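(* Let $\alpha\ge 0$ be an integer. For integers $b\ge0$, consider the set of symmetric transpose--complementary plane partitions $P$ contained in the box $[1,2\alpha+1]\times[1,2\alpha+1]\times[1,2b]$, and let $n(P)$ be the number of orbits of the map $(i,j,k)\mapsto(j,i,k)$ on the set $\{(i,j,k)\in P: k>b\}$ (equivalently, the number of cubes $(i,j,k)\in P$ with $i\le j$ and $k>b$). Then the weighted count $\sum_P(-1)^{n(P)}$ has the form \begin{align*} &\prod_{k=1}^{\alpha/2}(b/2+k)_{\alpha/2+1}\,(b+2\alpha+2)\cdot p_1(b) && \text{for $\alpha$ even and $b$ even},\\ &\prod_{k=1}^{\alpha/2}((b-1)/2+k)_{\alpha/2+1}\,(b-1)\cdot p_2(b) && \text{for $\alpha$ even and $b$ odd},\\ &\prod_{i=1}^{(\alpha+1)/2}((\alpha+b-1)/2-i+2)_{2i-1}\cdot p_3(b) && \text{for $\alpha$ odd and $b$ even},\\ &\prod_{i=1}^{(\alpha+1)/2}((b+\alpha)/2-i+1)_{2i-1}\cdot p_4(b) && \text{for $\alpha$ odd and $b$ odd}, \end{align*} where $p_1,p_2$ are polynomials (depending on $\alpha$) of degree $(\alpha/2)^2$, and $p_3,p_4$ are polynomials (depending on $\alpha$) of degree $(\alpha^2-1)/4$.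
   Context: A plane partition is a finite set $P$ of points $(i,j,k)$ with positive integer coordinates such that if $(i,j,k)\in P$ and $1\le i'\le i$, $1\le j'\le j$, $1\le k'\le k$, then $(i',j',k')\in P$. $P$ is contained in the box $[1,a]\times[1,a]\times[1,c]$ if $i\le a$, $j\le a$, $k\le c$ for all its points. $P$ is symmetric if $(i,j,k)\in P$ implies $(j,i,k)\in P$. $P$ (in the box $a\times a\times c$) is transpose--complementary if whenever $(i,j,k)\in P$ then $(a+1-j,a+1-i,c+1-k)\notin P$, for all $1\le i,j\le a$, $1\le k\le c$. $(x)_n=x(x+1)\cdots(x+n-1)$ denotes the shifted factorial; empty products equal $1$.
   Formalization: The degree of p_1, p_2 is corrected from (α/2)^2 to (α/2)^2−1; for α even the claim is made only for α>0, as it fails at α=0; transpose–complementary is read as: (i,j,k)∈P if and only if (a+1−j,a+1−i,c+1−k)∉P. *)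

theory Defs
  imports "HOL-Computational_Algebra.Polynomial"
begin

type_synonym point = "nat \<times> nat \<times> nat"

definition plane_partition :: "point set \<Rightarrow> bool" where
  "plane_partition P \<longleftrightarrow>
     finite P \<and>
     (\<forall>(i, j, k) \<in> P. 1 \<le> i \<and> 1 \<le> j \<and> 1 \<le> k) \<and>
     (\<forall>(i, j, k) \<in> P. \<forall>i' j' k'.
        1 \<le> i' \<and> i' \<le> i \<and> 1 \<le> j' \<and> j' \<le> j \<and> 1 \<le> k' \<and> k' \<le> k \<longrightarrow> (i', j', k') \<in> P)"

definition in_box :: "nat \<Rightarrow> nat \<Rightarrow> nat \<Rightarrow> point set \<Rightarrow> bool" where
  "in_box a b c P \<longleftrightarrow> P \<subseteq> {1..a} \<times> {1..b} \<times> {1..c}"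

definition symmetric_pp :: "point set \<Rightarrow> bool" where
  "symmetric_pp P \<longleftrightarrow> (\<forall>i j k. (i, j, k) \<in> P \<longrightarrow> (j, i, k) \<in> P)"

(* The complement of P in the box, reflected by (i, j, k) to (a+1-j, a+1-i, c+1-k), is P
   itself: of two points exchanged by this map exactly one lies in P.  No subtraction is
   truncated in the range considered. *)
definition transpose_complementary :: "nat \<Rightarrow> nat \<Rightarrow> point set \<Rightarrow> bool" where
  "transpose_complementary a c P \<longleftrightarrow>
     (\<forall>i \<in> {1..a}. \<forall>j \<in> {1..a}. \<forall>k \<in> {1..c}.
        (i, j, k) \<in> P \<longleftrightarrow> (a + 1 - j, a + 1 - i, c + 1 - k) \<notin> P)"

definition stc_pps :: "nat \<Rightarrow> nat \<Rightarrow> point set set" where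
  "stc_pps a c =
     {P. plane_partition P \<and> in_box a a c P \<and> symmetric_pp P \<and> transpose_complementary a c P}"

definition orbit_count :: "nat \<Rightarrow> point set \<Rightarrow> nat" where
  "orbit_count b P =
     card ((\<lambda>(i, j, k). {(i, j, k), (j, i, k)}) ` {(i, j, k). (i, j, k) \<in> P \<and> b < k})"

definition weighted_count :: "nat \<Rightarrow> nat \<Rightarrow> int" where
  "weighted_count \<alpha> b = (\<Sum>P \<in> stc_pps (2 * \<alpha> + 1) (2 * b). (-1) ^ orbit_count b P)"

end

theory Submission
  imports Defs
begin

text \<open>
  Let \<open>n\<close> be the parameter \<open>\<alpha>\<close>. The parts above height \<open>b\<close> of the plane partitions are symplectic
  Gelfand--Tsetlin patterns with \<open>2 * n\<close> rows. Summing out two rows at a time by telescoping shows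
  that the weighted count is the coefficient of \<open>e\<^sub>0 \<cdots> e\<^bsub>n-1\<^esub>\<close> in the degree \<open>n\<close> part of the product of
  \<open>1 + v M, \<dots>, 1 + v 1\<close> in a Grassmann algebra, where \<open>M = b + n\<close> and the \<open>n\<close> coordinates of
  the vector \<open>v l\<close> are the binomial coefficients of \<open>(l + k - 1) / 2\<close> over \<open>k\<close> if \<open>l + k\<close> is odd, and \<open>0\<close>
  otherwise, for \<open>0 \<le> k < n\<close>.

  This product equals \<open>(1 + T) * exp \<Omega>\<close> where \<open>T\<close> is the sum of the \<open>v l\<close>, and \<open>\<Omega>\<close> the sum of the
  products \<open>v l * v l'\<close> over \<open>l > l'\<close>. Both are polynomial in \<open>M\<close> on each parity class. Splitting the
  product at \<open>m \<le> n\<close> leaves at least \<open>n - m\<close> factors from the indices between \<open>m\<close> and \<open>M\<close>, and each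
  factor \<open>T\<close> or \<open>\<Omega>\<close> from this range vanishes for \<open>M = m\<close>; so the coefficient vanishes at \<open>M = m\<close> to the
  order \<open>(n - m) / 2\<close>, rounded up. The reflection of \<open>M\<close> to \<open>-1 - M\<close> exchanges the two parity classes and
  supplies the remaining roots. The leading coefficients satisfy a recursion that is solved by the
  products \<open>(x\<^sub>i - x\<^sub>j) / (x\<^sub>i + x\<^sub>j)\<close> of Schur's Pfaffian, which are not zero; this gives the degree.
\<close>

text \<open>The coefficient of a product of \<open>n\<close> vectors at \<open>{..<n}\<close> is the
  determinant of their coordinates. In a Grassmann algebra both row operations on such determinants
  and the summation of minors over all strictly decreasing index sequences are identities between
  ordered products. The shift \<open>M = b + n\<close> comes from turning partitions with
  \<open>n\<close> parts at most \<open>b\<close> into strictly decreasing sequences in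
  \<open>1..M\<close>.

  For even \<open>n\<close>, the vanishing orders at \<open>M \<le> n\<close> and their reflections
  account for the Pochhammer product only. The linear factors come from one more zero, at
  \<open>M = n + 1\<close>, that is \<open>b = 1\<close>; its reflection \<open>M = -2 - n\<close>
  is \<open>b = -2 * n - 2\<close>. Splitting the product gives nothing at this point; a contraction
  with a dual vector takes its place.

  The degree in \<open>M\<close> is \<open>n * (n + 1) / 2\<close> on both parity classes.
  Subtracting the number of forced linear factors leaves \<open>(n / 2)\<^sup>2 - 1\<close> for even
  \<open>n > 0\<close> and \<open>(n\<^sup>2 - 1) / 4\<close> for odd \<open>n\<close>.\<close>

text \<open>For disjoint sets, the sign of the permutation that sorts the elements of
  \<open>S\<close>, in increasing order, followed by those of \<open>T\<close>.\<close>

definition shuffle_sign :: "nat set \<Rightarrow> nat set \<Rightarrow> rat" where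
  "shuffle_sign S T = (\<Prod>s\<in>S. \<Prod>t\<in>T. if t < s then -1 else 1)"

lemma shuffle_sign_empty [simp]: "shuffle_sign {} T = 1" "shuffle_sign S {} = 1"
  by (simp_all add: shuffle_sign_def)

lemma shuffle_sign_Un_left: "finite S \<Longrightarrow> finite S' \<Longrightarrow> S \<inter> S' = {} \<Longrightarrow> shuffle_sign (S \<union> S') T = shuffle_sign S T * shuffle_sign S' T"
  by (simp add: shuffle_sign_def prod.union_disjoint)

lemma shuffle_sign_Un_right: "finite T \<Longrightarrow> finite T' \<Longrightarrow> T \<inter> T' = {} \<Longrightarrow> shuffle_sign S (T \<union> T') = shuffle_sign S T * shuffle_sign S T'"
  by (simp add: shuffle_sign_def prod.union_disjoint prod.distrib)

lemma shuffle_sign_square [simp]: "shuffle_sign S T * shuffle_sign S T = 1"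
proof -
  have "shuffle_sign S T * shuffle_sign S T = (\<Prod>s\<in>S. \<Prod>t\<in>T. (if t < s then -1 else 1) * (if t < s then -1 else 1))"
    by (simp add: shuffle_sign_def prod.distrib[symmetric])
  also have "\<dots> = 1" by (intro prod.neutral ballI) auto
  finally show ?thesis .
qed

lemma shuffle_sign_swap:
  assumes "finite S" "finite T" "S \<inter> T = {}"
  shows "shuffle_sign T S = (-1) ^ (card S * card T) * shuffle_sign S T"
proof -
  have "shuffle_sign T S * shuffle_sign S T = (\<Prod>s\<in>S. \<Prod>t\<in>T. (if s < t then -1 else 1)) * shuffle_sign S T"
    unfolding shuffle_sign_def by (subst prod.swap) simp
  also have "\<dots> = (\<Prod>s\<in>S. \<Prod>t\<in>T. (if s < t then -1 else 1) * (if t < s then -1 else 1))"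
    by (simp add: shuffle_sign_def prod.distrib[symmetric])
  also have "\<dots> = (\<Prod>s\<in>S. \<Prod>t\<in>T. -1)"
    using assms by (intro prod.cong) auto
  also have "\<dots> = (-1) ^ (card S * card T)"
    by (simp add: power_mult[symmetric] mult.commute)
  finally have "shuffle_sign T S * shuffle_sign S T * shuffle_sign S T = (-1) ^ (card S * card T) * shuffle_sign S T" by simp
  then show ?thesis by (simp add: mult.assoc)
qed

lemma shuffle_sign_singleton:
  assumes "finite K"
  shows "shuffle_sign {k} (K - {k}) = (-1) ^ card {j \<in> K. j < k}"
proof -
  have "shuffle_sign {k} (K - {k}) = (\<Prod>t\<in>K - {k}. if t < k then -1 else 1)"
    by (simp add: shuffle_sign_def)
  also have "\<dots> = (\<Prod>t\<in>K. if t < k then -1 else 1)"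
    by (rule prod.mono_neutral_left) (use assms in auto)
  also have "\<dots> = (\<Prod>t\<in>{j \<in> K. j < k}. -1)"
    using assms by (intro prod.mono_neutral_cong_right) auto
  finally show ?thesis by simp
qed

section \<open>The Grassmann algebra\<close>

text \<open>Finite support is not imposed, since the coefficient of a product at \<open>K\<close>
  involves only the subsets of \<open>K\<close>. At infinite \<open>K\<close> the sum over
  \<open>Pow K\<close> would be 0, so coefficients there are forced to vanish.\<close>

typedef grassmann = "{f :: nat set \<Rightarrow> rat. \<forall>K. infinite K \<longrightarrow> f K = 0}"
  morphisms cf Grassmann
  by (rule exI[of _ "\<lambda>_. 0"]) simp

setup_lifting type_definition_grassmann

lemma cf_infinite [simp]: "infinite K \<Longrightarrow> cf x K = 0"
  using cf[of x] by simp

lemma grassmann_eqI: "(\<And>K. finite K \<Longrightarrow> cf x K = cf y K) \<Longrightarrow> x = y"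
  by (metis cf_inject cf_infinite ext)

instantiation grassmann :: ring_1
begin

lift_definition zero_grassmann :: grassmann is "\<lambda>K. 0" by simp
lift_definition one_grassmann :: grassmann is "\<lambda>K. if K = {} then 1 else 0" by auto
lift_definition plus_grassmann :: "grassmann \<Rightarrow> grassmann \<Rightarrow> grassmann" is "\<lambda>f g K. f K + g K" by simp
lift_definition minus_grassmann :: "grassmann \<Rightarrow> grassmann \<Rightarrow> grassmann" is "\<lambda>f g K. f K - g K" by simp
lift_definition uminus_grassmann :: "grassmann \<Rightarrow> grassmann" is "\<lambda>f K. - f K" by simp
lift_definition times_grassmann :: "grassmann \<Rightarrow> grassmann \<Rightarrow> grassmann"
  is "\<lambda>f g K. \<Sum>S\<in>Pow K. shuffle_sign S (K - S) * f S * g (K - S)" by simp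

instance
proof
  fix x y z :: grassmann
  show "x + y + z = x + (y + z)" by transfer (simp add: add.assoc)
  show "x + y = y + x" by transfer (simp add: add.commute)
  show "0 + x = x" by transfer simp
  show "- x + x = 0" by transfer simp
  show "x - y = x + - y" by transfer simp
  show "(x + y) * z = x * z + y * z"
    by transfer (simp add: distrib_left distrib_right sum.distrib)
  show "x * (y + z) = x * y + x * z"
    by transfer (simp add: distrib_left distrib_right sum.distrib)
  show "(0 :: grassmann) \<noteq> 1"
    by transfer (auto simp: fun_eq_iff)
  show "1 * x = x"
  proof (rule grassmann_eqI)
    fix K :: "nat set" assume K: "finite K"
    have "cf (1 * x) K = (\<Sum>S\<in>Pow K. if S = {} then cf x K else 0)"
      unfolding times_grassmann.rep_eq one_grassmann.rep_eq
      by (intro sum.cong) auto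
    then show "cf (1 * x) K = cf x K" using K by simp
  qed
  show "x * 1 = x"
  proof (rule grassmann_eqI)
    fix K :: "nat set" assume K: "finite K"
    have "cf (x * 1) K = (\<Sum>S\<in>Pow K. if S = K then cf x K else 0)"
      unfolding times_grassmann.rep_eq one_grassmann.rep_eq
      by (intro sum.cong) auto
    then show "cf (x * 1) K = cf x K" using K by simp
  qed
  show "x * y * z = x * (y * z)"
  proof (rule grassmann_eqI)
    fix K :: "nat set" assume K: "finite K"
    then have fin: "finite S" if "S \<subseteq> K" for S using that finite_subset by blast
    have "cf (x * y * z) K = (\<Sum>(A, S)\<in>Sigma (Pow K) Pow.
        shuffle_sign A (K - A) * shuffle_sign S (A - S) * cf x S * cf y (A - S) * cf z (K - A))"
      unfolding times_grassmann.rep_eq using fin K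
      by (subst sum.Sigma[symmetric])
        (auto simp: sum_distrib_left sum_distrib_right mult_ac intro!: sum.cong)
    \<comment> \<open>Both sides sum over the ordered splittings of \<open>K\<close> into three
      blocks, \<open>A\<close> being the union of the first two. Either way the total sign is the
      product of the signs of the three pairs of blocks.\<close>
    also have "\<dots> = (\<Sum>(S, T)\<in>Sigma (Pow K) (\<lambda>S. Pow (K - S)).
        shuffle_sign S (K - S) * shuffle_sign T (K - S - T) * cf x S * cf y T * cf z (K - S - T))"
    proof (rule sum.reindex_bij_witness[where j = "\<lambda>(A, S). (S, A - S)" and i = "\<lambda>(S, T). (S \<union> T, S)"])
      fix p assume "p \<in> Sigma (Pow K) Pow"
      then obtain A S where p: "p = (A, S)" "S \<subseteq> A" "A \<subseteq> K" by auto
      have 1: "shuffle_sign A (K - A) = shuffle_sign S (K - A) * shuffle_sign (A - S) (K - A)"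
        using shuffle_sign_Un_left[of S "A - S" "K - A"] p fin[of S] fin[of "A - S"]
        by (simp add: Un_absorb1 subset_trans Diff_subset)
          (metis Diff_disjoint Un_Diff_cancel Un_absorb1 dual_order.trans fin finite_Diff)
      have "shuffle_sign S ((A - S) \<union> (K - A)) = shuffle_sign S (A - S) * shuffle_sign S (K - A)"
        using p fin K by (intro shuffle_sign_Un_right) auto
      moreover have "(A - S) \<union> (K - A) = K - S" using p by auto
      ultimately have 2: "shuffle_sign S (K - S) = shuffle_sign S (A - S) * shuffle_sign S (K - A)" by simp
      have 3: "K - S - (A - S) = K - A" using p by auto
      show "(case (case p of (A, S) \<Rightarrow> (S, A - S)) of (S, T) \<Rightarrow>
          shuffle_sign S (K - S) * shuffle_sign T (K - S - T) * cf x S * cf y T * cf z (K - S - T)) =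
        (case p of (A, S) \<Rightarrow> shuffle_sign A (K - A) * shuffle_sign S (A - S) * cf x S * cf y (A - S) * cf z (K - A))"
        by (simp add: p(1) 1 2 3 mult_ac)
    qed auto
    also have "\<dots> = cf (x * (y * z)) K"
      unfolding times_grassmann.rep_eq using fin K
      by (subst sum.Sigma[symmetric])
        (auto simp: sum_distrib_left sum_distrib_right mult_ac intro!: sum.cong)
    finally show "cf (x * y * z) K = cf (x * (y * z)) K" .
  qed
qed

end

lemma cf_simps [simp]:
  "cf 0 K = 0" "cf (x + y) K = cf x K + cf y K" "cf (x - y) K = cf x K - cf y K" "cf (- x) K = - cf x K"
  by (simp_all add: zero_grassmann.rep_eq plus_grassmann.rep_eq minus_grassmann.rep_eq uminus_grassmann.rep_eq)

lemmas cf_one = one_grassmann.rep_eq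
lemmas cf_mult = times_grassmann.rep_eq

lemma cf_sum [simp]: "cf (sum f A) K = (\<Sum>a\<in>A. cf (f a) K)"
  by (induction A rule: infinite_finite_induct) auto

lemma cf_of_nat_mult [simp]: "cf (of_nat m * x) K = of_nat m * cf x K"
  by (induction m) (auto simp: algebra_simps)

lemma cf_minus_one_power_mult [simp]: "cf ((-1) ^ m * x) K = (-1) ^ m * cf x K"
  by (induction m) (auto simp: mult.assoc)

lemma minus_one_power_commute: "(-1) ^ m * x = x * (-1 :: grassmann) ^ m"
  by (induction m) (auto simp: mult.assoc)

lemma cf_mult_minus_one_power: "cf (x * ((-1) ^ m * y)) K = (-1) ^ m * cf (x * y) K"
  by (metis cf_minus_one_power_mult minus_one_power_commute mult.assoc)

section \<open>Homogeneous elements and the exchange of factors\<close>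

definition homog :: "nat \<Rightarrow> grassmann \<Rightarrow> bool" where
  "homog r x \<longleftrightarrow> (\<forall>K. cf x K \<noteq> 0 \<longrightarrow> card K = r)"

lemma homogD: "homog r x \<Longrightarrow> card K \<noteq> r \<Longrightarrow> cf x K = 0"
  by (auto simp: homog_def)

lemma homog_zero [simp]: "homog r 0" and homog_one [simp]: "homog 0 1"
  by (auto simp: homog_def cf_one split: if_splits)

lemma homog_add: "homog r x \<Longrightarrow> homog r y \<Longrightarrow> homog r (x + y)"
  and homog_diff: "homog r x \<Longrightarrow> homog r y \<Longrightarrow> homog r (x - y)"
  by (auto simp: homog_def) (metis add_0 diff_0_right)+

lemma homog_sum: "(\<And>a. a \<in> A \<Longrightarrow> homog r (f a)) \<Longrightarrow> homog r (sum f A)"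
  by (induction A rule: infinite_finite_induct) (auto intro: homog_add)

lemma homog_minus_one_power: "homog r x \<Longrightarrow> homog r ((-1) ^ m * x)"
  by (auto simp: homog_def)

lemma homog_mult:
  assumes "homog r x" "homog s y"
  shows "homog (r + s) (x * y)"
  unfolding homog_def
proof (intro allI impI)
  fix K assume "cf (x * y) K \<noteq> 0"
  then have K: "finite K" using cf_infinite by blast
  from \<open>cf (x * y) K \<noteq> 0\<close> obtain S where S: "S \<subseteq> K" "cf x S \<noteq> 0" "cf y (K - S) \<noteq> 0"
    by (auto simp: cf_mult elim!: sum.not_neutral_contains_not_neutral)
  then show "card K = r + s"
    using assms K by (metis card_Diff_subset card_mono finite_subset homog_def le_add_diff_inverse)
qed

lemma mult_commute_even:
  assumes "homog 2 x"
  shows "x * y = y * x"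
proof (rule grassmann_eqI)
  fix K :: "nat set" assume K: "finite K"
  have "cf (x * y) K = (\<Sum>S\<in>Pow K. shuffle_sign (K - S) S * cf x (K - S) * cf y S)"
    unfolding cf_mult
    by (rule sum.reindex_bij_witness[where i = "\<lambda>S. K - S" and j = "\<lambda>S. K - S"]) (auto simp: double_diff)
  also have "\<dots> = (\<Sum>S\<in>Pow K. shuffle_sign S (K - S) * cf y S * cf x (K - S))"
  proof (rule sum.cong[OF refl])
    fix S assume "S \<in> Pow K"
    then have "finite S" using K by (auto dest: finite_subset)
    then have *: "shuffle_sign (K - S) S = (-1) ^ (card S * card (K - S)) * shuffle_sign S (K - S)"
      using K by (intro shuffle_sign_swap) auto
    show "shuffle_sign (K - S) S * cf x (K - S) * cf y S = shuffle_sign S (K - S) * cf y S * cf x (K - S)"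
    proof (cases "card (K - S) = 2")
      case True
      then show ?thesis by (simp add: *)
    next
      case False
      then show ?thesis using homogD[OF assms] by simp
    qed
  qed
  also have "\<dots> = cf (y * x) K" by (simp add: cf_mult)
  finally show "cf (x * y) K = cf (y * x) K" .
qed

lemma anticommute:
  assumes "homog 1 x" "homog 1 y"
  shows "x * y = - (y * x)"
proof (rule grassmann_eqI)
  fix K :: "nat set" assume K: "finite K"
  have "cf (x * y) K = (\<Sum>S\<in>Pow K. shuffle_sign (K - S) S * cf x (K - S) * cf y S)"
    unfolding cf_mult
    by (rule sum.reindex_bij_witness[where i = "\<lambda>S. K - S" and j = "\<lambda>S. K - S"]) (auto simp: double_diff)
  also have "\<dots> = (\<Sum>S\<in>Pow K. - (shuffle_sign S (K - S) * cf y S * cf x (K - S)))"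
  proof (rule sum.cong[OF refl])
    fix S assume "S \<in> Pow K"
    then have "finite S" using K by (auto dest: finite_subset)
    then have *: "shuffle_sign (K - S) S = (-1) ^ (card S * card (K - S)) * shuffle_sign S (K - S)"
      using K by (intro shuffle_sign_swap) auto
    show "shuffle_sign (K - S) S * cf x (K - S) * cf y S = - (shuffle_sign S (K - S) * cf y S * cf x (K - S))"
    proof (cases "card (K - S) = 1 \<and> card S = 1")
      case True
      then show ?thesis by (simp add: *)
    next
      case False
      then show ?thesis using homogD[OF assms(1)] homogD[OF assms(2)] by auto
    qed
  qed
  also have "\<dots> = cf (- (y * x)) K" by (simp add: cf_mult sum_negf)
  finally show "cf (x * y) K = cf (- (y * x)) K" .
qed

lemma vector_square [simp]: "homog 1 x \<Longrightarrow> x * x = 0"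
  using anticommute[of x x]
  by (intro grassmann_eqI) (metis cf_simps(1,4) equation_minus_iff neg_equal_zero)

text \<open>Expansion of a determinant along its first row: on the left only singletons contribute,
  with the sign of moving \<open>k\<close> to the front.\<close>

lemma cf_vector_mult:
  assumes "homog 1 v" "finite K"
  shows "cf (v * x) K = (\<Sum>k\<in>K. (-1) ^ card {j \<in> K. j < k} * cf v {k} * cf x (K - {k}))"
proof -
  have "cf (v * x) K = (\<Sum>S\<in>(\<lambda>k. {k}) ` K. shuffle_sign S (K - S) * cf v S * cf x (K - S))"
    unfolding cf_mult
  proof (rule sum.mono_neutral_right)
    show "\<forall>S\<in>Pow K - (\<lambda>k. {k}) ` K. shuffle_sign S (K - S) * cf v S * cf x (K - S) = 0"
    proof
      fix S assume S: "S \<in> Pow K - (\<lambda>k. {k}) ` K"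
      then have "card S \<noteq> 1" by (auto simp: card_1_singleton_iff)
      then show "shuffle_sign S (K - S) * cf v S * cf x (K - S) = 0" using homogD[OF assms(1)] by simp
    qed
  qed (use assms in auto)
  also have "\<dots> = (\<Sum>k\<in>K. shuffle_sign {k} (K - {k}) * cf v {k} * cf x (K - {k}))"
    by (subst sum.reindex) (auto simp: inj_on_def)
  finally show ?thesis using assms by (simp add: shuffle_sign_singleton)
qed

lift_definition vec :: "nat \<Rightarrow> (nat \<Rightarrow> rat) \<Rightarrow> grassmann"
  is "\<lambda>n c K. if is_singleton K \<and> the_elem K < n then c (the_elem K) else 0"
  by (auto simp: is_singleton_def)

lemma homog_vec [simp]: "homog (Suc 0) (vec n c)"
  by (auto simp: homog_def vec.rep_eq is_singleton_altdef)

lemma cf_vec [simp]: "cf (vec n c) {k} = (if k < n then c k else 0)"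
  by (simp add: vec.rep_eq)

lemma vector_eqI: "homog 1 x \<Longrightarrow> homog 1 y \<Longrightarrow> (\<And>k. cf x {k} = cf y {k}) \<Longrightarrow> x = y"
  by (rule grassmann_eqI) (metis card_1_singletonE homogD)

section \<open>Antidifferences of polynomials\<close>

lemma antidifference_poly:
  fixes p :: "rat poly"
  assumes "degree p \<le> d"
  shows "\<exists>q. poly q 0 = 0 \<and> (\<forall>x. poly q (x + 1) - poly q x = poly p x) \<and> degree q \<le> d + 1 \<and>
    coeff q (d + 1) = coeff p d / of_nat (d + 1)"
  using assms
proof (induction d arbitrary: p)
  case 0
  then obtain c where p: "p = [:c:]" using degree_0_id by (metis le_zero_eq)
  show ?case by (rule exI[of _ "[:0, c:]"]) (auto simp: p algebra_simps)
next
  case (Suc d)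
  \<comment> \<open>\<open>(x + 1) ^ (d + 2) - x ^ (d + 2)\<close> has degree \<open>d + 1\<close>
    and leading coefficient \<open>d + 2\<close>, so this \<open>c\<close> makes \<open>p'\<close>
    drop to degree \<open>d\<close>.\<close>
  define c where "c = coeff p (Suc d) / of_nat (Suc d + 1)"
  define s where "s = smult c (monom 1 (Suc (Suc d)))"
  define p' where "p' = p - smult c ([:1, 1:] ^ Suc (Suc d) - monom 1 (Suc (Suc d)))"
  have "degree p' \<le> d"
  proof (rule degree_le, intro allI impI)
    fix i assume i: "d < i"
    consider "i = Suc d" | "i = Suc (Suc d)" | "i > Suc (Suc d)" using i by linarith
    then show "coeff p' i = 0"
    proof cases
      case 1
      then show ?thesis by (simp add: p'_def coeff_linear_poly_power c_def del: power_Suc)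
    next
      case 2
      then show ?thesis using Suc.prems
        by (simp add: p'_def coeff_linear_poly_power coeff_eq_0 del: power_Suc)
    next
      case 3
      then show ?thesis using Suc.prems
        by (simp add: p'_def degree_linear_power coeff_eq_0 del: power_Suc)
    qed
  qed
  from Suc.IH[OF this] obtain q where q: "poly q 0 = 0" "\<And>x. poly q (x + 1) - poly q x = poly p' x"
    "degree q \<le> d + 1" by blast
  show ?case
  proof (rule exI[of _ "q + s"], intro conjI allI)
    show "poly (q + s) 0 = 0" by (simp add: q s_def poly_monom)
    show "poly (q + s) (x + 1) - poly (q + s) x = poly p x" for x
      using q(2)[of x] by (simp add: s_def p'_def poly_monom algebra_simps del: power_Suc)
    show "degree (q + s) \<le> Suc d + 1"
      using q(3) by (intro degree_add_le) (auto simp: s_def intro: degree_monom_le order_trans[OF degree_smult_le])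
    show "coeff (q + s) (Suc d + 1) = coeff p (Suc d) / of_nat (Suc d + 1)"
      using q(3) by (simp add: s_def coeff_eq_0 c_def)
  qed
qed

lemma poly_eq_if_eq_on_nat:
  fixes p q :: "rat poly"
  assumes "\<And>y :: nat. poly p (of_nat y) = poly q (of_nat y)"
  shows "p = q"
proof (rule ccontr)
  assume "p \<noteq> q"
  then have "finite {x. poly (p - q) x = 0}" by (intro poly_roots_finite) simp
  moreover have "range (of_nat :: nat \<Rightarrow> rat) \<subseteq> {x. poly (p - q) x = 0}" using assms by auto
  ultimately show False
    using finite_subset range_inj_infinite[OF inj_of_nat] by blast
qed

section \<open>Functions of an integer that are polynomial multiples of a power\<close>

text \<open>Vanishing to order \<open>r\<close> at 0. The argument runs over all integers because
  the reflection evaluates the same polynomials at negative points.\<close>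

definition poly_order_ge :: "nat \<Rightarrow> (int \<Rightarrow> rat) \<Rightarrow> bool" where
  "poly_order_ge r f \<longleftrightarrow> (\<exists>p. \<forall>y. f y = of_int y ^ r * poly p (of_int y))"

lemma poly_order_geI: "(\<And>y. f y = of_int y ^ r * poly p (of_int y)) \<Longrightarrow> poly_order_ge r f"
  by (auto simp: poly_order_ge_def)

lemma poly_order_ge_zero_iff: "poly_order_ge 0 f \<longleftrightarrow> (\<exists>p. \<forall>y. f y = poly p (of_int y))"
  by (simp add: poly_order_ge_def)

lemma poly_order_ge_0 [simp]: "poly_order_ge r (\<lambda>y. 0)"
  by (rule poly_order_geI[of _ _ 0]) simp

lemma poly_order_ge_const [simp]: "poly_order_ge 0 (\<lambda>y. c)"
  by (rule poly_order_geI[of _ _ "[:c:]"]) simp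

lemma poly_order_ge_add: "poly_order_ge r f \<Longrightarrow> poly_order_ge r g \<Longrightarrow> poly_order_ge r (\<lambda>y. f y + g y)"
  unfolding poly_order_ge_def by (metis distrib_left poly_add)

lemma poly_order_ge_mult: "poly_order_ge r f \<Longrightarrow> poly_order_ge s g \<Longrightarrow> poly_order_ge (r + s) (\<lambda>y. f y * g y)"
proof -
  assume "poly_order_ge r f" "poly_order_ge s g"
  then obtain p q where "\<And>y. f y = of_int y ^ r * poly p (of_int y)" "\<And>y. g y = of_int y ^ s * poly q (of_int y)"
    by (auto simp: poly_order_ge_def)
  then show ?thesis by (intro poly_order_geI[of _ _ "p * q"]) (simp add: power_add)
qed

lemma poly_order_ge_cmult: "poly_order_ge r f \<Longrightarrow> poly_order_ge r (\<lambda>y. c * f y)"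
  using poly_order_ge_mult[of 0 "\<lambda>_. c" r f] by simp

lemma poly_order_ge_sum: "(\<And>a. a \<in> A \<Longrightarrow> poly_order_ge r (f a)) \<Longrightarrow> poly_order_ge r (\<lambda>y. \<Sum>a\<in>A. f a y)"
  by (induction A rule: infinite_finite_induct) (auto intro: poly_order_ge_add)

lemma poly_order_ge_mono: "poly_order_ge r f \<Longrightarrow> s \<le> r \<Longrightarrow> poly_order_ge s f"
proof -
  assume "poly_order_ge r f" "s \<le> r"
  then obtain p where "\<And>y. f y = of_int y ^ r * poly p (of_int y)" by (auto simp: poly_order_ge_def)
  then show ?thesis using \<open>s \<le> r\<close>
    by (intro poly_order_geI[of _ _ "monom 1 (r - s) * p"])
      (simp add: poly_monom mult.assoc[symmetric] power_add[symmetric])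
qed

lemma poly_order_ge_antidifference:
  assumes "f 0 = 0" "poly_order_ge 0 (\<lambda>y. f (y + 1) - f y)"
  shows "poly_order_ge 1 f"
proof -
  obtain p where p: "\<And>y. f (y + 1) - f y = poly p (of_int y)" using assms by (auto simp: poly_order_ge_def)
  obtain q where q: "poly q 0 = 0" "\<And>x. poly q (x + 1) - poly q x = poly p x"
    using antidifference_poly[OF order_refl] by blast
  have eq: "f y = poly q (of_int y)" for y
  proof (induction y rule: int_induct[of _ 0])
    case base
    then show ?case by (simp add: assms q)
  next
    case (step1 i)
    then show ?case using p[of i] q(2)[of "of_int i"] by simp
  next
    case (step2 i)
    then show ?case using p[of "i - 1"] q(2)[of "of_int (i - 1)"] by simp
  qed
  obtain q' where "q = [:0, 1:] * q'" using q(1) by (metis dvdE poly_eq_0_iff_dvd minus_zero)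
  then show ?thesis by (intro poly_order_geI[of _ _ q']) (simp add: eq)
qed

definition coeffs_order_ge :: "nat \<Rightarrow> (int \<Rightarrow> grassmann) \<Rightarrow> bool" where
  "coeffs_order_ge r F \<longleftrightarrow> (\<forall>K. poly_order_ge r (\<lambda>y. cf (F y) K))"

lemma coeffs_order_ge_const: "coeffs_order_ge 0 (\<lambda>y. x)"
  by (simp add: coeffs_order_ge_def)

lemma coeffs_order_ge_add: "coeffs_order_ge r F \<Longrightarrow> coeffs_order_ge r G \<Longrightarrow> coeffs_order_ge r (\<lambda>y. F y + G y)"
  by (simp add: coeffs_order_ge_def poly_order_ge_add)

lemma coeffs_order_ge_mono: "coeffs_order_ge r F \<Longrightarrow> s \<le> r \<Longrightarrow> coeffs_order_ge s F"
  by (auto simp: coeffs_order_ge_def intro: poly_order_ge_mono)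

lemma coeffs_order_ge_mult: "coeffs_order_ge r F \<Longrightarrow> coeffs_order_ge s G \<Longrightarrow> coeffs_order_ge (r + s) (\<lambda>y. F y * G y)"
  unfolding coeffs_order_ge_def cf_mult by (intro allI poly_order_ge_sum poly_order_ge_mult[OF poly_order_ge_cmult]) auto

lemma coeffs_order_ge_power: "coeffs_order_ge r F \<Longrightarrow> coeffs_order_ge (i * r) (\<lambda>y. F y ^ i)"
  by (induction i) (auto simp: coeffs_order_ge_const intro: coeffs_order_ge_mult)

lemma coeffs_order_ge_antidifference:
  assumes "F 0 = 0" "coeffs_order_ge 0 (\<lambda>y. F (y + 1) - F y)"
  shows "coeffs_order_ge 1 F"
  using assms unfolding coeffs_order_ge_def by (auto intro!: poly_order_ge_antidifference[unfolded One_nat_def])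

section \<open>Summation over integer ranges\<close>

text \<open>The subtracted sum continues the summation to negative \<open>M\<close> such that the
  step from \<open>M\<close> to \<open>M + 1\<close> is \<open>g (M + 1)\<close> for every integer
  \<open>M\<close>. In particular \<open>int_sum g (-1) = - g 0\<close>.\<close>

definition int_sum :: "(int \<Rightarrow> 'a :: ab_group_add) \<Rightarrow> int \<Rightarrow> 'a" where
  "int_sum g M = sum g {1..M} - sum g {M + 1..0}"

lemma int_sum_0 [simp]: "int_sum g 0 = 0"
  by (simp add: int_sum_def)

lemma int_sum_step: "int_sum g (M + 1) = int_sum g M + g (M + 1)"
proof (cases "M \<ge> 0")
  case True
  then have "{1..M + 1} = insert (M + 1) {1..M}" by auto
  with True show ?thesis by (simp add: int_sum_def)
next
  case False
  then have "{M + 1..0} = insert (M + 1) {M + 2..0}" by auto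
  with False show ?thesis by (simp add: int_sum_def add.commute)
qed

lemma int_sum_unique:
  assumes "f 0 = 0" "\<And>M. f (M + 1) = f M + g (M + 1)"
  shows "f M = int_sum g M"
proof (induction M rule: int_induct[of _ 0])
  case (step2 i)
  then show ?case using assms(2)[of "i - 1"] int_sum_step[of g "i - 1"] by simp
qed (simp_all add: assms int_sum_step)

lemma homog_int_sum: "(\<And>l. homog r (g l)) \<Longrightarrow> homog r (int_sum g M)"
  by (simp add: int_sum_def homog_diff homog_sum)

section \<open>Products over decreasing index sequences\<close>

text \<open>The part of degree \<open>r\<close> of the ordered product: the sum of
  \<open>v l\<^sub>1 * ... * v l\<^sub>r\<close> over
  \<open>M \<ge> l\<^sub>1 > ... > l\<^sub>r \<ge> 1\<close>, with larger indices to the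
  left.\<close>

primrec esum :: "(int \<Rightarrow> grassmann) \<Rightarrow> nat \<Rightarrow> nat \<Rightarrow> grassmann" where
  "esum v 0 r = (if r = 0 then 1 else 0)"
| "esum v (Suc M) r = esum v M r + (case r of 0 \<Rightarrow> 0 | Suc q \<Rightarrow> v (int M + 1) * esum v M q)"

definition pairsum :: "(int \<Rightarrow> grassmann) \<Rightarrow> int \<Rightarrow> grassmann" where
  "pairsum v = int_sum (\<lambda>l. v l * int_sum v (l - 1))"

lemma pairsum_0 [simp]: "pairsum v 0 = 0"
  by (simp add: pairsum_def)

lemma pairsum_step: "pairsum v (M + 1) = pairsum v M + v (M + 1) * int_sum v M"
  by (simp add: pairsum_def int_sum_step)

lemma of_nat_left_commute: "of_nat m * (x * y) = x * (of_nat m * (y :: 'a :: semiring_1))"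
  by (metis mult.assoc mult_of_nat_commute)

lemma power_add_square_zero:
  fixes a b :: "'a :: ring_1"
  assumes "a * b = b * a" "b * b = 0"
  shows "(a + b) ^ Suc i = a ^ Suc i + of_nat (Suc i) * a ^ i * b"
proof (induction i)
  case (Suc i)
  have c: "b * a ^ n = a ^ n * b" for n using assms(1) by (metis power_commuting_commutes)
  have "(a + b) ^ Suc (Suc i) = (a ^ Suc i + of_nat (Suc i) * a ^ i * b) * (a + b)"
    unfolding Suc.IH[symmetric] by (rule power_Suc2)
  also have "\<dots> = a ^ Suc (Suc i) + (a ^ Suc i * b + of_nat (Suc i) * (a ^ i * a * b))"
    by (simp add: distrib_left distrib_right mult.assoc assms(1)[symmetric] assms(2) power_Suc2 del: power_Suc)
  also have "\<dots> = a ^ Suc (Suc i) + of_nat (Suc (Suc i)) * a ^ Suc i * b"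
    by (simp add: distrib_right mult.assoc power_Suc2 del: power_Suc)
  finally show ?case .
qed simp

lemma esum_0_right [simp]: "esum v M 0 = 1"
  by (induction M) auto

lemma esum_eq_0: "M < r \<Longrightarrow> esum v M r = 0"
  by (induction M arbitrary: r) (auto split: nat.split)

text \<open>The ordered product factors at \<open>m\<close>, indices above \<open>m\<close> standing
  on the left; \<open>j\<close> counts the vectors taken from the indices up to
  \<open>m\<close>.\<close>

lemma esum_split: "esum v (m + N) r = (\<Sum>j\<le>r. esum (\<lambda>l. v (l + int m)) N (r - j) * esum v m j)"
proof (induction N arbitrary: r)
  case 0
  have "(\<Sum>j\<le>r. esum (\<lambda>l. v (l + int m)) 0 (r - j) * esum v m j) = (\<Sum>j\<le>r. if j = r then esum v m j else 0)"
    by (intro sum.cong) auto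
  then show ?case by simp
next
  case (Suc N)
  show ?case
  proof (cases r)
    case (Suc q)
    let ?w = "\<lambda>l. v (l + int m)"
    have "esum v (m + Suc N) r = esum v (m + N) (Suc q) + v (int N + 1 + int m) * esum v (m + N) q"
      by (simp add: Suc algebra_simps)
    also have "\<dots> = (\<Sum>j\<le>q. esum ?w N (Suc q - j) * esum v m j) + esum v m (Suc q)
        + (\<Sum>j\<le>q. ?w (int N + 1) * esum ?w N (q - j) * esum v m j)"
      by (simp add: Suc.IH sum_distrib_left mult.assoc)
    also have "\<dots> = (\<Sum>j\<le>q. esum ?w (Suc N) (Suc q - j) * esum v m j) + esum v m (Suc q)"
      by (simp add: sum.distrib[symmetric] Suc_diff_le distrib_right)
    also have "\<dots> = (\<Sum>j\<le>r. esum ?w (Suc N) (r - j) * esum v m j)" by (simp add: Suc)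
    finally show ?thesis .
  qed simp
qed

locale vector_sequence =
  fixes v :: "int \<Rightarrow> grassmann"
  assumes vector [simp]: "homog (Suc 0) (v l)"
    and polynomial: "coeffs_order_ge 0 (\<lambda>y. v (2 * y + c))"
begin

lemma vector_int_sum [simp]: "homog (Suc 0) (int_sum v M)"
  by (simp add: homog_int_sum)

lemma homog_pairsum: "homog 2 (pairsum v M)"
  unfolding pairsum_def using homog_mult[of 1 _ 1] by (intro homog_int_sum) (simp add: numeral_2_eq_2)

lemma pairsum_commute: "pairsum v M * x = x * pairsum v M"
  by (rule mult_commute_even[OF homog_pairsum])

text \<open>The decreasing products assemble to \<open>(1 + int_sum v M) * exp (pairsum v M)\<close>; this plays the
  role of the expansion of a Pfaffian.\<close>

lemma esum_eq_pairsum_power: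
  "of_nat (fact i) * esum v M (2 * i) = pairsum v (int M) ^ i"
  "of_nat (fact i) * esum v M (2 * i + 1) = pairsum v (int M) ^ i * int_sum v (int M)"
proof (induction M arbitrary: i)
  case 0
  {
    case 1
    show ?case by (cases i) auto
  next
    case 2
    show ?case by simp
  }
next
  case (Suc M)
  define w T a where "w = v (int M + 1)" and "T = int_sum v (int M)" and "a = pairsum v (int M)"
  have w: "homog 1 w" and T: "homog 1 T" by (simp_all add: w_def T_def)
  have ac: "a * x = x * a" for x unfolding a_def by (rule pairsum_commute)
  then have apc: "a ^ j * x = x * a ^ j" for j x by (metis power_commuting_commutes)
  have "w * T * (w * T) = w * (T * w) * T" by (simp add: mult.assoc)
  also have "\<dots> = 0" by (subst anticommute[OF T w]) (simp add: mult.assoc[symmetric] vector_square[OF w])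
  finally have sq: "w * T * (w * T) = 0" .
  have pw: "(a + w * T) ^ Suc j = a ^ Suc j + of_nat (Suc j) * a ^ j * (w * T)" for j
    by (rule power_add_square_zero) (use ac sq in auto)
  have step: "pairsum v (int (Suc M)) = a + w * T" "int_sum v (int (Suc M)) = T + w"
    using pairsum_step[of v "int M"] int_sum_step[of v "int M"]
    by (simp_all add: a_def w_def T_def add.commute)
  {
    case 1
    show ?case
    proof (cases i)
      case (Suc j)
      have "of_nat (fact i) * esum v (Suc M) (2 * i) =
          of_nat (fact i) * esum v M (2 * i) + of_nat (fact i) * (w * esum v M (2 * j + 1))"
        by (simp add: Suc w_def distrib_left)
      also have "of_nat (fact i) * (w * esum v M (2 * j + 1)) =
          of_nat i * (w * (of_nat (fact j) * esum v M (2 * j + 1)))"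
        by (simp only: Suc fact_Suc of_nat_mult of_nat_id mult.assoc of_nat_left_commute[of _ w])
      also have "\<dots> = of_nat i * (a ^ j * (w * T))"
        unfolding Suc.IH(2) a_def[symmetric] T_def[symmetric]
        by (simp only: mult.assoc[symmetric] apc[of j w])
      finally show ?thesis
        unfolding Suc.IH(1) a_def[symmetric] step(1) by (simp only: Suc pw mult.assoc)
    qed simp
  next
    case 2
    \<comment> \<open>\<open>(a + w * T) ^ i\<close> and \<open>a ^ i\<close> differ by a multiple
      of \<open>w * T\<close>, and \<open>w * T\<close> annihilates \<open>T + w\<close>.\<close>
    have z: "w * T * (T + w) = 0"
    proof -
      have "w * T * (T + w) = w * (T * T) - w * w * T"
        by (simp add: distrib_left mult.assoc anticommute[OF T w])
      then show ?thesis by (simp only: vector_square[OF w] vector_square[OF T]) simp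
    qed
    have "of_nat (fact i) * esum v (Suc M) (2 * i + 1) =
        of_nat (fact i) * esum v M (2 * i + 1) + w * (of_nat (fact i) * esum v M (2 * i))"
      by (simp add: w_def distrib_left of_nat_left_commute[of _ "v (int M + 1)"])
    also have "\<dots> = a ^ i * (T + w)"
      unfolding Suc.IH a_def[symmetric] T_def[symmetric] by (simp only: distrib_left apc[of i w])
    also have "\<dots> = (a + w * T) ^ i * (T + w)"
    proof (cases i)
      case (Suc j)
      show ?thesis unfolding Suc pw using z by (simp add: distrib_right mult.assoc del: power_Suc)
    qed simp
    finally show ?case by (simp only: step)
  }
qed

text \<open>\<open>fact (r div 2)\<close> times the part of degree \<open>r\<close>, continued from
  natural \<open>M\<close> to all integers.\<close>

definition ext_esum :: "nat \<Rightarrow> int \<Rightarrow> grassmann" where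
  "ext_esum r M = pairsum v M ^ (r div 2) * (if even r then 1 else int_sum v M)"

lemma cf_esum: "cf (esum v M r) K = cf (ext_esum r (int M)) K / of_nat (fact (r div 2))"
proof -
  have "of_nat (fact (r div 2)) * esum v M r = ext_esum r (int M)"
    unfolding ext_esum_def
  proof (cases "even r")
    case True
    then have "2 * (r div 2) = r" by simp
    with True esum_eq_pairsum_power(1)[of "r div 2" M]
    show "of_nat (fact (r div 2)) * esum v M r = pairsum v (int M) ^ (r div 2) * (if even r then 1 else int_sum v (int M))"
      by (simp only: if_True mult_1_right)
  next
    case False
    then have "2 * (r div 2) + 1 = r" by simp
    with False esum_eq_pairsum_power(2)[of "r div 2" M]
    show "of_nat (fact (r div 2)) * esum v M r = pairsum v (int M) ^ (r div 2) * (if even r then 1 else int_sum v (int M))"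
      by (simp only: if_False)
  qed
  then have "cf (of_nat (fact (r div 2)) * esum v M r) K = cf (ext_esum r (int M)) K" by simp
  then show ?thesis by (simp add: field_simps)
qed

lemma coeffs_order_ge_int_sum: "coeffs_order_ge 1 (\<lambda>y. int_sum v (2 * y))"
proof (rule coeffs_order_ge_antidifference)
  have "int_sum v (2 * (y + 1)) - int_sum v (2 * y) = v (2 * y + 1) + v (2 * y + 2)" for y
    using int_sum_step[of v "2 * y"] int_sum_step[of v "2 * y + 1"] by (simp add: algebra_simps)
  then show "coeffs_order_ge 0 (\<lambda>y. int_sum v (2 * (y + 1)) - int_sum v (2 * y))"
    by (simp add: coeffs_order_ge_add polynomial)
qed simp

lemma coeffs_order_ge_pairsum: "coeffs_order_ge 1 (\<lambda>y. pairsum v (2 * y))"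
proof (rule coeffs_order_ge_antidifference)
  have "pairsum v (2 * (y + 1)) - pairsum v (2 * y) =
      v (2 * y + 1) * int_sum v (2 * y) + v (2 * y + 2) * (int_sum v (2 * y) + v (2 * y + 1))" for y
    using pairsum_step[of v "2 * y"] pairsum_step[of v "2 * y + 1"] int_sum_step[of v "2 * y"]
    by (simp add: algebra_simps)
  moreover have "coeffs_order_ge 0 (\<lambda>y. int_sum v (2 * y))" using coeffs_order_ge_int_sum by (rule coeffs_order_ge_mono) simp
  ultimately show "coeffs_order_ge 0 (\<lambda>y. pairsum v (2 * (y + 1)) - pairsum v (2 * y))"
    using coeffs_order_ge_mult[of 0 _ 0] by (simp add: coeffs_order_ge_add polynomial)
qed simp

text \<open>There are \<open>r div 2\<close> factors \<open>pairsum\<close> and, for odd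
  \<open>r\<close>, one factor \<open>int_sum\<close>: together \<open>(r + 1) div 2\<close>
  factors, each vanishing at \<open>y = 0\<close>.\<close>

lemma coeffs_order_ge_ext_esum_even: "coeffs_order_ge ((r + 1) div 2) (\<lambda>y. ext_esum r (2 * y))"
proof (cases "even r")
  case True
  then have "(r + 1) div 2 = r div 2" by auto
  with True show ?thesis using coeffs_order_ge_power[OF coeffs_order_ge_pairsum, of "r div 2"] by (simp add: ext_esum_def)
next
  case False
  then have "(r + 1) div 2 = r div 2 * 1 + 1" by auto
  with False show ?thesis
    using coeffs_order_ge_mult[OF coeffs_order_ge_power[OF coeffs_order_ge_pairsum, of "r div 2"] coeffs_order_ge_int_sum] by (simp add: ext_esum_def)
qed

lemma coeffs_order_ge_ext_esum_odd: "coeffs_order_ge 0 (\<lambda>y. ext_esum r (2 * y + 1))"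
proof -
  have i: "coeffs_order_ge 0 (\<lambda>y. int_sum v (2 * y))" and p: "coeffs_order_ge 0 (\<lambda>y. pairsum v (2 * y))"
    using coeffs_order_ge_int_sum coeffs_order_ge_pairsum by (auto intro: coeffs_order_ge_mono)
  have "coeffs_order_ge 0 (\<lambda>y. int_sum v (2 * y + 1))"
    using coeffs_order_ge_add[OF i polynomial[of 1]] by (simp add: int_sum_step)
  moreover have "coeffs_order_ge 0 (\<lambda>y. pairsum v (2 * y + 1))"
    using coeffs_order_ge_add[OF p coeffs_order_ge_mult[OF polynomial[of 1] i, simplified]] by (simp add: pairsum_step)
  ultimately show ?thesis
    using coeffs_order_ge_mult[OF coeffs_order_ge_power[of 0]] coeffs_order_ge_const[of 1]
    by (cases "even r") (fastforce simp: ext_esum_def)+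
qed

lemma vector_sequence_shift: "vector_sequence (\<lambda>l. v (l + c))"
  by unfold_locales (auto simp: add.assoc polynomial)

lemma esum_vanishing_order:
  "\<exists>p. \<forall>y :: nat. cf (esum v (m + 2 * y) n) K = of_nat y ^ ((n - m + 1) div 2) * poly p (of_nat y)"
proof -
  interpret w: vector_sequence "\<lambda>l. v (l + int m)" by (rule vector_sequence_shift)
  let ?r = "(n - m + 1) div 2"
  \<comment> \<open>With \<open>j \<le> m\<close> vectors from the indices up to \<open>m\<close>,
    at least \<open>n - m\<close> come from the shifted sequence. Terms with \<open>j > m\<close>
    are 0 because \<open>esum v m j = 0\<close>; hence the case distinction in
    \<open>?f\<close>.\<close>
  have "coeffs_order_ge ?r (\<lambda>y. w.ext_esum (n - j) (2 * y))" if "j \<le> m" for j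
    using w.coeffs_order_ge_ext_esum_even by (rule coeffs_order_ge_mono) (use that in \<open>auto intro: div_le_mono\<close>)
  then have j: "poly_order_ge ?r (\<lambda>y. cf (w.ext_esum (n - j) (2 * y)) S)" if "j \<le> m" for j S
    using that by (auto simp: coeffs_order_ge_def)
  let ?f = "\<lambda>y. \<Sum>j\<in>{..n}. if j \<le> m then \<Sum>S\<in>Pow K. shuffle_sign S (K - S) / of_nat (fact ((n - j) div 2))
    * cf (esum v m j) (K - S) * cf (w.ext_esum (n - j) (2 * y)) S else 0"
  have "poly_order_ge ?r (\<lambda>y. if j \<le> m then \<Sum>S\<in>Pow K. shuffle_sign S (K - S) / of_nat (fact ((n - j) div 2))
    * cf (esum v m j) (K - S) * cf (w.ext_esum (n - j) (2 * y)) S else 0)" for j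
    by (cases "j \<le> m") (simp_all only: if_True if_False poly_order_ge_0, intro poly_order_ge_sum poly_order_ge_cmult j)
  then have "poly_order_ge ?r ?f" by (intro poly_order_ge_sum) auto
  then obtain p where p: "\<And>y. ?f y = of_int y ^ ?r * poly p (of_int y)" by (auto simp: poly_order_ge_def)
  have eq: "cf (esum v (m + 2 * y) n) K = ?f (int y)" for y
    by (auto simp: esum_split esum_eq_0 cf_mult w.cf_esum mult_ac intro!: sum.cong)
  have "cf (esum v (m + 2 * y) n) K = of_nat y ^ ?r * poly p (of_nat y)" for y
    using trans[OF eq p] by (simp only: of_int_of_nat_eq)
  then show ?thesis by blast
qed

end

section \<open>Reflection\<close>

text \<open>The algebra endomorphism that multiplies the generator \<open>k\<close> by
  \<open>s k\<close>. With suitable signs it absorbs the parities of the coordinates of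
  \<open>v l\<close> when \<open>l\<close> becomes \<open>- l\<close>.\<close>

lift_definition twist :: "(nat \<Rightarrow> rat) \<Rightarrow> grassmann \<Rightarrow> grassmann"
  is "\<lambda>s f K. (\<Prod>k\<in>K. s k) * f K" by simp

lemmas cf_twist = twist.rep_eq

lemma twist_simps [simp]: "twist s 0 = 0" "twist s 1 = 1" "twist s (x + y) = twist s x + twist s y"
  "twist s (- x) = - twist s x" "twist s (x - y) = twist s x - twist s y"
  by (transfer, auto simp: fun_eq_iff algebra_simps)+

lemma twist_mult [simp]: "twist s (x * y) = twist s x * twist s y"
proof (rule grassmann_eqI)
  fix K :: "nat set" assume K: "finite K"
  have "(\<Prod>k\<in>K. s k) = (\<Prod>k\<in>S. s k) * (\<Prod>k\<in>K - S. s k)" if "S \<subseteq> K" for S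
    using K that by (simp add: prod.subset_diff mult.commute)
  then show "cf (twist s (x * y)) K = cf (twist s x * twist s y) K"
    by (auto simp: cf_twist cf_mult sum_distrib_left mult_ac intro!: sum.cong)
qed

lemma twist_power [simp]: "twist s (x ^ i) = twist s x ^ i"
  by (induction i) auto

context vector_sequence
begin

context
  fixes s
  assumes v_0: "v 0 = 0" and v_minus: "\<And>l. twist s (v (- l)) = - v l"
begin

text \<open>Both sides have the same increments in \<open>M\<close>. At \<open>M = 0\<close> the
  left side is the twist of \<open>int_sum v (-1) = - v 0\<close>, which is 0.\<close>

lemma int_sum_reflect: "twist s (int_sum v (-1 - M)) = int_sum v M"
proof (rule int_sum_unique[where f = "\<lambda>M. twist s (int_sum v (-1 - M))"])
  show "twist s (int_sum v (-1 - 0)) = 0"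
    using int_sum_step[of v "-1"] by (simp add: v_0)
  show "twist s (int_sum v (-1 - (M + 1))) = twist s (int_sum v (-1 - M)) + v (M + 1)" for M
  proof -
    have "int_sum v (-1 - M) = int_sum v (-1 - (M + 1)) + v (- (M + 1))"
      using int_sum_step[of v "-1 - (M + 1)"] by (simp add: minus_diff_commute)
    then show ?thesis by (simp only: twist_simps v_minus add_uminus_conv_diff diff_add_cancel)
  qed
qed

lemma pairsum_reflect: "twist s (pairsum v (-1 - M)) = pairsum v M"
  unfolding pairsum_def[of v, THEN fun_cong, of M]
proof (rule int_sum_unique[where f = "\<lambda>M. twist s (pairsum v (-1 - M))"])
  show "twist s (pairsum v (-1 - 0)) = 0"
    using pairsum_step[of v "-1"] by (simp add: v_0)
  show "twist s (pairsum v (-1 - (M + 1))) = twist s (pairsum v (-1 - M)) + v (M + 1) * int_sum v (M + 1 - 1)" for M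
  proof -
    have "pairsum v (-1 - M) = pairsum v (-1 - (M + 1)) + v (- (M + 1)) * int_sum v (-1 - (M + 1))"
      using pairsum_step[of v "-1 - (M + 1)"] by (simp add: minus_diff_commute)
    then have "twist s (pairsum v (-1 - M)) = twist s (pairsum v (-1 - (M + 1))) - v (M + 1) * int_sum v (M + 1)"
      by (simp only: twist_simps twist_mult v_minus int_sum_reflect mult_minus_left add_uminus_conv_diff)
    \<comment> \<open>\<open>v (M + 1)\<close> squares to 0, so the factor
      \<open>int_sum v (M + 1)\<close> may be replaced by \<open>int_sum v M\<close>.\<close>
    then show ?thesis by (simp add: int_sum_step distrib_left)
  qed
qed

lemma ext_esum_reflect: "twist s (ext_esum r (-1 - M)) = ext_esum r M"
  by (simp add: ext_esum_def pairsum_reflect int_sum_reflect)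

end

end

section \<open>Degrees and leading coefficients\<close>

text \<open>\<open>d\<close> is a formal degree and \<open>c\<close> may be 0, so that contributions
  of lower degree are added as terms with leading coefficient 0.\<close>

definition lead :: "nat \<Rightarrow> rat \<Rightarrow> (nat \<Rightarrow> rat) \<Rightarrow> bool" where
  "lead d c f \<longleftrightarrow> (\<exists>p. degree p \<le> d \<and> coeff p d = c \<and> (\<forall>y. f y = poly p (of_nat y)))"

lemma leadI: "degree p \<le> d \<Longrightarrow> coeff p d = c \<Longrightarrow> (\<And>y. f y = poly p (of_nat y)) \<Longrightarrow> lead d c f"
  by (auto simp: lead_def)

lemma lead_0 [simp]: "lead d 0 (\<lambda>y. 0)"
  by (rule leadI[of 0]) auto

lemma lead_const: "lead 0 c (\<lambda>y. c)"
  by (rule leadI[of "[:c:]"]) auto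

lemma lead_add:
  assumes "lead d c f" "lead d c' g"
  shows "lead d (c + c') (\<lambda>y. f y + g y)"
proof -
  obtain p q where "degree p \<le> d" "coeff p d = c" "\<And>y. f y = poly p (of_nat y)"
    "degree q \<le> d" "coeff q d = c'" "\<And>y. g y = poly q (of_nat y)"
    using assms by (auto simp: lead_def)
  then show ?thesis by (intro leadI[of "p + q"]) (auto intro: degree_add_le)
qed

lemma lead_mult:
  assumes "lead d c f" "lead d' c' g"
  shows "lead (d + d') (c * c') (\<lambda>y. f y * g y)"
proof -
  obtain p q where p: "degree p \<le> d" "coeff p d = c" "\<And>y. f y = poly p (of_nat y)"
    and q: "degree q \<le> d'" "coeff q d' = c'" "\<And>y. g y = poly q (of_nat y)"
    using assms by (auto simp: lead_def)
  have "coeff (p * q) (d + d') = c * c'"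
  proof (cases "degree p = d \<and> degree q = d'")
    case True
    then show ?thesis using coeff_mult_degree_sum[of p q] p q by simp
  next
    case False
    then have "degree p < d \<or> degree q < d'" using p q by auto
    then show ?thesis
    proof
      assume "degree p < d"
      then have "degree (p * q) < d + d'" using q(1) degree_mult_le[of p q] by linarith
      then show ?thesis using p(2) \<open>degree p < d\<close> by (auto simp: coeff_eq_0)
    next
      assume "degree q < d'"
      then have "degree (p * q) < d + d'" using p(1) degree_mult_le[of p q] by linarith
      then show ?thesis using q(2) \<open>degree q < d'\<close> by (auto simp: coeff_eq_0)
    qed
  qed
  then show ?thesis using p q degree_mult_le[of p q]
    by (intro leadI[of "p * q"]) auto
qed

lemma lead_cmult: "lead d c f \<Longrightarrow> lead d (a * c) (\<lambda>y. a * f y)"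
  using lead_mult[OF lead_const] by fastforce

lemma lead_sum: "(\<And>a. a \<in> A \<Longrightarrow> lead d (c a) (f a)) \<Longrightarrow> lead d (sum c A) (\<lambda>y. \<Sum>a\<in>A. f a y)"
  by (induction A rule: infinite_finite_induct) (auto intro: lead_add)

lemma lead_weaken: "lead d c f \<Longrightarrow> d < d' \<Longrightarrow> lead d' 0 f"
  unfolding lead_def by (metis coeff_eq_0 le_less_trans less_imp_le)

lemma lead_antidifference:
  assumes "f 0 = 0" "lead d c (\<lambda>y. f (Suc y) - f y)"
  shows "lead (Suc d) (c / of_nat (Suc d)) f"
proof -
  obtain p where p: "degree p \<le> d" "coeff p d = c" "\<And>y. f (Suc y) - f y = poly p (of_nat y)"
    using assms by (auto simp: lead_def)
  obtain q where q: "poly q 0 = 0" "\<And>x. poly q (x + 1) - poly q x = poly p x" "degree q \<le> d + 1"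
    "coeff q (d + 1) = coeff p d / of_nat (d + 1)"
    using antidifference_poly[OF p(1)] by blast
  have "f y = poly q (of_nat y)" for y
  proof (induction y)
    case (Suc y)
    then show ?case using p(3)[of y] q(2)[of "of_nat y"] by (simp add: add.commute)
  qed (simp add: assms q)
  with p q show ?thesis by (intro leadI[of q]) auto
qed

section \<open>Lagrange interpolation\<close>

lemma coeff_prod_linear:
  fixes c :: "'b \<Rightarrow> rat"
  assumes "finite K"
  shows "degree (\<Prod>j\<in>K. [:c j, 1:]) = card K" "coeff (\<Prod>j\<in>K. [:c j, 1:]) (card K) = 1"
    "K \<noteq> {} \<Longrightarrow> coeff (\<Prod>j\<in>K. [:c j, 1:]) (card K - 1) = sum c K"
proof -
  show *: "degree (\<Prod>j\<in>K. [:c j, 1:]) = card K" for K :: "'b set"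
    by (subst degree_prod_eq_sum_degree) auto
  show **: "coeff (\<Prod>j\<in>K. [:c j, 1:]) (card K) = 1"
    using lead_coeff_prod[of "\<lambda>j. [:c j, 1:]" K] by (simp add: *)
  show "K \<noteq> {} \<Longrightarrow> coeff (\<Prod>j\<in>K. [:c j, 1:]) (card K - 1) = sum c K"
    using assms
  proof (induction K rule: finite_ne_induct)
    case (insert k K)
    have "coeff (\<Prod>j\<in>K. [:c j, 1:]) (card K) = 1"
      using lead_coeff_prod[of "\<lambda>j. [:c j, 1:]" K] by (simp add: *)
    moreover obtain m where "card K = Suc m" using insert by (metis card_eq_0_iff not0_implies_Suc)
    ultimately show ?case using insert by simp
  qed simp
qed

text \<open>A polynomial of degree less than \<open>card K\<close> is its own Lagrange interpolant
  at the nodes \<open>x k\<close>. Compare coefficients in degree \<open>card K - 1\<close>, the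
  degree of the monic products \<open>L k\<close>.\<close>

lemma lagrange_leading_coeff:
  fixes x :: "'b \<Rightarrow> rat"
  assumes K: "finite K" "inj_on x K" and f: "degree f < card K"
  shows "(\<Sum>k\<in>K. poly f (x k) / (\<Prod>j\<in>K - {k}. x k - x j)) = coeff f (card K - 1)"
proof -
  define L where "L k = (\<Prod>j\<in>K - {k}. [:- x j, 1:])" for k
  define g where "g = (\<Sum>k\<in>K. smult (poly f (x k) / (\<Prod>j\<in>K - {k}. x k - x j)) (L k))"
  have L: "degree (L k) = card K - 1" "coeff (L k) (card K - 1) = 1" if "k \<in> K" for k
    using coeff_prod_linear(1,2)[of "K - {k}" "\<lambda>j. - x j"] K that by (simp_all add: L_def)
  have nz: "(\<Prod>j\<in>K - {k}. x k - x j) \<noteq> 0" if "k \<in> K" for k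
    using K that by (auto simp: inj_on_def)
  have "f = g"
  proof (rule ccontr)
    assume "f \<noteq> g"
    then have d: "f - g \<noteq> 0" by simp
    have "degree g \<le> card K - 1"
      unfolding g_def by (rule degree_sum_le) (use K L in \<open>auto intro: order_trans[OF degree_smult_le]\<close>)
    then have deg: "degree (f - g) \<le> card K - 1" using f by (intro degree_diff_le) auto
    have "poly g (x i) = poly f (x i)" if "i \<in> K" for i
    proof -
      have "poly (L k) (x i) = 0" if "k \<in> K" "k \<noteq> i" for k
        using K \<open>i \<in> K\<close> that by (auto simp: L_def poly_prod)
      then have "poly g (x i) = (\<Sum>k\<in>K. if k = i then poly f (x i) / (\<Prod>j\<in>K - {i}. x i - x j) * poly (L i) (x i) else 0)"
        unfolding g_def poly_sum by (intro sum.cong) auto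
      also have "\<dots> = poly f (x i)" using K that nz[OF that] by (simp add: L_def poly_prod)
      finally show ?thesis .
    qed
    then have "x ` K \<subseteq> {z. poly (f - g) z = 0}" by auto
    then have "card (x ` K) \<le> card {z. poly (f - g) z = 0}"
      using poly_roots_finite[OF d] by (rule card_mono[rotated])
    also have "\<dots> \<le> degree (f - g)" using card_poly_roots_bound[OF d] .
    finally show False using deg f K by (simp add: card_image)
  qed
  then have "coeff f (card K - 1) = coeff g (card K - 1)" by simp
  also have "\<dots> = (\<Sum>k\<in>K. poly f (x k) / (\<Prod>j\<in>K - {k}. x k - x j))"
    unfolding g_def by (auto simp: coeff_sum L[unfolded One_nat_def] intro!: sum.cong)
  finally show ?thesis by simp
qed

text \<open>Lagrange interpolation of \<open>f\<close>, the product of the \<open>X + x j\<close>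
  minus the product of the \<open>X - x j\<close>. The second product vanishes at the nodes, so
  \<open>f\<close> takes at \<open>x k\<close> the value \<open>2 * x k\<close> times the product of
  the other \<open>x k + x j\<close>; its coefficient in degree \<open>card K - 1\<close> is
  \<open>2 * sum x K\<close>.\<close>

lemma sum_prod_ratio:
  fixes x :: "'b \<Rightarrow> rat"
  assumes K: "finite K" "inj_on x K"
  shows "(\<Sum>k\<in>K. x k * (\<Prod>j\<in>K - {k}. (x k + x j) / (x k - x j))) = sum x K"
proof (cases "K = {}")
  case False
  define f where "f = (\<Prod>j\<in>K. [:x j, 1:]) - (\<Prod>j\<in>K. [:- x j, 1:])"
  have c: "coeff f (card K - 1) = 2 * sum x K"
    using coeff_prod_linear(3)[OF K(1) False, of x] coeff_prod_linear(3)[OF K(1) False, of "\<lambda>j. - x j"]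
    by (simp add: f_def sum_negf)
  have "degree f \<le> card K"
    unfolding f_def using coeff_prod_linear(1)[OF K(1), of x] coeff_prod_linear(1)[OF K(1), of "\<lambda>j. - x j"]
    by (intro degree_diff_le) auto
  moreover have "coeff f (card K) = 0"
    using coeff_prod_linear(2)[OF K(1), of x] coeff_prod_linear(2)[OF K(1), of "\<lambda>j. - x j"]
    by (simp add: f_def)
  ultimately have deg: "degree f < card K"
    using False K by (metis card_eq_0_iff coeff_0_degree_minus_1 degree_0 diff_less le_neq_implies_less
        leading_coeff_0_iff less_one linorder_not_less not_gr_zero)
  have "(\<Sum>k\<in>K. 2 * (x k * (\<Prod>j\<in>K - {k}. (x k + x j) / (x k - x j)))) =
      (\<Sum>k\<in>K. poly f (x k) / (\<Prod>j\<in>K - {k}. x k - x j))"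
  proof (rule sum.cong[OF refl])
    fix k assume k: "k \<in> K"
    have "(\<Prod>j\<in>K. x k - x j) = 0" using K k by auto
    then have "poly f (x k) = (\<Prod>j\<in>K. x j + x k)" by (simp add: f_def poly_prod)
    also have "\<dots> = 2 * x k * (\<Prod>j\<in>K - {k}. x k + x j)"
      using K k by (simp add: prod.remove add.commute)
    finally show "2 * (x k * (\<Prod>j\<in>K - {k}. (x k + x j) / (x k - x j))) =
        poly f (x k) / (\<Prod>j\<in>K - {k}. x k - x j)"
      by (simp add: prod_dividef)
  qed
  also have "\<dots> = 2 * sum x K" using lagrange_leading_coeff[OF K deg] c by simp
  finally show ?thesis by (simp add: sum_distrib_left[symmetric])
qed simp

section \<open>The product side of Schur's Pfaffian\<close>

definition schur_prod :: "(nat \<Rightarrow> rat) \<Rightarrow> nat set \<Rightarrow> rat" where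
  "schur_prod x K = (\<Prod>i\<in>K. \<Prod>j\<in>K. if i < j then (x i - x j) / (x i + x j) else 1)"

text \<open>The pairs containing \<open>k\<close> are split off and written with \<open>x k\<close>
  in front; each \<open>j < k\<close> costs a sign because its factor is
  \<open>(x j - x k) / (x j + x k)\<close>.\<close>

lemma schur_prod_remove:
  assumes "finite K" "k \<in> K"
  shows "schur_prod x K = schur_prod x (K - {k}) * (-1) ^ card {j \<in> K. j < k} *
    (\<Prod>j\<in>K - {k}. (x k - x j) / (x k + x j))"
proof -
  define g where "g i j = (if i < j then (x i - x j) / (x i + x j) else 1)" for i j
  define L where "L = K - {k}"
  have K: "K = insert k L" "k \<notin> L" "finite L" using assms by (auto simp: L_def)
  have "schur_prod x K = (\<Prod>i\<in>K. \<Prod>j\<in>K. g i j)" by (simp add: schur_prod_def g_def)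
  also have "\<dots> = schur_prod x L * (\<Prod>j\<in>L. g k j * g j k)"
    using K by (simp add: prod.distrib schur_prod_def g_def mult_ac)
  also have "(\<Prod>j\<in>L. g k j * g j k) = (\<Prod>j\<in>L. (if j < k then -1 else 1) * ((x k - x j) / (x k + x j)))"
  proof (rule prod.cong[OF refl])
    fix j assume "j \<in> L"
    then have "j \<noteq> k" using K by auto
    then show "g k j * g j k = (if j < k then -1 else 1) * ((x k - x j) / (x k + x j))"
      by (auto simp: g_def add.commute minus_divide_left)
  qed
  also have "\<dots> = (\<Prod>j\<in>L. if j < k then -1 else 1) * (\<Prod>j\<in>L. (x k - x j) / (x k + x j))"
    by (rule prod.distrib)
  also have "(\<Prod>j\<in>L. if j < k then -1 else 1 :: rat) = (\<Prod>j\<in>{j \<in> K. j < k}. -1)"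
    using K by (intro prod.mono_neutral_cong_right) auto
  finally show ?thesis by (simp add: L_def)
qed

lemma schur_prod_nonzero:
  assumes "finite K" "inj_on x K" "\<And>k. k \<in> K \<Longrightarrow> x k > 0"
  shows "schur_prod x K \<noteq> 0"
proof -
  have "x i + x j \<noteq> 0" if "i \<in> K" "j \<in> K" for i j using assms(3) that by (metis add_pos_pos less_irrefl)
  then show ?thesis using assms(1,2) by (auto simp: schur_prod_def inj_on_def)
qed

text \<open>Hence the leading coefficients of the difference equation for \<open>esum\<close> are, up to
  factorials, the products of Schur's Pfaffian.\<close>

lemma sum_schur_prod_remove:
  assumes "finite K" "inj_on x K" "\<And>k. k \<in> K \<Longrightarrow> x k > 0"
  shows "(\<Sum>k\<in>K. (-1) ^ card {j \<in> K. j < k} * x k * schur_prod x (K - {k})) = sum x K * schur_prod x K"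
proof -
  have "(-1) ^ card {j \<in> K. j < k} * x k * schur_prod x (K - {k}) =
      x k * (\<Prod>j\<in>K - {k}. (x k + x j) / (x k - x j)) * schur_prod x K" if k: "k \<in> K" for k
  proof -
    have "x k + x j \<noteq> 0" if "j \<in> K" for j using assms(3) k that by (metis add_pos_pos less_irrefl)
    moreover have "x k - x j \<noteq> 0" if "j \<in> K - {k}" for j using assms(2) k that by (auto simp: inj_on_def)
    ultimately have "(\<Prod>j\<in>K - {k}. (x k + x j) / (x k - x j)) * (\<Prod>j\<in>K - {k}. (x k - x j) / (x k + x j)) = 1"
      unfolding prod.distrib[symmetric] by (intro prod.neutral) auto
    then show ?thesis
      by (simp add: schur_prod_remove[OF assms(1) k] mult_ac)
  qed
  then have "(\<Sum>k\<in>K. (-1) ^ card {j \<in> K. j < k} * x k * schur_prod x (K - {k})) =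
      (\<Sum>k\<in>K. x k * (\<Prod>j\<in>K - {k}. (x k + x j) / (x k - x j)) * schur_prod x K)"
    by (rule sum.cong[OF refl])
  also have "\<dots> = sum x K * schur_prod x K"
    unfolding sum_distrib_right[symmetric] by (simp add: sum_prod_ratio assms)
  finally show ?thesis .
qed

section \<open>The vectors\<close>

text \<open>Iterated discrete primitives of \<open>phi 0\<close>, the indicator of the odd integers:
  \<open>phi (Suc k) (l + 1) - phi (Suc k) (l - 1) = phi k l\<close>. The centred numerator makes
  \<open>phi k\<close> even or odd as a function of \<open>l\<close> according to the parity of
  \<open>k\<close>; this is the source of the reflection.\<close>

definition phi :: "nat \<Rightarrow> int \<Rightarrow> rat" where
  "phi k l = (if even (l + int k + 1) then ((of_int l + of_nat k - 1) / 2) gchoose k else 0)"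

definition gpoly :: "nat \<Rightarrow> rat \<Rightarrow> rat poly" where
  "gpoly k c = smult (1 / fact k) (\<Prod>i\<in>{0..<k}. [:c - of_nat i, 1:])"

lemma poly_gpoly: "poly (gpoly k c) x = (x + c) gchoose k"
  by (simp add: gpoly_def gbinomial_prod_rev poly_prod algebra_simps)

lemma degree_gpoly: "degree (gpoly k c) \<le> k" and coeff_gpoly: "coeff (gpoly k c) k = 1 / fact k"
  using coeff_prod_linear(1,2)[of "{0..<k}" "\<lambda>i. c - of_nat i"] by (simp_all add: gpoly_def)

lemma phi_polynomial: "\<exists>p. degree p \<le> k \<and> (\<forall>y. phi k (2 * y + c) = poly p (of_int y))"
proof (cases "even (c + int k + 1)")
  case True
  have "phi k (2 * y + c) = poly (gpoly k ((of_int c + of_nat k - 1) / 2)) (of_int y)" for y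
    using True by (simp add: phi_def poly_gpoly add_divide_distrib diff_divide_distrib algebra_simps)
  then show ?thesis using degree_gpoly by blast
next
  case False
  then show ?thesis by (intro exI[of _ 0]) (simp add: phi_def)
qed

lemma lead_phi: "\<exists>a. lead k a (\<lambda>y. phi k (2 * int y + c))"
proof -
  obtain p where "degree p \<le> k" "\<And>y. phi k (2 * y + c) = poly p (of_int y)"
    using phi_polynomial by blast
  then show ?thesis by (intro exI[of _ "coeff p k"] leadI[of p]) auto
qed

text \<open>Exactly one of two consecutive arguments has the parity at which \<open>phi k\<close> is
  a binomial coefficient, so the leading term of the pair is the same for both parities of
  \<open>k\<close>.\<close>

lemma lead_phi_pair: "lead k (1 / fact k) (\<lambda>y. phi k (2 * int y + 1) + phi k (2 * int y + 2))"
proof (cases "even k")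
  case True
  then have "phi k (2 * int y + 1) + phi k (2 * int y + 2) = poly (gpoly k (of_nat k / 2)) (of_nat y)" for y
    by (simp add: phi_def poly_gpoly add_divide_distrib)
  then show ?thesis using degree_gpoly coeff_gpoly by (intro leadI[of "gpoly k (of_nat k / 2)"])
next
  case False
  then have "phi k (2 * int y + 1) + phi k (2 * int y + 2) = poly (gpoly k ((of_nat k + 1) / 2)) (of_nat y)" for y
    by (simp add: phi_def poly_gpoly add_divide_distrib algebra_simps)
  then show ?thesis using degree_gpoly coeff_gpoly by (intro leadI[of "gpoly k ((of_nat k + 1) / 2)"])
qed

lemma phi_minus: "phi k (- l) = (-1) ^ k * phi k l"
proof -
  have "(of_int (- l) + of_nat k - 1) / 2 = - ((of_int l - of_nat k + 1) / 2 :: rat)" by (simp add: field_simps)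
  then have "((of_int (- l) + of_nat k - 1) / 2 :: rat) gchoose k = (- ((of_int l - of_nat k + 1) / 2)) gchoose k"
    by (simp only:)
  also have "\<dots> = (-1) ^ k * (((of_int l - of_nat k + 1) / 2 + of_nat k - 1) gchoose k)"
    by (rule gbinomial_minus)
  also have "(of_int l - of_nat k + 1) / 2 + of_nat k - 1 = ((of_int l + of_nat k - 1) / 2 :: rat)"
    by (simp add: field_simps)
  finally show ?thesis by (simp add: phi_def)
qed

lemma phi_0_right: "phi k 0 = 0"
  using phi_minus[of k 0] by (cases "even k") (auto simp: phi_def)

text \<open>The coordinates are in reverse order, so that the passage from \<open>n\<close> to \<open>n + 1\<close> raises the index
  of every \<open>phi\<close> by one and appends the coordinate \<open>n\<close>, which carries \<open>phi 0\<close>.\<close>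

definition phi_vector :: "nat \<Rightarrow> int \<Rightarrow> grassmann" where
  "phi_vector n l = vec n (\<lambda>k. phi (n - 1 - k) l)"

lemma homog_phi_vector [simp]: "homog (Suc 0) (phi_vector n l)"
  by (simp add: phi_vector_def)

lemma cf_phi_vector: "cf (phi_vector n l) {k} = (if k < n then phi (n - 1 - k) l else 0)"
  by (simp add: phi_vector_def)

interpretation phi_vector: vector_sequence "phi_vector n" for n
proof
  show "coeffs_order_ge 0 (\<lambda>y. phi_vector n (2 * y + c))" for c
    unfolding coeffs_order_ge_def
  proof
    fix K
    show "poly_order_ge 0 (\<lambda>y. cf (phi_vector n (2 * y + c)) K)"
    proof (cases "card K = 1")
      case True
      then obtain k where K: "K = {k}" by (auto simp: card_1_singleton_iff)
      show ?thesis
        using phi_polynomial[of "n - 1 - k" c] by (cases "k < n") (auto simp: K cf_phi_vector poly_order_ge_zero_iff)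
    next
      case False
      then have "cf (phi_vector n (2 * y + c)) K = 0" for y
        using homogD[of 1 "phi_vector n (2 * y + c)" K] by simp
      then show ?thesis by simp
    qed
  qed
qed simp

text \<open>\<open>n - k\<close> is the degree bound \<open>n - 1 - k\<close> of the coordinate
  \<open>k\<close>, raised by one for the summation over the index of the vector.\<close>

definition weight :: "nat \<Rightarrow> nat set \<Rightarrow> nat" where
  "weight n K = (\<Sum>k\<in>K. n - k)"

lemma weight_remove: "finite K \<Longrightarrow> k \<in> K \<Longrightarrow> weight n K = (n - k) + weight n (K - {k})"
  by (simp add: weight_def sum.remove)

text \<open>Passing from \<open>2 * y\<close> to \<open>2 * (y + 1)\<close> adds terms with one or
  two new vectors. Those with one carry the leading coefficient, those with two have lower degree,
  and summation over \<open>y\<close> divides by the weight.\<close>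

lemma lead_esum:
  assumes "K \<subseteq> {..<n}"
  shows "lead (weight n K) (schur_prod (\<lambda>k. of_nat (n - k)) K / (\<Prod>k\<in>K. fact (n - k)))
    (\<lambda>y. cf (esum (phi_vector n) (2 * y) (card K)) K)"
  using finite_subset[OF assms finite_lessThan] assms
proof (induction K rule: finite_psubset_induct)
  case (psubset K)
  define x :: "nat \<Rightarrow> rat" where "x = (\<lambda>k. of_nat (n - k))"
  define a where "a K = schur_prod x K / (\<Prod>k\<in>K. fact (n - k))" for K
  have IH: "lead (weight n S) (a S) (\<lambda>y. cf (esum (phi_vector n) (2 * y) (card S)) S)" if "S \<subset> K" for S
    unfolding a_def x_def using psubset.IH[OF that] psubset.prems that by blast
  show ?case
  proof (cases "K = {}")
    case True
    then show ?thesis using lead_const[of 1] by (simp add: weight_def cf_one schur_prod_def)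
  next
    case False
    then obtain r where r: "card K = Suc r" using psubset.hyps by (metis card_eq_0_iff not0_implies_Suc)
    define f where "f y = cf (esum (phi_vector n) (2 * y) (card K)) K" for y
    define s :: "nat set \<Rightarrow> nat \<Rightarrow> rat" where "s K k = (-1) ^ card {j \<in> K. j < k}" for K k
    have step: "f (Suc y) - f y =
        (\<Sum>k\<in>K. s K k * ((phi (n - 1 - k) (2 * int y + 1) + phi (n - 1 - k) (2 * int y + 2)) *
          cf (esum (phi_vector n) (2 * y) (card (K - {k}))) (K - {k}))) +
        (\<Sum>k\<in>K. \<Sum>j\<in>K - {k}. s K k * (s (K - {k}) j * ((phi (n - 1 - k) (2 * int y + 2) * phi (n - 1 - j) (2 * int y + 1)) *
          cf (esum (phi_vector n) (2 * y) (card (K - {k} - {j}))) (K - {k} - {j}))))" for y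
    proof -
      let ?V = "esum (phi_vector n) (2 * y)"
      have lt: "k < n" if "k \<in> K" for k using that psubset.prems by auto
      have card: "card (K - {k}) = r" if "k \<in> K" for k using that r by simp
      have "f (Suc y) - f y = cf (phi_vector n (2 * int y + 1) * ?V r) K + cf (phi_vector n (2 * int y + 2) * esum (phi_vector n) (Suc (2 * y)) r) K"
        by (simp add: f_def r add.commute)
      also have "cf (phi_vector n (2 * int y + 2) * esum (phi_vector n) (Suc (2 * y)) r) K =
          (\<Sum>k\<in>K. s K k * phi (n - 1 - k) (2 * int y + 2) * (cf (?V r) (K - {k}) +
            (\<Sum>j\<in>K - {k}. s (K - {k}) j * phi (n - 1 - j) (2 * int y + 1) * cf (?V (card (K - {k} - {j}))) (K - {k} - {j}))))"
        unfolding cf_vector_mult[OF homog_phi_vector[folded One_nat_def] psubset.hyps]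
      proof (rule sum.cong[OF refl])
        fix k assume k: "k \<in> K"
        have fin: "finite (K - {k})" using psubset.hyps by simp
        have "cf (esum (phi_vector n) (Suc (2 * y)) r) (K - {k}) = cf (?V r) (K - {k}) +
            (\<Sum>j\<in>K - {k}. s (K - {k}) j * phi (n - 1 - j) (2 * int y + 1) * cf (?V (card (K - {k} - {j}))) (K - {k} - {j}))"
        proof (cases r)
          case 0
          then have e: "K - {k} = {}" using card[OF k] fin by simp
          show ?thesis unfolding e 0 by simp
        next
          case (Suc q)
          have "cf (phi_vector n (2 * int y + 1) * ?V q) (K - {k}) =
            (\<Sum>j\<in>K - {k}. s (K - {k}) j * phi (n - 1 - j) (2 * int y + 1) * cf (?V (card (K - {k} - {j}))) (K - {k} - {j}))"
            unfolding cf_vector_mult[OF homog_phi_vector[folded One_nat_def] fin]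
            using card[OF k] Suc lt by (intro sum.cong) (auto simp: cf_phi_vector s_def)
          then show ?thesis by (simp add: Suc add.commute)
        qed
        then show "(-1) ^ card {j \<in> K. j < k} * cf (phi_vector n (2 * int y + 2)) {k} * cf (esum (phi_vector n) (Suc (2 * y)) r) (K - {k}) =
          s K k * phi (n - 1 - k) (2 * int y + 2) * (cf (?V r) (K - {k}) +
            (\<Sum>j\<in>K - {k}. s (K - {k}) j * phi (n - 1 - j) (2 * int y + 1) * cf (?V (card (K - {k} - {j}))) (K - {k} - {j})))"
          using lt[OF k] by (simp add: cf_phi_vector s_def)
      qed
      also have "cf (phi_vector n (2 * int y + 1) * ?V r) K =
          (\<Sum>k\<in>K. s K k * phi (n - 1 - k) (2 * int y + 1) * cf (?V r) (K - {k}))"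
        unfolding cf_vector_mult[OF homog_phi_vector[folded One_nat_def] psubset.hyps]
        using lt by (intro sum.cong) (auto simp: cf_phi_vector s_def)
      finally show ?thesis
        by (simp add: sum.distrib[symmetric] r distrib_left distrib_right sum_distrib_left mult_ac add_ac)
    qed
    obtain d where d: "weight n K = Suc d"
    proof -
      obtain k where "k \<in> K" using False by blast
      then have "weight n K > 0" using weight_remove[OF psubset.hyps] psubset.prems by fastforce
      then show ?thesis using that gr0_implies_Suc by blast
    qed
    have L1: "lead d (s K k * (1 / fact (n - 1 - k) * a (K - {k})))
      (\<lambda>y. s K k * ((phi (n - 1 - k) (2 * int y + 1) + phi (n - 1 - k) (2 * int y + 2)) *
          cf (esum (phi_vector n) (2 * y) (card (K - {k}))) (K - {k})))" if k: "k \<in> K" for k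
    proof -
      have "d = (n - 1 - k) + weight n (K - {k})"
        using weight_remove[OF psubset.hyps k, of n] d k psubset.prems by auto
      show ?thesis unfolding \<open>d = _\<close> using k by (intro lead_cmult lead_mult lead_phi_pair IH) auto
    qed
    have L2: "lead d 0
      (\<lambda>y. s K k * (s (K - {k}) j * ((phi (n - 1 - k) (2 * int y + 2) * phi (n - 1 - j) (2 * int y + 1)) *
          cf (esum (phi_vector n) (2 * y) (card (K - {k} - {j}))) (K - {k} - {j}))))"
      if k: "k \<in> K" and j: "j \<in> K - {k}" for k j
    proof -
      obtain b c where bc: "lead (n - 1 - k) b (\<lambda>y. phi (n - 1 - k) (2 * int y + 2))"
        "lead (n - 1 - j) c (\<lambda>y. phi (n - 1 - j) (2 * int y + 1))"
        using lead_phi by metis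
      have "lead ((n - 1 - k) + (n - 1 - j) + weight n (K - {k} - {j}))
          (s K k * (s (K - {k}) j * (b * c * a (K - {k} - {j}))))
        (\<lambda>y. s K k * (s (K - {k}) j * ((phi (n - 1 - k) (2 * int y + 2) * phi (n - 1 - j) (2 * int y + 1)) *
          cf (esum (phi_vector n) (2 * y) (card (K - {k} - {j}))) (K - {k} - {j}))))"
        using k by (intro lead_cmult lead_mult bc IH) auto
      \<comment> \<open>Removing an index \<open>k\<close> lowers the weight by
        \<open>n - k\<close>, and its coordinate gives back only \<open>n - 1 - k\<close>. Two
        removals from the weight \<open>Suc d\<close> thus end at \<open>d - 1\<close>.\<close>
      moreover have "(n - 1 - k) + (n - 1 - j) + weight n (K - {k} - {j}) < d"
      proof -
        have "k < n" "j < n" using k j psubset.prems by auto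
        then show ?thesis
          using weight_remove[OF psubset.hyps k, of n] weight_remove[of "K - {k}" j n] d j psubset.hyps by simp
      qed
      ultimately show ?thesis by (rule lead_weaken)
    qed
    have "lead d ((\<Sum>k\<in>K. s K k * (1 / fact (n - 1 - k) * a (K - {k}))) + (\<Sum>k\<in>K. \<Sum>j\<in>K - {k}. 0))
        (\<lambda>y. f (Suc y) - f y)"
      unfolding step by (intro lead_add lead_sum L1 L2)
    moreover have "f 0 = 0" by (simp add: f_def r)
    ultimately have "lead (Suc d) ((\<Sum>k\<in>K. s K k * (1 / fact (n - 1 - k) * a (K - {k}))) / of_nat (Suc d)) f"
      using lead_antidifference by simp
    \<comment> \<open>The divisor \<open>Suc d\<close> is the weight, which is the sum of the
      \<open>x k\<close>. After clearing factorials with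
      \<open>fact (n - k) = x k * fact (n - 1 - k)\<close>, this is the identity for
      \<open>schur_prod\<close>.\<close>
    moreover have "(\<Sum>k\<in>K. s K k * (1 / fact (n - 1 - k) * a (K - {k}))) = of_nat (Suc d) * a K"
    proof -
      have pos: "x k > 0" if "k \<in> K" for k using that psubset.prems by (auto simp: x_def)
      have inj: "inj_on x K" using psubset.prems by (auto simp: inj_on_def x_def subset_iff)
      have "(\<Sum>k\<in>K. s K k * (1 / fact (n - 1 - k) * a (K - {k}))) =
          (\<Sum>k\<in>K. s K k * x k * schur_prod x (K - {k})) / (\<Prod>k\<in>K. fact (n - k))"
        unfolding sum_divide_distrib
      proof (rule sum.cong[OF refl])
        fix k assume k: "k \<in> K"
        then have "n - k = Suc (n - 1 - k)" using psubset.prems by auto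
        then have "fact (n - k) = x k * fact (n - 1 - k)" by (simp add: x_def)
        then have "(\<Prod>k\<in>K. fact (n - k)) = x k * fact (n - 1 - k) * (\<Prod>k\<in>K - {k}. fact (n - k))"
          using psubset.hyps k by (simp add: prod.remove)
        then show "s K k * (1 / fact (n - 1 - k) * a (K - {k})) =
            s K k * x k * schur_prod x (K - {k}) / (\<Prod>k\<in>K. fact (n - k))"
          using pos[OF k] by (simp add: a_def)
      qed
      also have "\<dots> = sum x K * schur_prod x K / (\<Prod>k\<in>K. fact (n - k))"
        using sum_schur_prod_remove[OF psubset.hyps inj pos] by (simp add: s_def)
      also have "sum x K = of_nat (Suc d)" by (simp add: d[symmetric] weight_def x_def)
      finally show ?thesis by (simp add: a_def)
    qed
    ultimately show ?thesis unfolding f_def[symmetric] d a_def[symmetric] x_def[symmetric]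
      by simp
  qed
qed

section \<open>Contraction\<close>

text \<open>The interior product with the dual vector of the generator \<open>k\<close>; the sign is
  that of moving \<open>k\<close> to the front.\<close>

lift_definition contract :: "nat \<Rightarrow> grassmann \<Rightarrow> grassmann"
  is "\<lambda>k f K. if k \<in> K then 0 else (-1) ^ card {j \<in> K. j < k} * f (insert k K)" by auto

lemmas cf_contract = contract.rep_eq

text \<open>The antiderivation rule. If \<open>k\<close> lies in \<open>K\<close>, only the term
  \<open>j = k\<close> of \<open>v * contract k x\<close> survives and it cancels the first summand;
  otherwise the two orders of extracting \<open>j\<close> and \<open>k\<close> have opposite
  signs.\<close>

lemma cf_contract_mult:
  assumes v: "homog 1 v" and K: "finite K"
  shows "cf (contract k (v * x)) K = cf v {k} * cf x K - cf (v * contract k x) K"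
proof (cases "k \<in> K")
  case True
  have "cf (v * contract k x) K = (\<Sum>j\<in>K. if j = k then cf v {k} * cf x K else 0)"
    unfolding cf_vector_mult[OF v K]
  proof (rule sum.cong[OF refl])
    fix j assume "j \<in> K"
    show "(-1) ^ card {i \<in> K. i < j} * cf v {j} * cf (contract k x) (K - {j}) =
        (if j = k then cf v {k} * cf x K else 0)"
    proof (cases "j = k")
      case j: True
      have "{i \<in> K - {k}. i < k} = {i \<in> K. i < k}" by auto
      then show ?thesis
        using True j by (simp add: cf_contract insert_absorb mult.assoc[symmetric] mult.commute[of _ "cf v {k}"])
    qed (use True in \<open>simp add: cf_contract\<close>)
  qed
  also have "\<dots> = cf v {k} * cf x K" using K True by simp
  finally show ?thesis using True by (simp add: cf_contract)
next
  case False
  define e :: "nat set \<Rightarrow> nat \<Rightarrow> rat" where "e S j = (-1) ^ card {i \<in> S. i < j}" for S j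
  have "cf (contract k (v * x)) K = e K k * (\<Sum>j\<in>insert k K. e (insert k K) j * cf v {j} * cf x (insert k K - {j}))"
    using False cf_vector_mult[OF v, of "insert k K" x] K by (simp add: cf_contract e_def)
  also have "\<dots> = e K k * (e (insert k K) k * cf v {k} * cf x K) +
      (\<Sum>j\<in>K. e K k * (e (insert k K) j * cf v {j} * cf x (insert k K - {j})))"
    using K False by (simp add: distrib_left sum_distrib_left)
  also have "e K k * (e (insert k K) k * cf v {k} * cf x K) = cf v {k} * cf x K"
  proof -
    have "{i. (i = k \<or> i \<in> K) \<and> i < k} = {i \<in> K. i < k}" by auto
    then have "e K k * e (insert k K) k = 1" by (simp add: e_def power_add[symmetric] mult_2[symmetric])
    then show ?thesis by (simp add: mult.assoc[symmetric])
  qed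
  also have "(\<Sum>j\<in>K. e K k * (e (insert k K) j * cf v {j} * cf x (insert k K - {j}))) =
      (\<Sum>j\<in>K. - (e K j * cf v {j} * cf (contract k x) (K - {j})))"
  proof (rule sum.cong[OF refl])
    fix j assume j: "j \<in> K"
    then have jk: "j \<noteq> k" using False by auto
    have "e K k * e (insert k K) j = - (e K j * e (K - {j}) k)"
    proof (cases "k < j")
      case True
      then have "{i \<in> insert k K. i < j} = insert k {i \<in> K. i < j}" "{i \<in> K - {j}. i < k} = {i \<in> K. i < k}" by auto
      then show ?thesis unfolding e_def using K False by simp
    next
      case ge: False
      then have "{i \<in> insert k K. i < j} = {i \<in> K. i < j}" "{i \<in> K. i < k} = insert j {i \<in> K - {j}. i < k}"
        using j jk by auto
      then show ?thesis unfolding e_def using K by simp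
    qed
    then have "e K k * (e (insert k K) j * cf v {j} * cf x (insert k K - {j})) =
        - (e K j * e (K - {j}) k) * (cf v {j} * cf x (insert k K - {j}))"
      by (simp only: mult.assoc[symmetric])
    moreover have "insert k K - {j} = insert k (K - {j})" using jk by auto
    moreover have "cf (contract k x) (K - {j}) = e (K - {j}) k * cf x (insert k (K - {j}))"
      using False by (simp add: cf_contract e_def)
    ultimately show "e K k * (e (insert k K) j * cf v {j} * cf x (insert k K - {j})) =
        - (e K j * cf v {j} * cf (contract k x) (K - {j}))"
      by simp
  qed
  also have "\<dots> = - cf (v * contract k x) K"
    unfolding cf_vector_mult[OF v K] e_def by (rule sum_negf)
  finally show ?thesis by simp
qed

text \<open>A coordinate \<open>k\<close> of \<open>phi_vector n l\<close> is nonzero only if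
  \<open>n - 1 - k\<close> and \<open>l\<close> have different parities. So for a product of such
  vectors \<open>m\<close> is the number of odd indices \<open>l\<close>.\<close>

definition graded :: "nat \<Rightarrow> nat \<Rightarrow> grassmann \<Rightarrow> bool" where
  "graded n m x \<longleftrightarrow> (\<forall>K. cf x K \<noteq> 0 \<longrightarrow> card {k \<in> K. even (n - 1 - k)} = m)"

lemma graded_add: "graded n m x \<Longrightarrow> graded n m y \<Longrightarrow> graded n m (x + y)"
  unfolding graded_def cf_simps by (metis add_0)

lemma graded_phi_vector_mult:
  assumes "graded n m x"
  shows "graded n (if odd l then Suc m else m) (phi_vector n l * x)"
  unfolding graded_def
proof (intro allI impI)
  fix K assume nz: "cf (phi_vector n l * x) K \<noteq> 0"
  then have K: "finite K" using cf_infinite by blast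
  from nz obtain k where k: "k \<in> K" "cf (phi_vector n l) {k} \<noteq> 0" "cf x (K - {k}) \<noteq> 0"
    unfolding cf_vector_mult[OF homog_phi_vector[folded One_nat_def] K]
    by (auto elim!: sum.not_neutral_contains_not_neutral)
  then have "even (n - 1 - k) \<longleftrightarrow> odd l" by (auto simp: cf_phi_vector phi_def split: if_splits)
  moreover have "card {j \<in> K - {k}. even (n - 1 - j)} = m" using assms k(3) unfolding graded_def by blast
  moreover have "{j \<in> K. even (n - 1 - j)} = (if even (n - 1 - k) then insert k {j \<in> K - {k}. even (n - 1 - j)}
      else {j \<in> K - {k}. even (n - 1 - j)})" using k by auto
  ultimately show "card {j \<in> K. even (n - 1 - j)} = (if odd l then Suc m else m)"
    using K by simp
qed

lemma card_odd_lessThan: "card {k \<in> {..<2 * m}. odd k} = m"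
proof (induction m)
  case (Suc m)
  have "{k \<in> {..<2 * Suc m}. odd k} = insert (2 * m + 1) {k \<in> {..<2 * m}. odd k}"
    by (auto simp: less_Suc_eq)
  with Suc show ?case by simp
qed simp

text \<open>Exactly one of \<open>n + 1\<close> vectors is omitted in each term of \<open>esum\<close>. Omitting an even index gives
  terms of the wrong grade; the remaining ones form the contraction of a product of \<open>n + 1\<close> vectors.\<close>

lemma esum_vanishes:
  assumes n: "even n" "n > 0"
  shows "cf (esum (phi_vector n) (n + 1) n) {..<n} = 0"
proof -
  \<comment> \<open>\<open>P m\<close> is the product of all vectors with indices from
    \<open>m\<close> down to 1, \<open>Q m\<close> the sum of the products with one index omitted.
    As \<open>phi 0\<close> is the indicator of odd indices, contraction with the coordinate
    \<open>n - 1\<close> collects the odd omissions, all with the same sign; \<open>D m\<close>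
    keeps the even ones.\<close>
  define Q where "Q m = (case m of 0 \<Rightarrow> 0 | Suc q \<Rightarrow> esum (phi_vector n) m q)" for m
  define P where "P m = esum (phi_vector n) m m" for m
  define D where "D m = Q m + (-1) ^ m * contract (n - 1) (P m)" for m
  have P0: "P 0 = 1" and PS: "P (Suc m) = phi_vector n (int m + 1) * P m" for m
    by (simp_all add: P_def esum_eq_0)
  have QS: "Q (Suc m) = P m + phi_vector n (int m + 1) * Q m" for m
    by (cases m) (auto simp: Q_def P_def esum_eq_0)
  have D0: "D 0 = 0"
    by (rule grassmann_eqI) (simp add: D_def Q_def P0 cf_contract cf_one)
  have DS: "D (Suc m) = (if odd m then P m else 0) + phi_vector n (int m + 1) * D m" for m
  proof (rule grassmann_eqI)
    fix K :: "nat set" assume K: "finite K"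
    have "cf (phi_vector n (int m + 1)) {n - 1} = (if even m then 1 else 0)"
      using n by (simp add: cf_phi_vector phi_def)
    then show "cf (D (Suc m)) K = cf ((if odd m then P m else 0) + phi_vector n (int m + 1) * D m) K"
      using cf_contract_mult[OF homog_phi_vector[folded One_nat_def] K, of "n - 1" n "int m + 1" "P m"]
      by (simp add: D_def QS PS distrib_left cf_mult_minus_one_power)
  qed
  have Pg: "graded n ((m + 1) div 2) (P m)" for m
  proof (induction m)
    case 0
    then show ?case by (auto simp: P0 graded_def cf_one)
  next
    case (Suc m)
    then show ?case using graded_phi_vector_mult[OF Suc.IH, of "int m + 1"] by (cases "even m") (auto simp: PS)
  qed
  have Dg: "graded n ((m + 1) div 2) (D m)" for m
  proof (induction m)
    case 0
    then show ?case by (simp add: D0 graded_def)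
  next
    case (Suc m)
    have "graded n ((Suc m + 1) div 2) (phi_vector n (int m + 1) * D m)"
      using graded_phi_vector_mult[OF Suc.IH, of "int m + 1"] by (cases "even m") auto
    moreover have "graded n ((Suc m + 1) div 2) (if odd m then P m else 0)"
      using Pg[of m] by (auto simp: graded_def elim!: oddE)
    ultimately show ?case unfolding DS by (rule graded_add[rotated])
  qed
  \<comment> \<open>The grade of \<open>D (n + 1)\<close> is \<open>n div 2 + 1\<close>, but
    \<open>{..<n}\<close> has grade \<open>n div 2\<close>. The contraction contributes nothing at
    \<open>{..<n}\<close>, which contains \<open>n - 1\<close>.\<close>
  have "{k \<in> {..<n}. even (n - 1 - k)} = {k \<in> {..<2 * (n div 2)}. odd k}" using n by auto
  then have "card {k \<in> {..<n}. even (n - 1 - k)} = n div 2" by (simp only: card_odd_lessThan)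
  moreover have "(n + 1 + 1) div 2 = Suc (n div 2)" using n by auto
  ultimately have "cf (D (n + 1)) {..<n} = 0" using Dg[of "n + 1"] by (auto simp: graded_def)
  moreover have "cf (D (n + 1)) {..<n} = cf (Q (n + 1)) {..<n}" using n by (simp add: D_def cf_contract)
  ultimately show ?thesis by (simp add: Q_def)
qed

section \<open>The top coefficient as a polynomial\<close>

definition top_coeff :: "nat \<Rightarrow> nat \<Rightarrow> rat" where
  "top_coeff n M = cf (esum (phi_vector n) M n) {..<n}"

lemma twist_phi_vector_minus: "twist (\<lambda>k. - ((-1) ^ (n - 1 - k))) (phi_vector n (- l)) = - phi_vector n l"
proof (rule vector_eqI)
  show "homog 1 (twist (\<lambda>k. - ((-1) ^ (n - 1 - k))) (phi_vector n (- l)))"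
    using homog_phi_vector[of n "- l"] by (auto simp: homog_def cf_twist)
  show "homog 1 (- phi_vector n l)"
    using homog_phi_vector[of n l] by (auto simp: homog_def)
  show "cf (twist (\<lambda>k. - ((-1) ^ (n - 1 - k))) (phi_vector n (- l))) {k} = cf (- phi_vector n l) {k}" for k
    by (simp add: cf_twist cf_phi_vector phi_minus mult.assoc[symmetric] power_mult_distrib[symmetric])
qed

lemma phi_vector_0_right: "phi_vector n 0 = 0"
  by (rule vector_eqI) (simp_all add: cf_phi_vector phi_0_right)

lemma poly_eq_if_eq_on_int:
  fixes p q :: "rat poly"
  assumes "\<And>y :: int. poly p (of_int y) = poly q (of_int y)"
  shows "p = q"
  using assms by (intro poly_eq_if_eq_on_nat) (metis of_int_of_nat_eq)

text \<open>\<open>E\<close> serves even and \<open>O'\<close> odd \<open>M\<close>. The reflection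
  sends \<open>2 * y\<close> to \<open>2 * (-1 - y) + 1\<close>, hence exchanges them and replaces
  \<open>y\<close> by \<open>-1 - y\<close>; \<open>s\<close> is the product of the twisting signs
  over all coordinates.\<close>

lemma top_coeff_polynomials:
  obtains E O' :: "rat poly" and s :: rat where
    "\<And>y. top_coeff n (2 * y) = poly E (of_nat y)" "\<And>y. top_coeff n (2 * y + 1) = poly O' (of_nat y)"
    "s = 1 \<or> s = -1" "\<And>x. poly O' x = s * poly E (-1 - x)" "\<And>x. poly E x = s * poly O' (-1 - x)"
proof -
  let ?X = "\<lambda>M. cf (phi_vector.ext_esum n n M) {..<n} / of_nat (fact (n div 2))"
  have X: "top_coeff n M = ?X (int M)" for M
    unfolding top_coeff_def by (rule phi_vector.cf_esum)
  have "poly_order_ge 0 (\<lambda>y. ?X (2 * y))"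
  proof -
    have "coeffs_order_ge 0 (\<lambda>y. phi_vector.ext_esum n n (2 * y))"
      by (rule coeffs_order_ge_mono[OF phi_vector.coeffs_order_ge_ext_esum_even]) simp
    then have "poly_order_ge 0 (\<lambda>y. cf (phi_vector.ext_esum n n (2 * y)) {..<n})" by (simp add: coeffs_order_ge_def)
    from poly_order_ge_cmult[OF this, of "1 / of_nat (fact (n div 2))"] show ?thesis by simp
  qed
  then obtain E where E: "\<And>y. ?X (2 * y) = poly E (of_int y)" by (auto simp: poly_order_ge_zero_iff)
  have "poly_order_ge 0 (\<lambda>y. ?X (2 * y + 1))"
  proof -
    have "poly_order_ge 0 (\<lambda>y. cf (phi_vector.ext_esum n n (2 * y + 1)) {..<n})"
      using phi_vector.coeffs_order_ge_ext_esum_odd[of n n] by (simp add: coeffs_order_ge_def)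
    from poly_order_ge_cmult[OF this, of "1 / of_nat (fact (n div 2))"] show ?thesis by simp
  qed
  then obtain O' where O': "\<And>y. ?X (2 * y + 1) = poly O' (of_int y)" by (auto simp: poly_order_ge_zero_iff)
  define s :: rat where "s = (\<Prod>k<n. - ((-1) ^ (n - 1 - k)))"
  have ss: "s * s = 1"
    unfolding s_def prod.distrib[symmetric] by (simp add: power_mult_distrib[symmetric])
  then have s: "s = 1 \<or> s = -1" by (simp add: square_eq_1_iff)
  have refl: "s * ?X (-1 - M) = ?X M" for M
    using phi_vector.ext_esum_reflect[OF phi_vector_0_right twist_phi_vector_minus, of n n M, THEN arg_cong[where f = "\<lambda>x. cf x {..<n}"]]
    by (simp add: cf_twist s_def)
  have "E = smult s (pcompose O' [:-1, -1:])"
  proof (rule poly_eq_if_eq_on_int)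
    fix y :: int
    show "poly E (of_int y) = poly (smult s (pcompose O' [:-1, -1:])) (of_int y)"
    proof -
      have "poly E (of_int y) = s * ?X (-1 - 2 * y)" by (simp only: E[symmetric] refl)
      also have "-1 - 2 * y = 2 * (-1 - y) + 1" by simp
      also have "?X \<dots> = poly O' (of_int (-1 - y))" by (rule O')
      finally show ?thesis by (simp add: poly_pcompose algebra_simps)
    qed
  qed
  then have E_O: "poly E x = s * poly O' (-1 - x)" for x by (simp add: poly_pcompose)
  have "poly O' x = s * poly E (-1 - x)" for x
    by (simp add: E_O mult.assoc[symmetric] ss)
  show ?thesis
  proof (rule that)
    show "top_coeff n (2 * y) = poly E (of_nat y)" for y
      unfolding X using E[of "int y"] by simp
    show "top_coeff n (2 * y + 1) = poly O' (of_nat y)" for y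
      unfolding X using O'[of "int y"] by (simp add: add.commute)
  qed fact+
qed

section \<open>Roots of the top coefficient\<close>

lemma prod_linear_dvd:
  fixes c :: "'b \<Rightarrow> rat"
  assumes "finite A" "p \<noteq> 0" "\<And>r. card {x \<in> A. c x = r} \<le> order r p"
  shows "(\<Prod>x\<in>A. [:- c x, 1:]) dvd p"
  using assms
proof (induction A arbitrary: p rule: finite_induct)
  case (insert a A)
  have fin: "finite {x \<in> insert a A. c x = r}" for r using insert.hyps by simp
  have "card {x \<in> insert a A. c x = c a} > 0" using fin by (auto simp: card_gt_0_iff)
  then have "order (c a) p > 0" using insert.prems(2)[of "c a"] by simp
  then have "[:- c a, 1:] dvd p" using order_root poly_eq_0_iff_dvd by blast
  then obtain q where q: "p = [:- c a, 1:] * q" ..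
  then have "q \<noteq> 0" using insert.prems by auto
  have "card {x \<in> A. c x = r} \<le> order r q" for r
  proof -
    have "order r p = order r [:- c a, 1:] + order r q" using insert.prems(1) unfolding q by (rule order_mult)
    also have "order r [:- c a, 1:] = (if r = c a then 1 else 0)"
      using order_power_n_n[of "c a" 1] by (auto intro: order_0I)
    finally have "card {x \<in> insert a A. c x = r} \<le> (if r = c a then 1 else 0) + order r q"
      using insert.prems(2)[of r] by simp
    moreover have "{x \<in> insert a A. c x = c a} = insert a {x \<in> A. c x = c a}"
      and "r \<noteq> c a \<Longrightarrow> {x \<in> insert a A. c x = r} = {x \<in> A. c x = r}" by auto
    ultimately show ?thesis using insert.hyps by (auto split: if_splits)
  qed
  then have "(\<Prod>x\<in>A. [:- c x, 1:]) dvd q" using insert.IH \<open>q \<noteq> 0\<close> by blast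
  then show ?case using insert.hyps q by (simp add: mult_dvd_mono del: mult_pCons_left mult_pCons_right)
qed simp

text \<open>Roots are prescribed as an indexed family with repetitions, because Pochhammer products
  unfold into double products over such index sets.\<close>

lemma prod_linear_quotient:
  fixes c :: "'b \<Rightarrow> int" and p :: "rat poly"
  assumes "finite A" "p \<noteq> 0" "\<And>z. card {x \<in> A. c x = z} \<le> order (of_int z) p"
  obtains q where "q \<noteq> 0" "degree q = degree p - card A"
    "\<And>y. poly p y = (\<Prod>x\<in>A. y - of_int (c x)) * poly q y"
proof -
  have "(\<Prod>x\<in>A. [:- of_int (c x), 1:]) dvd p"
  proof (rule prod_linear_dvd[OF assms(1,2)])
    fix r :: rat
    show "card {x \<in> A. of_int (c x) = r} \<le> order r p"
    proof (cases "r \<in> \<int>")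
      case True
      then obtain z where "r = of_int z" by (auto elim: Ints_cases)
      then show ?thesis using assms(3)[of z] by simp
    next
      case False
      then have e: "{x \<in> A. of_int (c x) = r} = {}" by auto
      show ?thesis unfolding e by simp
    qed
  qed
  then obtain q where q: "p = (\<Prod>x\<in>A. [:- of_int (c x), 1:]) * q" ..
  then have "q \<noteq> 0" using assms(2) by auto
  moreover have "degree q = degree p - card A"
    using q \<open>q \<noteq> 0\<close> assms(1) coeff_prod_linear(1)[OF assms(1), of "\<lambda>x. - of_int (c x)"]
    by (simp add: degree_mult_eq)
  moreover have "poly p y = (\<Prod>x\<in>A. y - of_int (c x)) * poly q y" for y
    by (simp add: q poly_prod)
  ultimately show ?thesis using that by blast
qed

lemma shifted_power_dvd:
  fixes p q :: "rat poly"
  assumes "\<And>y :: nat. poly p (of_nat (t + y)) = of_nat y ^ r * poly q (of_nat y)"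
  shows "[:- of_nat t, 1:] ^ r dvd p"
proof -
  have "pcompose p [:of_nat t, 1:] = [:0, 1:] ^ r * q"
    using assms by (intro poly_eq_if_eq_on_nat) (simp add: poly_pcompose)
  then have "poly (pcompose p [:of_nat t, 1:]) (x - of_nat t) = poly ([:0, 1:] ^ r * q) (x - of_nat t)" for x
    by simp
  then have "p = [:- of_nat t, 1:] ^ r * pcompose q [:- of_nat t, 1:]"
    by (simp add: poly_eq_poly_eq_iff[symmetric] fun_eq_iff poly_pcompose)
  then show ?thesis by (rule dvdI)
qed

lemma reflected_power_dvd:
  fixes p q :: "rat poly"
  assumes "[:- c, 1:] ^ r dvd q" "\<And>x. poly p x = s * poly q (-1 - x)"
  shows "[:- (-1 - c), 1:] ^ r dvd p"
proof -
  obtain q' where "q = [:- c, 1:] ^ r * q'" using assms(1) ..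
  then have q: "poly q x = (x - c) ^ r * poly q' x" for x by simp
  have "(-1 - x - c) ^ r = ((-1) * (x + 1 + c)) ^ r" for x by (simp add: algebra_simps)
  then have k: "(-1 - x - c) ^ r = (-1) ^ r * (x + 1 + c) ^ r" for x by (simp only: power_mult_distrib)
  have "poly p x = poly ([:- (-1 - c), 1:] ^ r * smult (s * (-1) ^ r) (pcompose q' [:-1, -1:])) x" for x
    unfolding assms(2) q k by (simp add: poly_pcompose algebra_simps)
  then have "p = [:- (-1 - c), 1:] ^ r * smult (s * (-1) ^ r) (pcompose q' [:-1, -1:])"
    by (simp add: poly_eq_poly_eq_iff[symmetric] fun_eq_iff)
  then show ?thesis by (rule dvdI)
qed

text \<open>The degree is read off at even \<open>M\<close> and transferred to \<open>O'\<close> by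
  the reflection. Zeros at \<open>M = 2 * t\<close> and \<open>M = 2 * t + 1\<close> are zeros of
  \<open>E\<close> and \<open>O'\<close> at \<open>t\<close>; each reflects to a zero of the other
  polynomial at \<open>-1 - t\<close>.\<close>

lemma top_coeff_polynomial_structure:
  obtains E O' :: "rat poly" where
    "\<And>y. top_coeff n (2 * y) = poly E (of_nat y)" "\<And>y. top_coeff n (2 * y + 1) = poly O' (of_nat y)"
    "E \<noteq> 0" "O' \<noteq> 0" "2 * degree E = n * (n + 1)" "2 * degree O' = n * (n + 1)"
    "\<And>t :: nat. (n - 2 * t + 1) div 2 \<le> order (of_nat t) E"
    "\<And>t :: nat. (n - 2 * t) div 2 \<le> order (-1 - of_nat t) E"
    "\<And>t :: nat. (n - 2 * t) div 2 \<le> order (of_nat t) O'"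
    "\<And>t :: nat. (n - 2 * t + 1) div 2 \<le> order (-1 - of_nat t) O'"
    "even n \<Longrightarrow> n > 0 \<Longrightarrow> 1 \<le> order (of_nat (n div 2)) O'"
    "even n \<Longrightarrow> n > 0 \<Longrightarrow> 1 \<le> order (-1 - of_nat (n div 2)) E"
proof -
  obtain E O' :: "rat poly" and s :: rat where
    E: "\<And>y. top_coeff n (2 * y) = poly E (of_nat y)" and O': "\<And>y. top_coeff n (2 * y + 1) = poly O' (of_nat y)"
    and s: "s = 1 \<or> s = -1" and OE: "\<And>x. poly O' x = s * poly E (-1 - x)" and EO: "\<And>x. poly E x = s * poly O' (-1 - x)"
    using top_coeff_polynomials by metis
  have "(\<Sum>k<n. n - k) = (\<Sum>k<n. Suc k)"
    by (rule sum.reindex_bij_witness[where i = "\<lambda>k. n - 1 - k" and j = "\<lambda>k. n - 1 - k"]) auto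
  also have "2 * \<dots> = n * (n + 1)" by (induction n) auto
  finally have weight: "2 * weight n {..<n} = n * (n + 1)" by (simp add: weight_def)
  define a :: rat where "a = schur_prod (\<lambda>k. of_nat (n - k)) {..<n} / (\<Prod>k\<in>{..<n}. fact (n - k))"
  have "schur_prod (\<lambda>k. of_nat (n - k)) {..<n} \<noteq> 0"
    by (rule schur_prod_nonzero) (auto simp: inj_on_def)
  then have a: "a \<noteq> 0" by (simp add: a_def)
  have "lead (weight n {..<n}) a (\<lambda>y. top_coeff n (2 * y))"
    using lead_esum[of "{..<n}" n] by (simp add: a_def top_coeff_def)
  then obtain p where p: "degree p \<le> weight n {..<n}" "coeff p (weight n {..<n}) = a" "\<And>y. top_coeff n (2 * y) = poly p (of_nat y)"
    by (auto simp: lead_def)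
  then have "E = p" by (intro poly_eq_if_eq_on_nat) (simp add: E[symmetric])
  then have E0: "E \<noteq> 0" and dE: "2 * degree E = n * (n + 1)"
    using p a weight le_degree[of p "weight n {..<n}"] by (auto simp: le_antisym)
  have "O' = smult s (pcompose E [:-1, -1:])"
    by (simp add: poly_eq_poly_eq_iff[symmetric] fun_eq_iff OE poly_pcompose)
  then have "degree O' = degree E" using s by (auto simp: degree_pcompose)
  then have dO: "2 * degree O' = n * (n + 1)" using dE by simp
  have O0: "O' \<noteq> 0"
  proof
    assume "O' = 0"
    then have "poly E x = 0" for x by (simp add: EO)
    then show False using E0 by (metis poly_all_0_iff_0)
  qed
  have Et: "[:- of_nat t, 1:] ^ ((n - 2 * t + 1) div 2) dvd E" for t :: nat
  proof -
    obtain q where q: "\<And>y :: nat. top_coeff n (2 * t + 2 * y) = of_nat y ^ ((n - 2 * t + 1) div 2) * poly q (of_nat y)"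
      unfolding top_coeff_def using phi_vector.esum_vanishing_order by blast
    show ?thesis
      by (rule shifted_power_dvd[of _ _ _ q]) (simp only: q[symmetric] E[symmetric] distrib_left)
  qed
  have Ot: "[:- of_nat t, 1:] ^ ((n - 2 * t) div 2) dvd O'" for t :: nat
  proof -
    obtain q where q: "\<And>y :: nat. top_coeff n (2 * t + 1 + 2 * y) = of_nat y ^ ((n - (2 * t + 1) + 1) div 2) * poly q (of_nat y)"
      unfolding top_coeff_def using phi_vector.esum_vanishing_order by blast
    have r: "(n - (2 * t + 1) + 1) div 2 = (n - 2 * t) div 2" by (cases "n \<ge> 2 * t + 1") auto
    have "2 * (t + y) + 1 = 2 * t + 1 + 2 * y" for y by simp
    then show ?thesis
      by (intro shifted_power_dvd[of _ _ _ q]) (simp only: q[unfolded r, symmetric] O'[symmetric])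
  qed
  \<comment> \<open>For even \<open>n\<close> the additional zero \<open>M = n + 1\<close> is
    \<open>2 * (n div 2) + 1\<close>, so it belongs to \<open>O'\<close>; \<open>E\<close> receives
    its reflection.\<close>
  have root: "poly O' (of_nat (n div 2)) = 0" if "even n" "n > 0"
    using esum_vanishes[OF that] O'[of "n div 2"] that by (simp add: top_coeff_def)
  then have O1: "[:- of_nat (n div 2), 1:] ^ 1 dvd O'" if "even n" "n > 0"
    using that by (simp add: poly_eq_0_iff_dvd)
  show ?thesis
  proof (rule that[of E O'])
    show "1 \<le> order (of_nat (n div 2)) O'" if "even n" "n > 0"
      using O1[OF that] O0 order_divides by blast
    show "1 \<le> order (-1 - of_nat (n div 2)) E" if "even n" "n > 0"
      using reflected_power_dvd[OF O1[OF that] EO] E0 order_divides by blast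
    show "(n - 2 * t) div 2 \<le> order (-1 - of_nat t) E" for t :: nat
      using reflected_power_dvd[OF Ot EO] E0 order_divides by blast
    show "(n - 2 * t + 1) div 2 \<le> order (-1 - of_nat t) O'" for t :: nat
      using reflected_power_dvd[OF Et OE] O0 order_divides by blast
    show "(n - 2 * t + 1) div 2 \<le> order (of_nat t) E" for t :: nat
      using Et E0 order_divides by blast
    show "(n - 2 * t) div 2 \<le> order (of_nat t) O'" for t :: nat
      using Ot O0 order_divides by blast
  qed (use E O' E0 O0 dE dO in auto)
qed

section \<open>Matching root multiplicities with Pochhammer products\<close>

lemma int_sign_cases:
  obtains t :: nat where "z = int t" | t :: nat where "z = -1 - int t"
proof (cases "z \<ge> 0")
  case True
  then show ?thesis using that(1)[of "nat z"] by simp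
next
  case False
  then show ?thesis using that(2)[of "nat (- 1 - z)"] by simp
qed

lemma card_le_fst:
  assumes "S \<subseteq> {(k, j). k \<in> B \<and> j = f k}" "finite B"
  shows "card S \<le> card B"
proof -
  have "j = f k" if "(k, j) \<in> S" for k j using assms(1) that by auto
  then have "inj_on fst S" by (intro inj_onI) (metis prod.collapse)
  moreover have "fst ` S \<subseteq> B" using assms(1) by auto
  ultimately show ?thesis using assms(2) by (metis card_image card_mono)
qed

lemma even_quotient:
  fixes p :: "rat poly" and e :: int
  assumes p: "p \<noteq> 0" "\<And>t :: nat. a - t \<le> order (of_nat t) p" "\<And>t :: nat. a - t \<le> order (-1 - of_nat t) p"
    and e: "1 \<le> order (of_int e) p" "e = int a \<or> e = -1 - int a"
  obtains q where "q \<noteq> 0" "degree q = degree p - (a * (a + 1) + 1)"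
    "\<And>y. poly p y = (\<Prod>k = 1..a. pochhammer (y - of_nat a + of_nat k) (a + 1)) * (y - of_int e) * poly q y"
proof -
  \<comment> \<open>The factor \<open>(k, j)\<close> of the double product has the root
    \<open>a - k - j\<close>. The pair \<open>(0, 0)\<close> is not among these and stands for the
    additional root \<open>e\<close>.\<close>
  define A where "A = insert (0, 0) ({1..a} \<times> {0..<a + 1})"
  define c :: "nat \<times> nat \<Rightarrow> int" where "c = (\<lambda>(k, j). if k = 0 then e else int a - int k - int j)"
  let ?B = "{1..a} \<times> {0..<a + 1}"
  have bound: "card {x \<in> ?B. c x = int t} \<le> a - t" "card {x \<in> ?B. c x = -1 - int t} \<le> a - t" for t
  proof -
    have "card {x \<in> ?B. c x = int t} \<le> card {1..a - t}"
      by (rule card_le_fst[where f = "\<lambda>k. nat (int a - int k - int t)"]) (auto simp: c_def)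
    moreover have "card {x \<in> ?B. c x = -1 - int t} \<le> card {1 + t..a}"
      by (rule card_le_fst[where f = "\<lambda>k. nat (int a - int k + 1 + int t)"]) (auto simp: c_def)
    ultimately show "card {x \<in> ?B. c x = int t} \<le> a - t" "card {x \<in> ?B. c x = -1 - int t} \<le> a - t" by simp_all
  qed
  have "card {x \<in> A. c x = z} \<le> order (of_int z) p" for z
  proof (cases "z = e")
    case True
    \<comment> \<open>\<open>e\<close> is \<open>a\<close> or \<open>-1 - a\<close>, just outside
      the range of the other roots, so the simple zero at \<open>e\<close> suffices.\<close>
    have "card {x \<in> ?B. c x = e} = 0" using bound[of a] e(2) by auto
    then have "{x \<in> ?B. c x = e} = {}" by (simp add: card_eq_0_iff)
    moreover have "{x \<in> A. c x = e} \<subseteq> insert (0, 0) {x \<in> ?B. c x = e}" by (auto simp: A_def)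
    ultimately have "{x \<in> A. c x = e} \<subseteq> {(0, 0)}" by (simp only:)
    then have "card {x \<in> A. c x = e} \<le> card {(0 :: nat, 0 :: nat)}" by (intro card_mono) auto
    then show ?thesis using True e(1) by simp
  next
    case False
    then have "{x \<in> A. c x = z} = {x \<in> ?B. c x = z}" by (auto simp: A_def c_def)
    then have eq: "card {x \<in> A. c x = z} = card {x \<in> ?B. c x = z}" by (simp only:)
    show ?thesis
    proof (cases z rule: int_sign_cases)
      case (1 t)
      then show ?thesis unfolding eq using order_trans[OF bound(1)[of t] p(2)[of t]] by simp
    next
      case (2 t)
      then show ?thesis unfolding eq using order_trans[OF bound(2)[of t] p(3)[of t]] by simp
    qed
  qed
  then obtain q where q: "q \<noteq> 0" "degree q = degree p - card A"
    "\<And>y. poly p y = (\<Prod>x\<in>A. y - of_int (c x)) * poly q y"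
    using prod_linear_quotient[of A p c] p(1) by (auto simp: A_def)
  have "(\<Prod>x\<in>A. y - of_int (c x)) = (\<Prod>k = 1..a. pochhammer (y - of_nat a + of_nat k) (a + 1)) * (y - of_int e)" for y :: rat
  proof -
    have "(\<Prod>x\<in>A. y - of_int (c x)) = (y - of_int e) * (\<Prod>x\<in>?B. y - of_int (c x))"
      by (simp add: A_def c_def)
    also have "(\<Prod>x\<in>?B. y - of_int (c x)) = (\<Prod>k\<in>{1..a}. \<Prod>j\<in>{0..<a + 1}. y - of_int (c (k, j)))"
      by (subst prod.Sigma) auto
    also have "\<dots> = (\<Prod>k = 1..a. pochhammer (y - of_nat a + of_nat k) (a + 1))"
      unfolding pochhammer_prod by (intro prod.cong) (auto simp: c_def algebra_simps)
    finally show ?thesis by simp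
  qed
  moreover have "card A = a * (a + 1) + 1" by (simp add: A_def)
  ultimately show ?thesis using that q by simp
qed

text \<open>The roots of the \<open>i\<close>-th Pochhammer symbol are the \<open>2 * i - 1\<close>
  integers at distance less than \<open>i\<close> from the centre \<open>- e\<close>. An integer at
  distance \<open>t\<close> from the centre, \<open>t < a\<close>, is therefore a root
  \<open>a - t\<close> times.\<close>

lemma odd_quotient:
  fixes p :: "rat poly" and e :: int
  assumes p: "p \<noteq> 0" "\<And>z. a - nat \<bar>z + e\<bar> \<le> order (of_int z) p"
  obtains q where "q \<noteq> 0" "degree q = degree p - a\<^sup>2"
    "\<And>y. poly p y = (\<Prod>i = 1..a. pochhammer (y + of_int e - of_nat i + 1) (2 * i - 1)) * poly q y"
proof -
  define A where "A = (SIGMA i:{1..a}. {0..<2 * i - 1})"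
  define c :: "nat \<times> nat \<Rightarrow> int" where "c = (\<lambda>(i, j). int i - 1 - int j - e)"
  have "card {x \<in> A. c x = z} \<le> order (of_int z) p" for z
  proof -
    have "card {x \<in> A. c x = z} \<le> card {nat \<bar>z + e\<bar> + 1..a}"
      by (rule card_le_fst[where f = "\<lambda>i. nat (int i - 1 - e - z)"]) (auto simp: c_def A_def)
    then show ?thesis using p(2)[of z] by simp
  qed
  then obtain q where q: "q \<noteq> 0" "degree q = degree p - card A"
    "\<And>y. poly p y = (\<Prod>x\<in>A. y - of_int (c x)) * poly q y"
    using prod_linear_quotient[of A p c] p(1) by (auto simp: A_def)
  have "(\<Prod>x\<in>A. y - of_int (c x)) = (\<Prod>i = 1..a. pochhammer (y + of_int e - of_nat i + 1) (2 * i - 1))" for y :: rat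
  proof -
    have "(\<Prod>x\<in>A. y - of_int (c x)) = (\<Prod>i\<in>{1..a}. \<Prod>j\<in>{0..<2 * i - 1}. y - of_int (c (i, j)))"
      unfolding A_def by (subst prod.Sigma) auto
    also have "\<dots> = (\<Prod>i = 1..a. pochhammer (y + of_int e - of_nat i + 1) (2 * i - 1))"
      unfolding pochhammer_prod by (intro prod.cong) (auto simp: c_def algebra_simps)
    finally show ?thesis .
  qed
  moreover have "card A = a\<^sup>2"
  proof -
    have "card A = (\<Sum>i\<in>{1..a}. 2 * i - 1)" by (simp add: A_def)
    also have "\<dots> = a\<^sup>2" by (induction a) (auto simp: power2_eq_square)
    finally show ?thesis .
  qed
  ultimately show ?thesis using that q by simp
qed

lemma affine_substitution:
  fixes q :: "rat poly"
  assumes "q \<noteq> 0" "c \<noteq> 0"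
  obtains r where "r \<noteq> 0" "degree r = degree q" "\<And>x. poly r x = c * poly q (x / 2 + d)"
proof
  let ?r = "smult c (pcompose q [:d, 1 / 2:])"
  show "?r \<noteq> 0" using assms pcompose_eq_0[of q "[:d, 1 / 2:]"] by auto
  show "degree ?r = degree q" using assms by (simp add: degree_pcompose)
  show "poly ?r x = c * poly q (x / 2 + d)" for x by (simp add: poly_pcompose add.commute)
qed

section \<open>Factorizations in the variable \<open>b\<close>\<close>

text \<open>With \<open>n = 2 * a\<close> the variable \<open>y\<close> is \<open>b / 2 + a\<close>
  or \<open>(b - 1) / 2 + a\<close>, and the remaining degree is
  \<open>a * (2 * a + 1) - a * (a + 1) - 1 = a\<^sup>2 - 1\<close>. At \<open>n = 0\<close> the
  coefficient is the constant 1, which has no linear factor.\<close>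

lemma top_coeff_factorization_even:
  assumes n: "even n" "0 < n"
  shows "\<exists>p :: rat poly. p \<noteq> 0 \<and> degree p = (n div 2)\<^sup>2 - 1 \<and>
      (\<forall>b. even b \<longrightarrow> top_coeff n (b + n) =
        (\<Prod>k = 1..n div 2. pochhammer (of_nat b / 2 + of_nat k) (n div 2 + 1))
          * (of_nat b + 2 * of_nat n + 2) * poly p (of_nat b))" (is ?P1)
    and "\<exists>p :: rat poly. p \<noteq> 0 \<and> degree p = (n div 2)\<^sup>2 - 1 \<and>
      (\<forall>b. odd b \<longrightarrow> top_coeff n (b + n) =
        (\<Prod>k = 1..n div 2. pochhammer ((of_nat b - 1) / 2 + of_nat k) (n div 2 + 1))
          * (of_nat b - 1) * poly p (of_nat b))" (is ?P2)
proof -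
  obtain E O' :: "rat poly" where
    E: "\<And>y. top_coeff n (2 * y) = poly E (of_nat y)" and O': "\<And>y. top_coeff n (2 * y + 1) = poly O' (of_nat y)"
    and nz: "E \<noteq> 0" "O' \<noteq> 0" and deg: "2 * degree E = n * (n + 1)" "2 * degree O' = n * (n + 1)"
    and ord: "\<And>t :: nat. (n - 2 * t + 1) div 2 \<le> order (of_nat t) E"
      "\<And>t :: nat. (n - 2 * t) div 2 \<le> order (-1 - of_nat t) E"
      "\<And>t :: nat. (n - 2 * t) div 2 \<le> order (of_nat t) O'"
      "\<And>t :: nat. (n - 2 * t + 1) div 2 \<le> order (-1 - of_nat t) O'"
    and ord1: "even n \<Longrightarrow> n > 0 \<Longrightarrow> 1 \<le> order (of_nat (n div 2)) O'"
      "even n \<Longrightarrow> n > 0 \<Longrightarrow> 1 \<le> order (-1 - of_nat (n div 2)) E"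
    by (rule top_coeff_polynomial_structure[of n]) blast
  have nz12: "(1 / 2 :: rat) \<noteq> 0" "(1 :: rat) \<noteq> 0" by simp_all
  define a where "a = n div 2"
  have na: "n = 2 * a" using n by (simp add: a_def)
  have half: "(n - 2 * t + 1) div 2 = a - t" "(n - 2 * t) div 2 = a - t" for t
    by (simp_all add: na diff_mult_distrib2[symmetric])
  have d: "degree E - (a * (a + 1) + 1) = a\<^sup>2 - 1" "degree O' - (a * (a + 1) + 1) = a\<^sup>2 - 1"
    using deg by (simp_all add: na power2_eq_square algebra_simps)
  show ?P1
  proof -
    obtain q where q: "q \<noteq> 0" "degree q = degree E - (a * (a + 1) + 1)"
      "\<And>y. poly E y = (\<Prod>k = 1..a. pochhammer (y - of_nat a + of_nat k) (a + 1)) * (y - of_int (-1 - int a)) * poly q y"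
      using even_quotient[of E a "-1 - int a"] nz ord(1,2)[unfolded half] ord1(2)[OF n, folded a_def] by auto
    \<comment> \<open>The constant \<open>1 / 2\<close> comes from
      \<open>y + 1 + a = (b + 2 * n + 2) / 2\<close>.\<close>
    obtain r where r: "r \<noteq> 0" "degree r = degree q" "\<And>x. poly r x = 1 / 2 * poly q (x / 2 + of_nat a)"
      using affine_substitution[OF q(1) nz12(1)] by blast
    show ?thesis
    proof (intro exI[of _ r] conjI allI impI)
      fix b :: nat assume "even b"
      then obtain c where b: "b = 2 * c" by blast
      have "top_coeff n (b + n) = poly E (of_nat (c + a))"
        using E[of "c + a"] by (simp add: b na)
      also have "\<dots> = (\<Prod>k = 1..a. pochhammer (of_nat b / 2 + of_nat k) (a + 1)) * (of_nat b + 2 * of_nat n + 2) * poly r (of_nat b)"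
        unfolding q(3) r(3) by (simp add: b na algebra_simps)
      finally show "top_coeff n (b + n) = (\<Prod>k = 1..n div 2. pochhammer (of_nat b / 2 + of_nat k) (n div 2 + 1))
        * (of_nat b + 2 * of_nat n + 2) * poly r (of_nat b)" by (simp add: a_def)
    qed (use q r d in \<open>simp_all add: a_def\<close>)
  qed
  show ?P2
  proof -
    obtain q where q: "q \<noteq> 0" "degree q = degree O' - (a * (a + 1) + 1)"
      "\<And>y. poly O' y = (\<Prod>k = 1..a. pochhammer (y - of_nat a + of_nat k) (a + 1)) * (y - of_int (int a)) * poly q y"
      using even_quotient[of O' a "int a"] nz ord(3,4)[unfolded half] ord1(1)[OF n, folded a_def] by auto
    obtain r where r: "r \<noteq> 0" "degree r = degree q" "\<And>x. poly r x = 1 / 2 * poly q (x / 2 + (of_nat a - 1 / 2))"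
      using affine_substitution[OF q(1) nz12(1)] by blast
    show ?thesis
    proof (intro exI[of _ r] conjI allI impI)
      fix b :: nat assume "odd b"
      then obtain c where b: "b = 2 * c + 1" by (blast elim: oddE)
      have "top_coeff n (b + n) = poly O' (of_nat (c + a))"
        using O'[of "c + a"] by (simp add: b na)
      also have "\<dots> = (\<Prod>k = 1..a. pochhammer ((of_nat b - 1) / 2 + of_nat k) (a + 1)) * (of_nat b - 1) * poly r (of_nat b)"
        unfolding q(3) r(3) by (simp add: b na algebra_simps add_divide_distrib)
      finally show "top_coeff n (b + n) = (\<Prod>k = 1..n div 2. pochhammer ((of_nat b - 1) / 2 + of_nat k) (n div 2 + 1))
        * (of_nat b - 1) * poly r (of_nat b)" by (simp add: a_def)
    qed (use q r d in \<open>simp_all add: a_def\<close>)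
  qed
qed

text \<open>For odd \<open>n\<close> the parities of \<open>b\<close> and \<open>M = b + n\<close>
  differ: even \<open>b\<close> belongs to \<open>O'\<close>, whose forced roots are centred at
  \<open>-1\<close>, and odd \<open>b\<close> to \<open>E\<close>, with centre 0. For
  \<open>n = 2 * a - 1\<close> the remaining degree is
  \<open>a * (2 * a - 1) - a\<^sup>2 = (n\<^sup>2 - 1) / 4\<close>.\<close>

lemma top_coeff_factorization_odd:
  assumes n: "odd n"
  shows "\<exists>p :: rat poly. p \<noteq> 0 \<and> degree p = (n\<^sup>2 - 1) div 4 \<and>
      (\<forall>b. even b \<longrightarrow> top_coeff n (b + n) =
        (\<Prod>i = 1..(n + 1) div 2. pochhammer ((of_nat n + of_nat b - 1) / 2 - of_nat i + 2) (2 * i - 1))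
          * poly p (of_nat b))" (is ?P1)
    and "\<exists>p :: rat poly. p \<noteq> 0 \<and> degree p = (n\<^sup>2 - 1) div 4 \<and>
      (\<forall>b. odd b \<longrightarrow> top_coeff n (b + n) =
        (\<Prod>i = 1..(n + 1) div 2. pochhammer ((of_nat b + of_nat n) / 2 - of_nat i + 1) (2 * i - 1))
          * poly p (of_nat b))" (is ?P2)
proof -
  obtain E O' :: "rat poly" where
    E: "\<And>y. top_coeff n (2 * y) = poly E (of_nat y)" and O': "\<And>y. top_coeff n (2 * y + 1) = poly O' (of_nat y)"
    and nz: "E \<noteq> 0" "O' \<noteq> 0" and deg: "2 * degree E = n * (n + 1)" "2 * degree O' = n * (n + 1)"
    and ord: "\<And>t :: nat. (n - 2 * t + 1) div 2 \<le> order (of_nat t) E"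
      "\<And>t :: nat. (n - 2 * t) div 2 \<le> order (-1 - of_nat t) E"
      "\<And>t :: nat. (n - 2 * t) div 2 \<le> order (of_nat t) O'"
      "\<And>t :: nat. (n - 2 * t + 1) div 2 \<le> order (-1 - of_nat t) O'"
    and ord1: "even n \<Longrightarrow> n > 0 \<Longrightarrow> 1 \<le> order (of_nat (n div 2)) O'"
      "even n \<Longrightarrow> n > 0 \<Longrightarrow> 1 \<le> order (-1 - of_nat (n div 2)) E"
    by (rule top_coeff_polynomial_structure[of n]) blast
  have nz12: "(1 / 2 :: rat) \<noteq> 0" "(1 :: rat) \<noteq> 0" by simp_all
  define a where "a = (n + 1) div 2"
  have na: "n + 1 = 2 * a" using n by (simp add: a_def)
  have half: "(n - 2 * t + 1) div 2 = a - t" if "t < a" for t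
    using na that by linarith
  have half': "(n - 2 * t) div 2 = a - Suc t" for t
    using na by presburger
  have "n * (n + 1) = 2 * (a * (2 * a - 1))" using na by (metis Suc_eq_plus1 diff_Suc_1 mult.assoc mult.commute)
  then have "degree E = a * (2 * a - 1)" "degree O' = a * (2 * a - 1)" using deg by simp_all
  moreover have "a * (2 * a - 1) - a\<^sup>2 = (n\<^sup>2 - 1) div 4"
  proof -
    obtain c where c: "a = Suc c" using na by (cases a) auto
    have "n = 2 * c + 1" using na c by simp
    then have "n\<^sup>2 - 1 = 4 * (c * (c + 1))" by (simp add: power2_eq_square algebra_simps)
    then show ?thesis by (simp add: c power2_eq_square algebra_simps)
  qed
  ultimately have d: "degree E - a\<^sup>2 = (n\<^sup>2 - 1) div 4" "degree O' - a\<^sup>2 = (n\<^sup>2 - 1) div 4" by simp_all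
  show ?P1
  proof -
    have "a - nat \<bar>z + 1\<bar> \<le> order (of_int z) O'" for z
    proof (cases z rule: int_sign_cases)
      case (1 t)
      then show ?thesis using ord(3)[of t, unfolded half'] by (simp add: nat_add_distrib)
    next
      case (2 t)
      then show ?thesis using ord(4)[of t] half[of t] by (cases "t < a") auto
    qed
    then obtain q where q: "q \<noteq> 0" "degree q = degree O' - a\<^sup>2"
      "\<And>y. poly O' y = (\<Prod>i = 1..a. pochhammer (y + of_int 1 - of_nat i + 1) (2 * i - 1)) * poly q y"
      using odd_quotient[of O' a 1] nz by blast
    obtain r where r: "r \<noteq> 0" "degree r = degree q" "\<And>x. poly r x = 1 * poly q (x / 2 + (of_nat n - 1) / 2)"
      using affine_substitution[OF q(1) nz12(2)] by blast
    show ?thesis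
    proof (intro exI[of _ r] conjI allI impI)
      fix b :: nat assume "even b"
      then obtain c where b: "b = 2 * c" by blast
      obtain m where m: "n = 2 * m + 1" using n by (blast elim: oddE)
      have y: "of_nat (c + m) = (of_nat n + of_nat b - 1) / (2 :: rat)" by (simp add: b m)
      have "top_coeff n (b + n) = poly O' (of_nat (c + m))"
        using O'[of "c + m"] by (simp add: b m)
      also have "\<dots> = (\<Prod>i = 1..a. pochhammer ((of_nat n + of_nat b - 1) / 2 - of_nat i + 2) (2 * i - 1)) * poly r (of_nat b)"
        unfolding q(3) r(3) y by (simp add: add_divide_distrib diff_divide_distrib algebra_simps)
      finally show "top_coeff n (b + n) = (\<Prod>i = 1..(n + 1) div 2. pochhammer ((of_nat n + of_nat b - 1) / 2 - of_nat i + 2) (2 * i - 1))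
        * poly r (of_nat b)" by (simp add: a_def)
    qed (use q r d in simp_all)
  qed
  show ?P2
  proof -
    have "a - nat \<bar>z + 0\<bar> \<le> order (of_int z) E" for z
    proof (cases z rule: int_sign_cases)
      case (1 t)
      then show ?thesis using ord(1)[of t] half[of t] by (cases "t < a") auto
    next
      case (2 t)
      then show ?thesis using ord(2)[of t, unfolded half'] by (simp add: nat_add_distrib)
    qed
    then obtain q where q: "q \<noteq> 0" "degree q = degree E - a\<^sup>2"
      "\<And>y. poly E y = (\<Prod>i = 1..a. pochhammer (y + of_int 0 - of_nat i + 1) (2 * i - 1)) * poly q y"
      using odd_quotient[of E a 0] nz by blast
    obtain r where r: "r \<noteq> 0" "degree r = degree q" "\<And>x. poly r x = 1 * poly q (x / 2 + of_nat n / 2)"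
      using affine_substitution[OF q(1) nz12(2)] by blast
    show ?thesis
    proof (intro exI[of _ r] conjI allI impI)
      fix b :: nat assume "odd b"
      then obtain c where b: "b = 2 * c + 1" by (blast elim: oddE)
      obtain m where m: "n = 2 * m + 1" using n by (blast elim: oddE)
      have y: "of_nat (c + m + 1) = (of_nat b + of_nat n) / (2 :: rat)" by (simp add: b m)
      have "top_coeff n (b + n) = poly E (of_nat (c + m + 1))"
        using E[of "c + m + 1"] by (simp add: b m)
      also have "\<dots> = (\<Prod>i = 1..a. pochhammer ((of_nat b + of_nat n) / 2 - of_nat i + 1) (2 * i - 1)) * poly r (of_nat b)"
        unfolding q(3) r(3) y by (simp add: add_divide_distrib algebra_simps)
      finally show "top_coeff n (b + n) = (\<Prod>i = 1..(n + 1) div 2. pochhammer ((of_nat b + of_nat n) / 2 - of_nat i + 1) (2 * i - 1))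
        * poly r (of_nat b)" by (simp add: a_def)
    qed (use q r d in simp_all)
  qed
qed

section \<open>Ordered products and interlacing sums\<close>

primrec wedge :: "nat \<Rightarrow> (nat \<Rightarrow> grassmann) \<Rightarrow> grassmann" where
  "wedge 0 w = 1"
| "wedge (Suc n) w = wedge n w * w n"

lemma wedge_cong: "(\<And>i. i < n \<Longrightarrow> f i = g i) \<Longrightarrow> wedge n f = wedge n g"
  by (induction n) auto

lemma wedge_Suc_left: "wedge (Suc n) w = w 0 * wedge n (\<lambda>i. w (Suc i))"
proof (induction n)
  case (Suc n)
  have "wedge (Suc (Suc n)) w = wedge (Suc n) w * w (Suc n)" by simp
  also have "\<dots> = w 0 * wedge (Suc n) (\<lambda>i. w (Suc i))" unfolding Suc by (simp add: mult.assoc)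
  finally show ?case .
qed simp

lemma wedge_minus_one_power:
  "wedge n (\<lambda>i. (-1) ^ k i * w i) = (-1) ^ (\<Sum>i<n. k i) * wedge n w"
proof (induction n)
  case (Suc n)
  have "wedge (Suc n) (\<lambda>i. (-1) ^ k i * w i) = (-1) ^ (\<Sum>i<n. k i) * (wedge n w * (-1) ^ k n) * w n"
    by (simp add: Suc mult.assoc)
  also have "\<dots> = (-1) ^ (\<Sum>i<Suc n. k i) * wedge (Suc n) w"
    by (simp only: minus_one_power_commute[of "k n" "wedge n w", symmetric]) (simp add: mult.assoc power_add)
  finally show ?case .
qed simp

text \<open>A row operation: \<open>a i * a (Suc i)\<close> does not change when
  \<open>a (Suc i)\<close> is subtracted from its left factor.\<close>

lemma wedge_telescope:
  assumes "\<And>i. homog 1 (a i)"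
  shows "wedge (Suc n) a = wedge n (\<lambda>i. a i - a (Suc i)) * a n"
proof (induction n)
  case (Suc n)
  have "wedge (Suc (Suc n)) a = wedge n (\<lambda>i. a i - a (Suc i)) * (a n * a (Suc n))"
    using Suc by (simp add: mult.assoc)
  also have "a n * a (Suc n) = (a n - a (Suc n)) * a (Suc n)"
    using vector_square[OF assms] by (simp add: left_diff_distrib)
  finally show ?case by (simp add: mult.assoc)
qed simp

lemma wedge_telescope_zero:
  assumes "\<And>i. homog 1 (a i)" "a n = 0"
  shows "wedge n (\<lambda>i. a i - a (Suc i)) = wedge n a"
proof (cases n)
  case (Suc m)
  then show ?thesis using wedge_telescope[of a m] assms by simp
qed simp

definition Box :: "nat \<Rightarrow> (nat \<Rightarrow> nat set) \<Rightarrow> (nat \<Rightarrow> nat) set" where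
  "Box n B = {u. (\<forall>i<n. u i \<in> B i) \<and> (\<forall>i\<ge>n. u i = 0)}"

lemma Box_Suc: "Box (Suc n) B = (\<lambda>(u, x). u(n := x)) ` (Box n B \<times> B n)"
proof (intro equalityI subsetI)
  fix u assume "u \<in> Box (Suc n) B"
  then have "(u(n := 0), u n) \<in> Box n B \<times> B n" by (auto simp: Box_def)
  then show "u \<in> (\<lambda>(u, x). u(n := x)) ` (Box n B \<times> B n)" by (rule rev_image_eqI) simp
qed (auto simp: Box_def less_Suc_eq)

lemma finite_Box: "(\<And>i. i < n \<Longrightarrow> finite (B i)) \<Longrightarrow> finite (Box n B)"
proof (induction n)
  case 0
  have "Box 0 B \<subseteq> {\<lambda>_. 0}" by (auto simp: Box_def)
  then show ?case by (rule finite_subset) simp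
qed (simp add: Box_Suc)

lemma sum_Box_wedge: "(\<Sum>u\<in>Box n B. wedge n (\<lambda>i. f i (u i))) = wedge n (\<lambda>i. \<Sum>x\<in>B i. f i x)"
proof (induction n)
  case 0
  have "Box 0 B = {\<lambda>_. 0}" by (auto simp: Box_def)
  then show ?case by simp
next
  case (Suc n)
  have "inj_on (\<lambda>(u, x). u(n := x)) (Box n B \<times> B n)"
  proof (rule inj_onI, clarify)
    fix u x u' x' assume "u \<in> Box n B" "u' \<in> Box n B" and eq: "u(n := x) = u'(n := x')"
    then have "u i = u' i" for i
      using eq by (cases "i = n") (simp add: Box_def, metis fun_upd_other)
    with fun_cong[OF eq, of n] show "u = u' \<and> x = x'" by auto
  qed
  then have "(\<Sum>u\<in>Box (Suc n) B. wedge (Suc n) (\<lambda>i. f i (u i))) =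
      (\<Sum>(u, x)\<in>Box n B \<times> B n. wedge n (\<lambda>i. f i (u i)) * f n x)"
    unfolding Box_Suc by (subst sum.reindex) (auto simp: o_def case_prod_beta intro!: sum.cong arg_cong2[where f = "(*)"] wedge_cong)
  also have "\<dots> = wedge (Suc n) (\<lambda>i. \<Sum>x\<in>B i. f i x)"
    by (simp add: Suc[symmetric] sum_product sum.cartesian_product)
  finally show ?case .
qed

definition supported :: "nat \<Rightarrow> grassmann \<Rightarrow> bool" where
  "supported n x \<longleftrightarrow> (\<forall>K. cf x K \<noteq> 0 \<longrightarrow> K \<subseteq> {..<n})"

lemma supported_mult: "supported n x \<Longrightarrow> supported n y \<Longrightarrow> supported n (x * y)"
  unfolding supported_def cf_mult
proof (intro allI impI)
  fix K assume x: "\<forall>K. cf x K \<noteq> 0 \<longrightarrow> K \<subseteq> {..<n}" and y: "\<forall>K. cf y K \<noteq> 0 \<longrightarrow> K \<subseteq> {..<n}"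
    and "(\<Sum>S\<in>Pow K. shuffle_sign S (K - S) * cf x S * cf y (K - S)) \<noteq> 0"
  then obtain S where "S \<subseteq> K" "cf x S \<noteq> 0" "cf y (K - S) \<noteq> 0"
    by (auto elim!: sum.not_neutral_contains_not_neutral)
  then show "K \<subseteq> {..<n}" using x y by blast
qed

lemma supported_diff: "supported n x \<Longrightarrow> supported n y \<Longrightarrow> supported n (x - y)"
  unfolding supported_def cf_simps by (metis diff_0_right)

lemma supported_sum: "(\<And>a. a \<in> A \<Longrightarrow> supported n (f a)) \<Longrightarrow> supported n (sum f A)"
proof (induction A rule: infinite_finite_induct)
  case (insert a A)
  then have "supported n (f a)" "supported n (sum f A)" by auto
  then have "supported n (f a + sum f A)" unfolding supported_def cf_simps by (metis add_0)
  with insert show ?case by simp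
qed (auto simp: supported_def)

lemma supported_phi_vector: "supported n (phi_vector n l)"
  unfolding supported_def
proof (intro allI impI)
  fix K assume nz: "cf (phi_vector n l) K \<noteq> 0"
  then have "card K = 1" using homog_phi_vector[of n l] by (auto simp: homog_def)
  then obtain k where "K = {k}" by (auto simp: card_1_singleton_iff)
  with nz show "K \<subseteq> {..<n}" by (auto simp: cf_phi_vector split: if_splits)
qed

lemma supported_wedge: "(\<And>i. i < m \<Longrightarrow> supported n (w i)) \<Longrightarrow> supported n (wedge m w)"
  by (induction m) (auto simp: supported_def[of _ 1] cf_one split: if_splits intro: supported_mult)

lemma homog_wedge: "(\<And>i. i < m \<Longrightarrow> homog 1 (w i)) \<Longrightarrow> homog m (wedge m w)"
proof (induction m)
  case (Suc m)
  then show ?case using homog_mult[of m "wedge m w" 1 "w m"] by simp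
qed simp

text \<open>Adjoining a constant function to the family of functions turns a sum over interlacing
  sequences into a product with one more factor.\<close>

lemma wedge_border:
  assumes c: "\<And>i. homog 1 (c i)" "\<And>i. supported n (c i)"
  shows "cf (wedge (Suc n) (\<lambda>i. c i + vec (Suc n) (\<lambda>k. if k = n then 1 else 0))) {..<Suc n} =
    cf (wedge n (\<lambda>i. c i - c (Suc i))) {..<n}"
proof -
  define e where "e = vec (Suc n) (\<lambda>k. if k = n then 1 else 0)"
  define x where "x = wedge n (\<lambda>i. c i - c (Suc i))"
  have "homog 1 (c i + e)" for i using c(1) by (intro homog_add) (simp_all add: e_def)
  then have "wedge (Suc n) (\<lambda>i. c i + e) = x * (c n + e)"
    using wedge_telescope[of "\<lambda>i. c i + e"] by (simp add: x_def)
  moreover have "homog n x" unfolding x_def using c(1) by (intro homog_wedge homog_diff) auto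
  moreover have "supported n x" unfolding x_def using c(2) by (intro supported_wedge supported_diff) auto
  \<comment> \<open>\<open>x\<close> has degree \<open>n\<close> and involves only the first
    \<open>n\<close> generators, so the last factor must supply the generator \<open>n\<close>,
    which occurs only in \<open>e\<close>.\<close>
  moreover have "cf (x * (c n + e)) {..<Suc n} =
    (\<Sum>S\<in>Pow {..<Suc n}. if S = {..<n} then cf x {..<n} else 0)"
    unfolding cf_mult
  proof (rule sum.cong[OF refl])
    fix S assume S: "S \<in> Pow {..<Suc n}"
    show "shuffle_sign S ({..<Suc n} - S) * cf x S * cf (c n + e) ({..<Suc n} - S) =
        (if S = {..<n} then cf x {..<n} else 0)"
    proof (cases "S = {..<n}")
      case True
      have "{..<Suc n} - {..<n} = {n}" by auto
      moreover have "shuffle_sign {..<n} {n} = 1" unfolding shuffle_sign_def by (intro prod.neutral) auto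
      moreover have "cf (c n) {n} = 0" using c(2)[of n] by (auto simp: supported_def)
      ultimately show ?thesis using True by (simp add: e_def)
    next
      case False
      have "cf x S = 0"
      proof (rule ccontr)
        assume "cf x S \<noteq> 0"
        then have "S \<subseteq> {..<n}" "card S = n" using \<open>supported n x\<close> \<open>homog n x\<close> by (auto simp: supported_def homog_def)
        then show False using False card_subset_eq[of "{..<n}" S] by simp
      qed
      then show ?thesis using False by simp
    qed
  qed
  ultimately show ?thesis by (simp add: e_def x_def)
qed

section \<open>Summation formulas for the vectors\<close>

text \<open>Pascal's rule makes the sum telescope in steps of two, hence two terms on the right. The
  lower boundary values \<open>phi (Suc k) 0\<close> and \<open>phi (Suc k) 1\<close>
  vanish.\<close>

lemma sum_phi: "(\<Sum>l\<in>{1..u}. phi k (int l)) = phi (Suc k) (int u) + phi (Suc k) (int u + 1)"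
proof (induction u)
  case 0
  have "phi (Suc k) 1 = 0"
  proof (cases "odd k")
    case True
    then obtain m where k: "k = 2 * m + 1" by (elim oddE)
    have "(of_int 1 + of_nat (Suc k) - 1) / 2 = (of_nat (m + 1) :: rat)" by (simp add: k field_simps)
    then have "phi (Suc k) 1 = of_nat (m + 1) gchoose Suc k" using True by (simp only: phi_def) simp
    also have "\<dots> = 0" by (simp only: binomial_gbinomial[symmetric]) (subst binomial_eq_0, simp_all add: k)
    finally show ?thesis .
  qed (simp add: phi_def)
  then show ?case by (simp add: phi_0_right)
next
  case (Suc u)
  define a :: rat where "a = (of_nat u + of_nat k) / 2"
  have "phi k (int u + 1) + phi (Suc k) (int u) = phi (Suc k) (int u + 2)"
  proof (cases "even (u + k)")
    case True
    have "(of_int (int u + 1) + of_nat k - 1) / 2 = a" "(of_int (int u) + of_nat (Suc k) - 1) / 2 = a"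
      "(of_int (int u + 2) + of_nat (Suc k) - 1) / 2 = a + 1"
      by (simp_all add: a_def field_simps)
    then have "phi k (int u + 1) = (if even (int u + 1 + int k + 1) then a gchoose k else 0)"
      "phi (Suc k) (int u) = (if even (int u + int (Suc k) + 1) then a gchoose Suc k else 0)"
      "phi (Suc k) (int u + 2) = (if even (int u + 2 + int (Suc k) + 1) then (a + 1) gchoose Suc k else 0)"
      by (simp_all only: phi_def)
    then show ?thesis using True gbinomial_Suc_Suc[of a k] by simp
  qed (simp add: phi_def)
  moreover have "{1..Suc u} = insert (Suc u) {1..u}" by auto
  ultimately show ?case using Suc by (simp add: add.commute add.left_commute)
qed

lemma alternating_telescope:
  fixes g :: "nat \<Rightarrow> rat"
  shows "(\<Sum>t<m. (-1) ^ t * (g t + g (Suc t))) = g 0 - (-1) ^ m * g m"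
  by (induction m) (auto simp: algebra_simps)

text \<open>An ordinary summation followed by an alternating one raises every \<open>phi\<close> by
  one: the first yields a sum of two neighbouring values, which the second telescopes. In the
  adjoined coordinate, the alternating sum of ones is the indicator \<open>phi 0\<close> of odd
  \<open>m\<close>.\<close>

lemma interlacing_vector:
  "(\<Sum>t<m. (-1) ^ t * ((\<Sum>l\<in>{1..t}. phi_vector n (int l)) + vec (Suc n) (\<lambda>k. if k = n then 1 else 0))) =
    (-1) ^ Suc m * phi_vector (Suc n) (int m)"
proof (rule vector_eqI)
  show "homog 1 (\<Sum>t<m. (-1) ^ t * ((\<Sum>l\<in>{1..t}. phi_vector n (int l)) + vec (Suc n) (\<lambda>k. if k = n then 1 else 0)))"
    by (intro homog_sum homog_minus_one_power homog_add) (simp_all del: power_Suc)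
  show "homog 1 ((-1) ^ Suc m * phi_vector (Suc n) (int m))"
    by (intro homog_minus_one_power) simp
  fix k
  consider "k < n" | "k = n" | "k > n" by linarith
  then show "cf (\<Sum>t<m. (-1) ^ t * ((\<Sum>l\<in>{1..t}. phi_vector n (int l)) + vec (Suc n) (\<lambda>k. if k = n then 1 else 0))) {k} =
    cf ((-1) ^ Suc m * phi_vector (Suc n) (int m)) {k}"
  proof cases
    case 1
    then have k: "n - k = Suc (n - 1 - k)" by simp
    have "cf (\<Sum>t<m. (-1) ^ t * ((\<Sum>l\<in>{1..t}. phi_vector n (int l)) + vec (Suc n) (\<lambda>k. if k = n then 1 else 0))) {k} =
        (\<Sum>t<m. (-1) ^ t * (phi (n - k) (int t) + phi (n - k) (int (Suc t))))"
      using 1 by (simp add: cf_phi_vector sum_phi[of "n - 1 - k", folded k, simplified] add.commute)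
    also have "\<dots> = - ((-1) ^ m * phi (n - k) (int m))"
      unfolding alternating_telescope[of "\<lambda>t. phi (n - k) (int t)"] by (simp add: phi_0_right)
    also have "\<dots> = cf ((-1) ^ Suc m * phi_vector (Suc n) (int m)) {k}"
      using 1 by (simp only: cf_minus_one_power_mult) (simp add: cf_phi_vector)
    finally show ?thesis .
  next
    case 2
    have "(\<Sum>t<m. (-1) ^ t) = (if odd m then 1 else 0 :: rat)" by (induction m) auto
    then show ?thesis using 2 by (simp only: cf_minus_one_power_mult) (simp add: cf_phi_vector phi_def)
  next
    case 3
    then show ?thesis by (simp only: cf_minus_one_power_mult) (simp add: cf_phi_vector)
  qed
qed

lemma sum_interval_closed:
  fixes g :: "nat \<Rightarrow> 'a :: ab_group_add"
  assumes "a \<le> b"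
  shows "(\<Sum>x\<in>{a..b}. g (x + Suc k)) = sum g {1..b + Suc k} - sum g {1..a + k}"
  using assms by (induction b rule: dec_induct) (auto simp: algebra_simps atLeastAtMostSuc_conv)

lemma sum_interval_open:
  fixes g :: "nat \<Rightarrow> 'a :: ab_group_add"
  assumes "a \<le> b"
  shows "(\<Sum>x\<in>{a..b}. g (x + k)) = sum g {..<b + Suc k} - sum g {..<a + k}"
  using assms by (induction b rule: dec_induct) (auto simp: algebra_simps atLeastAtMostSuc_conv)

section \<open>Symplectic patterns\<close>

text \<open>Row \<open>d\<close> of a pattern lists the part above height \<open>b\<close> of the diagonal \<open>j - i = d\<close> of a
  plane partition; the entry with index \<open>i\<close> belongs to row \<open>i + 1\<close> of the plane partition.\<close>

definition row_patterns :: "nat \<Rightarrow> (nat \<Rightarrow> nat) \<Rightarrow> (nat \<Rightarrow> nat \<Rightarrow> nat) set" where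
  "row_patterns n l = {h. h 0 = l \<and> (\<forall>d i. h (Suc d) i \<le> h d i \<and> h d (Suc i) \<le> h (Suc d) i) \<and>
     (\<forall>d i. n \<le> i + d div 2 \<longrightarrow> h d i = 0)}"

definition pattern_sum :: "nat \<Rightarrow> (nat \<Rightarrow> nat \<Rightarrow> nat) \<Rightarrow> nat" where
  "pattern_sum n h = (\<Sum>d<2 * n. \<Sum>i<n. h d i)"

definition interlacing :: "nat \<Rightarrow> (nat \<Rightarrow> nat) \<Rightarrow> (nat \<Rightarrow> nat) set" where
  "interlacing n l = Box n (\<lambda>i. {l (Suc i)..l i})"

lemma finite_interlacing [simp]: "finite (interlacing n l)"
  by (simp add: interlacing_def finite_Box)

text \<open>Row \<open>d\<close> has \<open>n - d div 2\<close> possibly nonzero entries. The length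
  drops only at every second row, so rows are split off in pairs.\<close>

definition glue :: "(nat \<Rightarrow> nat) \<Rightarrow> (nat \<Rightarrow> nat) \<Rightarrow> (nat \<Rightarrow> nat \<Rightarrow> nat) \<Rightarrow> nat \<Rightarrow> nat \<Rightarrow> nat" where
  "glue l m h d = (case d of 0 \<Rightarrow> l | Suc 0 \<Rightarrow> m | Suc (Suc d) \<Rightarrow> h d)"

lemma row_patterns_Suc:
  assumes l: "\<And>i. Suc n \<le> i \<Longrightarrow> l i = 0"
  shows "row_patterns (Suc n) l = (\<lambda>(m, k, h). glue l m h) ` (SIGMA m:interlacing (Suc n) l. SIGMA k:interlacing n m. row_patterns n k)"
proof (intro equalityI subsetI)
  fix h assume "h \<in> row_patterns (Suc n) l"
  then have h0: "h 0 = l" and h1: "\<And>d i. h (Suc d) i \<le> h d i" "\<And>d i. h d (Suc i) \<le> h (Suc d) i"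
    and h2: "\<And>d i. Suc n \<le> i + d div 2 \<Longrightarrow> h d i = 0" by (auto simp: row_patterns_def)
  have "h 1 \<in> interlacing (Suc n) l"
    using h1[of 0] h2[of _ 1] by (auto simp: interlacing_def Box_def h0[symmetric])
  moreover have "h 2 \<in> interlacing n (h 1)"
    using h1[of 1] h2[of _ 2] by (auto simp: interlacing_def Box_def numeral_2_eq_2)
  moreover have "(\<lambda>d. h (Suc (Suc d))) \<in> row_patterns n (h 2)"
    using h1 h2[of _ "Suc (Suc _)"] by (auto simp: row_patterns_def numeral_2_eq_2[symmetric] simp del: One_nat_def)
  moreover have "h = glue l (h 1) (\<lambda>d. h (Suc (Suc d)))"
    by (rule ext) (auto simp: glue_def h0 split: nat.split)
  ultimately show "h \<in> (\<lambda>(m, k, h). glue l m h) ` (SIGMA m:interlacing (Suc n) l. SIGMA k:interlacing n m. row_patterns n k)"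
    by (intro image_eqI[of _ _ "(h 1, h 2, \<lambda>d. h (Suc (Suc d)))"]) auto
next
  fix g assume "g \<in> (\<lambda>(m, k, h). glue l m h) ` (SIGMA m:interlacing (Suc n) l. SIGMA k:interlacing n m. row_patterns n k)"
  then obtain m k h where g: "g = glue l m h" and m: "m \<in> interlacing (Suc n) l" and k: "k \<in> interlacing n m" and h: "h \<in> row_patterns n k"
    by auto
  have m': "m i \<le> l i" "l (Suc i) \<le> m i" for i
    using m l[of i] l[of "Suc i"] by (cases "i < Suc n"; auto simp: interlacing_def Box_def)+
  have mz: "m i = 0" if "Suc n \<le> i" for i using m that by (auto simp: interlacing_def Box_def)
  have k': "k i \<le> m i" "m (Suc i) \<le> k i" for i
    using k mz[of "Suc i"] by (cases "i < n"; auto simp: interlacing_def Box_def)+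
  have h': "h 0 = k" "\<And>d i. h (Suc d) i \<le> h d i" "\<And>d i. h d (Suc i) \<le> h (Suc d) i"
    "\<And>d i. n \<le> i + d div 2 \<Longrightarrow> h d i = 0" using h by (auto simp: row_patterns_def)
  have "g (Suc d) i \<le> g d i \<and> g d (Suc i) \<le> g (Suc d) i" for d i
    using m' k' h' by (auto simp: g glue_def split: nat.split)
  moreover have "g d i = 0" if "Suc n \<le> i + d div 2" for d i
    using that l mz h'(4) by (auto simp: g glue_def split: nat.split)
  moreover have "g 0 = l" by (simp add: g glue_def)
  ultimately show "g \<in> row_patterns (Suc n) l" by (simp add: row_patterns_def)
qed

lemma interlacing_zero: "m \<in> interlacing n l \<Longrightarrow> n \<le> i \<Longrightarrow> m i = 0"
  by (simp add: interlacing_def Box_def)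

lemma row_patterns_0: "row_patterns 0 (\<lambda>_. 0) = {\<lambda>_ _. 0}"
  by (auto simp: row_patterns_def fun_eq_iff)

lemma finite_row_patterns: "(\<And>i. n \<le> i \<Longrightarrow> l i = 0) \<Longrightarrow> finite (row_patterns n l)"
proof (induction n arbitrary: l)
  case 0
  have "row_patterns 0 l \<subseteq> {\<lambda>_ _. 0}" by (auto simp: row_patterns_def fun_eq_iff)
  then show ?case by (rule finite_subset) simp
next
  case (Suc n)
  have "finite ((\<lambda>(m, k, h). glue l m h) ` (SIGMA m:interlacing (Suc n) l. SIGMA k:interlacing n m. row_patterns n k))"
    by (intro finite_imageI finite_SigmaI finite_interlacing Suc.IH) (auto dest: interlacing_zero)
  then show ?case by (subst row_patterns_Suc) (auto simp: Suc.prems)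
qed

lemma pattern_sum_glue:
  assumes "h \<in> row_patterns n k"
  shows "pattern_sum (Suc n) (glue l m h) = (\<Sum>i<Suc n. l i) + (\<Sum>i<Suc n. m i) + pattern_sum n h"
proof -
  have "h d n = 0" for d using assms by (auto simp: row_patterns_def)
  then have "pattern_sum n h = (\<Sum>d<2 * n. \<Sum>i<Suc n. h d i)" by (simp add: pattern_sum_def)
  moreover have "pattern_sum (Suc n) (glue l m h) = (\<Sum>d<Suc (Suc (2 * n)). \<Sum>i<Suc n. glue l m h d i)"
    by (simp add: pattern_sum_def)
  ultimately show ?thesis
    by (simp only: sum.lessThan_Suc_shift[of _ "Suc (2 * n)"] sum.lessThan_Suc_shift[of _ "2 * n"]) (simp add: glue_def)
qed

lemma sum_row_patterns_Suc:
  assumes l: "\<And>i. Suc n \<le> i \<Longrightarrow> l i = 0"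
  shows "(\<Sum>h\<in>row_patterns (Suc n) l. (-1) ^ pattern_sum (Suc n) h) =
    (\<Sum>m\<in>interlacing (Suc n) l. (-1) ^ ((\<Sum>i<Suc n. l i) + (\<Sum>i<Suc n. m i)) * (\<Sum>k\<in>interlacing n m. \<Sum>h\<in>row_patterns n k. (-1 :: rat) ^ pattern_sum n h))"
proof -
  let ?S = "SIGMA m:interlacing (Suc n) l. SIGMA k:interlacing n m. row_patterns n k"
  have "inj_on (\<lambda>(m, k, h). glue l m h) ?S"
  proof (rule inj_onI)
    fix p p' assume S: "p \<in> ?S" "p' \<in> ?S" and "(case p of (m, k, h) \<Rightarrow> glue l m h) = (case p' of (m, k, h) \<Rightarrow> glue l m h)"
    moreover obtain m k h m' k' h' where p: "p = (m, k, h)" "p' = (m', k', h')" by (metis prod_cases3)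
    ultimately have eq: "glue l m h = glue l m' h'" by simp
    have "k = h 0" "k' = h' 0" using S by (auto simp: p row_patterns_def)
    moreover have "m = m'" using fun_cong[OF eq, of 1] by (simp add: glue_def)
    moreover have "h d = h' d" for d using fun_cong[OF eq, of "Suc (Suc d)"] by (simp add: glue_def)
    then have "h = h'" ..
    ultimately show "p = p'" by (simp add: p)
  qed
  moreover have "row_patterns (Suc n) l = (\<lambda>(m, k, h). glue l m h) ` ?S"
    by (rule row_patterns_Suc) (rule l)
  ultimately have "(\<Sum>h\<in>row_patterns (Suc n) l. (-1) ^ pattern_sum (Suc n) h) = (\<Sum>(m, k, h)\<in>?S. (-1 :: rat) ^ pattern_sum (Suc n) (glue l m h))"
    by (simp only: sum.reindex) (simp add: o_def case_prod_beta)
  also have "\<dots> = (\<Sum>(m, k, h)\<in>?S. (-1 :: rat) ^ ((\<Sum>i<Suc n. l i) + (\<Sum>i<Suc n. m i)) * (-1) ^ pattern_sum n h)"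
    by (intro sum.cong) (auto simp: pattern_sum_glue power_add simp del: sum.lessThan_Suc)
  also have "\<dots> = (\<Sum>m\<in>interlacing (Suc n) l. \<Sum>k\<in>interlacing n m. \<Sum>h\<in>row_patterns n k.
      (-1 :: rat) ^ ((\<Sum>i<Suc n. l i) + (\<Sum>i<Suc n. m i)) * (-1) ^ pattern_sum n h)"
    by (simp add: sum.Sigma finite_row_patterns interlacing_zero del: sum.lessThan_Suc)
  finally show ?thesis by (simp add: sum_distrib_left)
qed

text \<open>The sign of row \<open>k\<close> is already part of the induction hypothesis, so
  \<open>k\<close> is summed without sign and \<open>m\<close> with alternating signs. Together
  these are the two summations of \<open>interlacing_vector\<close>.\<close>

lemma sum_row_patterns_eq_wedge:
  assumes "\<And>i. l (Suc i) \<le> l i" "\<And>i. n \<le> i \<Longrightarrow> l i = 0"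
  shows "(\<Sum>h\<in>row_patterns n l. (-1) ^ pattern_sum n h) = cf (wedge n (\<lambda>i. phi_vector n (int (l i + (n - i))))) {..<n}"
  using assms
proof (induction n arbitrary: l)
  case 0
  then have "l = (\<lambda>_. 0)" by auto
  then show ?case by (simp add: row_patterns_0 pattern_sum_def cf_one)
next
  case (Suc n)
  define F where "F u = (\<Sum>x\<in>{1..u}. phi_vector n (int x))" for u
  define e where "e = vec (Suc n) (\<lambda>k. if k = n then 1 else 0)"
  have F1: "homog 1 (F u)" and F2: "supported n (F u)" for u
    unfolding F_def by (auto intro!: homog_sum supported_sum supported_phi_vector)
  have inner: "(\<Sum>k\<in>interlacing n m. \<Sum>h\<in>row_patterns n k. (-1) ^ pattern_sum n h) =
      cf (wedge (Suc n) (\<lambda>i. F (m i + (n - i)) + e)) {..<Suc n}" if m: "m \<in> interlacing (Suc n) l" for m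
  proof -
    have dec: "m (Suc i) \<le> m i" if "i < n" for i
    proof -
      have "m (Suc i) \<le> l (Suc i)" "l (Suc i) \<le> m i" using m that by (auto simp: interlacing_def Box_def)
      then show ?thesis by simp
    qed
    have "(\<Sum>k\<in>interlacing n m. \<Sum>h\<in>row_patterns n k. (-1) ^ pattern_sum n h) =
        (\<Sum>k\<in>interlacing n m. cf (wedge n (\<lambda>i. phi_vector n (int (k i + (n - i))))) {..<n})"
    proof (rule sum.cong[OF refl])
      fix k assume k: "k \<in> interlacing n m"
      have "k (Suc i) \<le> k i" for i
      proof (cases "Suc i < n")
        case True
        then have "k (Suc i) \<le> m (Suc i)" "m (Suc i) \<le> k i" using k by (auto simp: interlacing_def Box_def)
        then show ?thesis by simp
      next
        case False
        then show ?thesis using interlacing_zero[OF k] by simp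
      qed
      then show "(\<Sum>h\<in>row_patterns n k. (-1) ^ pattern_sum n h) = cf (wedge n (\<lambda>i. phi_vector n (int (k i + (n - i))))) {..<n}"
        by (intro Suc.IH interlacing_zero[OF k])
    qed
    also have "\<dots> = cf (wedge n (\<lambda>i. \<Sum>x\<in>{m (Suc i)..m i}. phi_vector n (int (x + (n - i))))) {..<n}"
      unfolding interlacing_def sum_Box_wedge[symmetric] by simp
    \<comment> \<open>After the shifts by \<open>n - i\<close>, the range of factor \<open>i\<close>
      starts directly above the end of the range of factor \<open>i + 1\<close>. So the factors are
      differences of consecutive terms of one sequence.\<close>
    also have "wedge n (\<lambda>i. \<Sum>x\<in>{m (Suc i)..m i}. phi_vector n (int (x + (n - i)))) =
        wedge n (\<lambda>i. F (m i + (n - i)) - F (m (Suc i) + (n - Suc i)))"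
    proof (rule wedge_cong)
      fix i assume i: "i < n"
      then have "n - i = Suc (n - Suc i)" by simp
      then show "(\<Sum>x\<in>{m (Suc i)..m i}. phi_vector n (int (x + (n - i)))) = F (m i + (n - i)) - F (m (Suc i) + (n - Suc i))"
        using sum_interval_closed[OF dec[OF i], of "\<lambda>x. phi_vector n (int x)" "n - Suc i"] by (simp add: F_def)
    qed
    also have "cf \<dots> {..<n} = cf (wedge (Suc n) (\<lambda>i. F (m i + (n - i)) + e)) {..<Suc n}"
      unfolding e_def by (rule wedge_border[symmetric]) (rule F1 F2)+
    finally show ?thesis .
  qed
  \<comment> \<open>\<open>L\<close> collects the signs of the given row, \<open>C\<close> those
    caused by the shifts \<open>n - i\<close>; both cancel against the signs of
    \<open>G\<close>.\<close>
  define L where "L = (\<Sum>i<Suc n. l i)"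
  define C where "C = (\<Sum>i<Suc n. n - i)"
  define G where "G u = (\<Sum>t<u. (-1) ^ t * (F t + e))" for u
  have G: "G u = (-1) ^ Suc u * phi_vector (Suc n) (int u)" for u
    unfolding G_def F_def e_def by (rule interlacing_vector)
  have "(\<Sum>h\<in>row_patterns (Suc n) l. (-1) ^ pattern_sum (Suc n) h) =
      (\<Sum>m\<in>interlacing (Suc n) l. (-1 :: rat) ^ (L + (\<Sum>i<Suc n. m i)) * (\<Sum>k\<in>interlacing n m. \<Sum>h\<in>row_patterns n k. (-1) ^ pattern_sum n h))"
    unfolding L_def by (rule sum_row_patterns_Suc) (rule Suc.prems(2))
  also have "\<dots> =
      (\<Sum>m\<in>interlacing (Suc n) l. (-1) ^ (L + (\<Sum>i<Suc n. m i)) * cf (wedge (Suc n) (\<lambda>i. F (m i + (n - i)) + e)) {..<Suc n})"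
    by (intro sum.cong refl) (simp only: inner)
  also have "\<dots> = (\<Sum>m\<in>interlacing (Suc n) l. (-1) ^ (L + C) *
      cf (wedge (Suc n) (\<lambda>i. (-1) ^ (m i + (n - i)) * (F (m i + (n - i)) + e))) {..<Suc n})"
  proof (rule sum.cong[OF refl])
    fix m
    have "(-1 :: rat) ^ (L + (\<Sum>i<Suc n. m i)) = (-1) ^ (L + C) * (-1) ^ (\<Sum>i<Suc n. m i + (n - i))"
      unfolding sum.distrib C_def[symmetric] by (auto simp: minus_one_power_iff simp del: sum.lessThan_Suc)
    then show "(-1) ^ (L + (\<Sum>i<Suc n. m i)) * cf (wedge (Suc n) (\<lambda>i. F (m i + (n - i)) + e)) {..<Suc n} =
        (-1) ^ (L + C) * cf (wedge (Suc n) (\<lambda>i. (-1) ^ (m i + (n - i)) * (F (m i + (n - i)) + e))) {..<Suc n}"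
      unfolding wedge_minus_one_power cf_minus_one_power_mult by (simp only: mult.assoc)
  qed
  also have "\<dots> = (-1) ^ (L + C) * cf (\<Sum>m\<in>interlacing (Suc n) l.
      wedge (Suc n) (\<lambda>i. (-1) ^ (m i + (n - i)) * (F (m i + (n - i)) + e))) {..<Suc n}"
    by (simp only: sum_distrib_left cf_sum)
  also have "(\<Sum>m\<in>interlacing (Suc n) l. wedge (Suc n) (\<lambda>i. (-1) ^ (m i + (n - i)) * (F (m i + (n - i)) + e))) =
      wedge (Suc n) (\<lambda>i. \<Sum>x\<in>{l (Suc i)..l i}. (-1) ^ (x + (n - i)) * (F (x + (n - i)) + e))"
    unfolding interlacing_def sum_Box_wedge[symmetric] ..
  also have "\<dots> = wedge (Suc n) (\<lambda>i. G (l i + (Suc n - i)) - G (l (Suc i) + (Suc n - Suc i)))"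
  proof (rule wedge_cong)
    fix i assume "i < Suc n"
    then have "Suc n - i = Suc (n - i)" by simp
    then show "(\<Sum>x\<in>{l (Suc i)..l i}. (-1) ^ (x + (n - i)) * (F (x + (n - i)) + e)) =
        G (l i + (Suc n - i)) - G (l (Suc i) + (Suc n - Suc i))"
      using sum_interval_open[OF Suc.prems(1), of "\<lambda>x. (-1) ^ x * (F x + e)" "n - i" i] by (simp add: G_def)
  qed
  also have "\<dots> = wedge (Suc n) (\<lambda>i. G (l i + (Suc n - i)))"
  proof (rule wedge_telescope_zero)
    show "homog 1 (G (l i + (Suc n - i)))" for i
      unfolding G by (intro homog_minus_one_power) simp
    \<comment> \<open>\<open>l (Suc n) = 0\<close>, so this is the empty sum \<open>G 0\<close>, and
      the telescoping leaves no boundary term.\<close>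
    show "G (l (Suc n) + (Suc n - Suc n)) = 0" using Suc.prems(2)[of "Suc n"] by (simp add: G_def)
  qed
  also have "\<dots> = (-1) ^ (\<Sum>i<Suc n. Suc (l i + (Suc n - i))) * wedge (Suc n) (\<lambda>i. phi_vector (Suc n) (int (l i + (Suc n - i))))"
    unfolding G by (rule wedge_minus_one_power)
  also have "(\<Sum>i<Suc n. Suc (l i + (Suc n - i))) = L + C + 2 * Suc n"
  proof -
    have "(\<Sum>i<Suc n. Suc (l i + (Suc n - i))) = (\<Sum>i<Suc n. l i + (n - i) + 2)"
      by (intro sum.cong refl) auto
    then show ?thesis by (simp only: sum.distrib L_def C_def) (simp only: sum_constant card_lessThan of_nat_id mult.commute)
  qed
  finally show ?case
    by (simp only: cf_minus_one_power_mult mult.assoc[symmetric] power_add[symmetric])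
      (simp add: power_add mult.assoc power_mult_distrib[symmetric])
qed

section \<open>Summation over the first row\<close>

definition partitions :: "nat \<Rightarrow> nat \<Rightarrow> (nat \<Rightarrow> nat) set" where
  "partitions n b = {l. (\<forall>i. l (Suc i) \<le> l i) \<and> (\<forall>i\<ge>n. l i = 0) \<and> l 0 \<le> b}"

lemma finite_partitions: "finite (partitions n b)"
proof (rule finite_subset)
  have "l i \<le> b" if "l \<in> partitions n b" for l i
    using that by (induction i) (auto simp: partitions_def intro: order_trans)
  then show "partitions n b \<subseteq> Box n (\<lambda>_. {..b})" by (auto simp: Box_def) (auto simp: partitions_def)
qed (simp add: finite_Box)

lemma partitions_Suc: "partitions (Suc n) b = (\<lambda>(x, l). case_nat x l) ` (SIGMA x:{..b}. partitions n x)"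
proof (intro equalityI subsetI)
  fix l assume "l \<in> partitions (Suc n) b"
  then have "l 0 \<in> {..b}" "(\<lambda>i. l (Suc i)) \<in> partitions n (l 0)" by (auto simp: partitions_def)
  moreover have "l = case_nat (l 0) (\<lambda>i. l (Suc i))" by (auto simp: fun_eq_iff split: nat.split)
  ultimately show "l \<in> (\<lambda>(x, l). case_nat x l) ` (SIGMA x:{..b}. partitions n x)"
    by (intro image_eqI[of _ _ "(l 0, \<lambda>i. l (Suc i))"]) auto
qed (auto simp: partitions_def split: nat.split)

text \<open>Grouping by the largest index \<open>x + Suc q\<close>, which is at least
  \<open>Suc q\<close> because \<open>q\<close> smaller positive indices follow.\<close>

lemma esum_Suc_expand:
  "esum v (b + Suc q) (Suc q) = (\<Sum>x\<le>b. v (int (x + Suc q)) * esum v (x + q) q)"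
  by (induction b) (auto simp: esum_eq_0 add.commute)

text \<open>The numbers \<open>l i + (n - i)\<close> for \<open>i < n\<close> run through the
  strictly decreasing sequences of length \<open>n\<close> in \<open>1..b + n\<close>.\<close>

lemma sum_partitions_wedge:
  "(\<Sum>l\<in>partitions n b. wedge n (\<lambda>i. v (int (l i + (n - i))))) = esum v (b + n) n"
proof (induction n arbitrary: b)
  case 0
  have "partitions 0 b = {\<lambda>_. 0}" by (auto simp: partitions_def)
  then show ?case by simp
next
  case (Suc n)
  have "inj_on (\<lambda>(x, l). case_nat x l) (SIGMA x:{..b}. partitions n x)"
  proof (rule inj_onI, clarify)
    fix x l x' l' assume eq: "case_nat x l = case_nat x' (l' :: nat \<Rightarrow> nat)"
    show "x = x' \<and> l = l'"
      using fun_cong[OF eq, of 0] fun_cong[OF eq, of "Suc _"] by (simp add: fun_eq_iff)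
  qed
  then have "(\<Sum>l\<in>partitions (Suc n) b. wedge (Suc n) (\<lambda>i. v (int (l i + (Suc n - i))))) =
      (\<Sum>(x, l)\<in>(SIGMA x:{..b}. partitions n x). v (int (x + Suc n)) * wedge n (\<lambda>i. v (int (l i + (n - i)))))"
    unfolding partitions_Suc wedge_Suc_left by (subst sum.reindex) (auto simp: o_def case_prod_beta)
  also have "\<dots> = (\<Sum>x\<le>b. \<Sum>l\<in>partitions n x. v (int (x + Suc n)) * wedge n (\<lambda>i. v (int (l i + (n - i)))))"
    by (rule sum.Sigma[symmetric]) (auto simp: finite_partitions)
  also have "\<dots> = (\<Sum>x\<le>b. v (int (x + Suc n)) * esum v (x + n) n)"
    by (simp only: sum_distrib_left[symmetric] Suc)
  finally show ?case by (simp only: esum_Suc_expand)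
qed

lemma sum_all_patterns: "(\<Sum>l\<in>partitions n b. \<Sum>h\<in>row_patterns n l. (-1) ^ pattern_sum n h) = top_coeff n (b + n)"
proof -
  have "(\<Sum>l\<in>partitions n b. \<Sum>h\<in>row_patterns n l. (-1) ^ pattern_sum n h) =
      (\<Sum>l\<in>partitions n b. cf (wedge n (\<lambda>i. phi_vector n (int (l i + (n - i))))) {..<n})"
    by (intro sum.cong refl sum_row_patterns_eq_wedge) (auto simp: partitions_def)
  also have "\<dots> = top_coeff n (b + n)"
    by (simp only: cf_sum[symmetric] sum_partitions_wedge top_coeff_def)
  finally show ?thesis .
qed

section \<open>Plane partitions and patterns\<close>

definition height :: "point set \<Rightarrow> nat \<Rightarrow> nat \<Rightarrow> nat" where
  "height P i j = card {k. (i, j, k) \<in> P}"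

text \<open>The condition says that the cell \<open>(Suc i, Suc i + d)\<close> lies strictly before
  the antidiagonal of cells with coordinate sum \<open>2 * n + 2\<close>. There the plane partitions
  in question have height at least \<open>b\<close>, so the subtraction is not truncated.\<close>

definition pattern_of :: "nat \<Rightarrow> nat \<Rightarrow> point set \<Rightarrow> nat \<Rightarrow> nat \<Rightarrow> nat" where
  "pattern_of n b P d i = (if i + d div 2 < n then height P (Suc i) (Suc i + d) - b else 0)"

text \<open>Reflection in the antidiagonal maps the row \<open>i\<close> of the diagonal \<open>j - i\<close> to the row
  \<open>2 * n + 2 - j\<close> of the same diagonal. At most one of the two entries of the pattern is nonzero.\<close>

definition pattern_height :: "nat \<Rightarrow> nat \<Rightarrow> (nat \<Rightarrow> nat \<Rightarrow> nat) \<Rightarrow> nat \<Rightarrow> nat \<Rightarrow> nat" where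
  "pattern_height n b h i j = b + h (j - i) (i - 1) - h (j - i) (2 * n + 1 - j)"

definition pp_of :: "nat \<Rightarrow> nat \<Rightarrow> (nat \<Rightarrow> nat \<Rightarrow> nat) \<Rightarrow> point set" where
  "pp_of n b h = {(i, j, k). i \<in> {1..2 * n + 1} \<and> j \<in> {1..2 * n + 1} \<and> 1 \<le> k \<and>
     k \<le> pattern_height n b h (min i j) (max i j)}"

definition patterns :: "nat \<Rightarrow> nat \<Rightarrow> (nat \<Rightarrow> nat \<Rightarrow> nat) set" where
  "patterns n b = (\<Union>l\<in>partitions n b. row_patterns n l)"

lemma patternsI:
  assumes "\<And>d i. h (Suc d) i \<le> h d i" "\<And>d i. h d (Suc i) \<le> h (Suc d) i"
    "\<And>d i. n \<le> i + d div 2 \<Longrightarrow> h d i = 0" "h 0 0 \<le> b"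
  shows "h \<in> patterns n b"
proof -
  have "h 0 \<in> partitions n b"
    using assms(3)[of _ 0] assms(4) order_trans[OF assms(2)[of 0] assms(1)[of 0]] by (auto simp: partitions_def)
  moreover have "h \<in> row_patterns n (h 0)" using assms by (simp add: row_patterns_def)
  ultimately show ?thesis by (auto simp: patterns_def)
qed

lemma patternsD:
  assumes "h \<in> patterns n b"
  shows "h (Suc d) i \<le> h d i" "h d (Suc i) \<le> h (Suc d) i" "n \<le> i + d div 2 \<Longrightarrow> h d i = 0" "h d i \<le> b"
proof -
  show 1: "h (Suc d) i \<le> h d i" "h d (Suc i) \<le> h (Suc d) i" "n \<le> i + d div 2 \<Longrightarrow> h d i = 0" for d i
    using assms by (auto simp: patterns_def row_patterns_def)
  have "h 0 i \<le> b" for i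
  proof (induction i)
    case 0
    then show ?case using assms by (auto simp: patterns_def partitions_def row_patterns_def)
  next
    case (Suc i)
    then show ?case using 1(1)[of 0 i] 1(2)[of 0 i] by simp
  qed
  then show "h d i \<le> b" by (induction d) (auto intro: order_trans[OF 1(1)])
qed

lemma sum_patterns_by_row: "(\<Sum>h\<in>patterns n b. f h) = (\<Sum>l\<in>partitions n b. \<Sum>h\<in>row_patterns n l. f h)"
  unfolding patterns_def
proof (rule sum.UNION_disjoint)
  show "\<forall>l\<in>partitions n b. finite (row_patterns n l)"
    by (intro ballI finite_row_patterns) (auto simp: partitions_def)
  show "\<forall>l\<in>partitions n b. \<forall>l'\<in>partitions n b. l \<noteq> l' \<longrightarrow> row_patterns n l \<inter> row_patterns n l' = {}"
    by (auto simp: row_patterns_def)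
qed (rule finite_partitions)

lemma card_down_closed:
  assumes "finite S" "\<And>k k'. k \<in> S \<Longrightarrow> 1 \<le> k' \<Longrightarrow> k' \<le> k \<Longrightarrow> k' \<in> S" "\<And>k. k \<in> S \<Longrightarrow> 1 \<le> (k :: nat)"
  shows "S = {1..card S}"
proof (cases "S = {}")
  case False
  define m where "m = Max S"
  have "m \<in> S" "\<And>k. k \<in> S \<Longrightarrow> k \<le> m" using assms(1) False by (simp_all add: m_def)
  then have "S \<subseteq> {1..m}" using assms(3) by (meson atLeastAtMost_iff subsetI)
  moreover have "{1..m} \<subseteq> S" using assms(2)[OF \<open>m \<in> S\<close>] by (meson atLeastAtMost_iff subsetI)
  ultimately have S: "S = {1..m}" by (rule equalityI)
  show ?thesis unfolding S by simp
qed simp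

section \<open>From plane partitions to patterns\<close>

locale stc =
  fixes n b :: nat and P :: "point set"
  assumes P: "P \<in> stc_pps (2 * n + 1) (2 * b)"
begin

lemma mem_iff: "(i, j, k) \<in> P \<longleftrightarrow> 1 \<le> k \<and> k \<le> height P i j"
proof -
  let ?S = "{k. (i, j, k) \<in> P}"
  have pp: "finite P" "\<And>i j k. (i, j, k) \<in> P \<Longrightarrow> 1 \<le> i \<and> 1 \<le> j \<and> 1 \<le> k"
    "\<And>i j k i' j' k'. (i, j, k) \<in> P \<Longrightarrow> 1 \<le> i' \<Longrightarrow> i' \<le> i \<Longrightarrow> 1 \<le> j' \<Longrightarrow> j' \<le> j \<Longrightarrow> 1 \<le> k' \<Longrightarrow> k' \<le> k \<Longrightarrow> (i', j', k') \<in> P"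
    using P by (auto simp: stc_pps_def plane_partition_def)
  have "?S \<subseteq> (\<lambda>(i, j, k). k) ` P" by force
  then have "finite ?S" using pp(1) finite_surj by blast
  then have "?S = {1..card ?S}"
    by (rule card_down_closed) (use pp(2,3) in blast)+
  then have "k \<in> ?S \<longleftrightarrow> k \<in> {1..height P i j}" by (simp add: height_def)
  then show ?thesis by simp
qed

lemma in_range: "(i, j, k) \<in> P \<Longrightarrow> i \<in> {1..2 * n + 1} \<and> j \<in> {1..2 * n + 1} \<and> k \<in> {1..2 * b}"
  using P by (auto simp: stc_pps_def in_box_def)

lemma height_le: "height P i j \<le> 2 * b"
proof (cases "height P i j")
  case (Suc m)
  then have "(i, j, height P i j) \<in> P" by (simp add: mem_iff)
  then show ?thesis using in_range by auto
qed simp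

lemma height_antimono:
  assumes "1 \<le> i'" "i' \<le> i" "1 \<le> j'" "j' \<le> j"
  shows "height P i j \<le> height P i' j'"
proof (cases "height P i j")
  case (Suc m)
  then have "(i, j, height P i j) \<in> P" by (simp add: mem_iff)
  then have "(i', j', height P i j) \<in> P"
    using P assms Suc unfolding stc_pps_def plane_partition_def by fastforce
  then show ?thesis by (simp add: mem_iff)
qed simp

lemma height_sym: "height P i j = height P j i"
proof -
  have "(i, j, k) \<in> P \<longleftrightarrow> (j, i, k) \<in> P" for k
    using P by (auto simp: stc_pps_def symmetric_pp_def)
  then show ?thesis by (simp add: height_def)
qed

text \<open>A column and the column over the mirror image of its cell in the antidiagonal, turned
  upside down, fill the height \<open>2 * b\<close>. It suffices to test the topmost cube and the
  first missing one.\<close>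

lemma height_complement:
  assumes "i \<in> {1..2 * n + 1}" "j \<in> {1..2 * n + 1}"
  shows "height P i j + height P (2 * n + 2 - j) (2 * n + 2 - i) = 2 * b"
proof -
  let ?x = "height P i j" and ?y = "height P (2 * n + 2 - j) (2 * n + 2 - i)"
  have tc: "k \<le> ?x \<longleftrightarrow> \<not> 2 * b + 1 - k \<le> ?y" if "k \<in> {1..2 * b}" for k
    using P assms that
    by (auto simp: stc_pps_def transpose_complementary_def mem_iff)
  have x: "?x \<le> 2 * b" and y: "?y \<le> 2 * b" by (rule height_le)+
  show ?thesis
  proof (rule antisym)
    show "?x + ?y \<le> 2 * b"
    proof (cases "?x = 0")
      case False
      then show ?thesis using tc[of ?x] x by auto
    qed (use y in simp)
    show "2 * b \<le> ?x + ?y"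
    proof (cases "?x = 2 * b")
      case False
      then show ?thesis using tc[of "Suc ?x"] x by auto
    qed simp
  qed
qed

text \<open>These cells are their own mirror images, so the height is half of
  \<open>2 * b\<close>.\<close>

lemma height_antidiagonal: "1 \<le> i \<Longrightarrow> i \<le> 2 * n + 1 \<Longrightarrow> height P i (2 * n + 2 - i) = b"
proof -
  assume i: "1 \<le> i" "i \<le> 2 * n + 1"
  then have "i \<in> {1..2 * n + 1}" "2 * n + 2 - i \<in> {1..2 * n + 1}" "2 * n + 2 - (2 * n + 2 - i) = i" by auto
  then have "height P i (2 * n + 2 - i) + height P i (2 * n + 2 - i) = 2 * b"
    using height_complement[of i "2 * n + 2 - i"] by simp
  then show ?thesis by simp
qed

lemma height_ge:
  assumes "1 \<le> i" "1 \<le> j" "i + j \<le> 2 * n + 2"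
  shows "b \<le> height P i j"
proof -
  have "height P i (2 * n + 2 - i) \<le> height P i j" using assms by (intro height_antimono) auto
  then show ?thesis using height_antidiagonal[of i] assms by simp
qed

lemma pattern_of_in_patterns: "pattern_of n b P \<in> patterns n b"
proof (rule patternsI)
  fix d i
  show "pattern_of n b P (Suc d) i \<le> pattern_of n b P d i"
    using height_antimono[of "Suc i" "Suc i" "Suc i + d" "Suc i + Suc d"]
    by (auto simp: pattern_of_def intro: diff_le_mono)
  show "pattern_of n b P d (Suc i) \<le> pattern_of n b P (Suc d) i"
    using height_antimono[of "Suc i" "Suc (Suc i)" "Suc i + Suc d" "Suc (Suc i) + d"]
    by (auto simp: pattern_of_def intro: diff_le_mono)
  show "pattern_of n b P 0 0 \<le> b"
    using height_le[of 1 1] by (auto simp: pattern_of_def)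
qed (simp add: pattern_of_def)

lemma height_eq_pattern_height:
  assumes "1 \<le> i" "i \<le> j" "j \<le> 2 * n + 1"
  shows "height P i j = pattern_height n b (pattern_of n b P) i j"
proof -
  consider "i + j \<le> 2 * n + 1" | "i + j = 2 * n + 2" | "i + j > 2 * n + 2" by linarith
  then show ?thesis
  proof cases
    case 1
    then have "i - 1 + (j - i) div 2 < n" "\<not> 2 * n + 1 - j + (j - i) div 2 < n" using assms by linarith+
    then show ?thesis using assms height_ge[of i j] 1 by (simp add: pattern_height_def pattern_of_def)
  next
    case 2
    then have "\<not> i - 1 + (j - i) div 2 < n" "\<not> 2 * n + 1 - j + (j - i) div 2 < n" using assms by linarith+
    moreover have "j = 2 * n + 2 - i" using 2 by simp
    ultimately show ?thesis using assms height_antidiagonal[of i] by (simp add: pattern_height_def pattern_of_def)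
  next
    case 3
    then have "\<not> i - 1 + (j - i) div 2 < n" "2 * n + 1 - j + (j - i) div 2 < n" using assms by linarith+
    moreover have "Suc (2 * n + 1 - j) = 2 * n + 2 - j" "Suc (2 * n + 1 - j) + (j - i) = 2 * n + 2 - i" using assms by auto
    moreover have "height P i j + height P (2 * n + 2 - j) (2 * n + 2 - i) = 2 * b" using assms by (intro height_complement) auto
    moreover have "b \<le> height P (2 * n + 2 - j) (2 * n + 2 - i)" using assms 3 by (intro height_ge) auto
    ultimately show ?thesis by (simp add: pattern_height_def pattern_of_def) linarith
  qed
qed

lemma pp_of_pattern_of: "pp_of n b (pattern_of n b P) = P"
proof -
  have "(i, j, k) \<in> pp_of n b (pattern_of n b P) \<longleftrightarrow> (i, j, k) \<in> P" for i j k
  proof (cases "i \<in> {1..2 * n + 1} \<and> j \<in> {1..2 * n + 1}")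
    case True
    then have "height P (min i j) (max i j) = pattern_height n b (pattern_of n b P) (min i j) (max i j)"
      by (intro height_eq_pattern_height) auto
    moreover have "height P (min i j) (max i j) = height P i j" by (cases "i \<le> j") (auto simp: min_def max_def intro: height_sym)
    ultimately show ?thesis using True by (simp add: pp_of_def mem_iff)
  next
    case False
    then show ?thesis using in_range by (auto simp: pp_of_def)
  qed
  then show ?thesis by auto
qed

text \<open>Cubes above height \<open>b\<close> lie over cells with coordinate sum at most
  \<open>2 * n + 1\<close>. Choosing the representative with \<open>i \<le> j\<close> on the
  diagonal \<open>d = j - i\<close>, the orbits over a cell are counted by its pattern
  entry.\<close>

lemma orbit_count_eq: "orbit_count b P = pattern_sum n (pattern_of n b P)"
proof -
  let ?T = "SIGMA p:{..<2 * n} \<times> {..<n}. {b<..b + pattern_of n b P (fst p) (snd p)}"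
  let ?f = "\<lambda>((d, i), k). {(Suc i, Suc i + d, k), (Suc i + d, Suc i, k)}"
  have bound: "height P i j \<le> b" if "i + j > 2 * n + 1" "1 \<le> i" "1 \<le> j" for i j
  proof (cases "i \<le> 2 * n + 1")
    case True
    have "height P i j \<le> height P i (2 * n + 2 - i)" using that True by (intro height_antimono) auto
    then show ?thesis using height_antidiagonal[of i] that True by simp
  next
    case False
    then have "(i, j, 1) \<notin> P" using in_range by auto
    then show ?thesis by (simp add: mem_iff)
  qed
  have "(\<lambda>(i, j, k). {(i, j, k), (j, i, k)}) ` {(i, j, k). (i, j, k) \<in> P \<and> b < k} = ?f ` ?T"
  proof (intro equalityI subsetI)
    fix X assume "X \<in> (\<lambda>(i, j, k). {(i, j, k), (j, i, k)}) ` {(i, j, k). (i, j, k) \<in> P \<and> b < k}"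
    then obtain i j k where X: "X = {(i, j, k), (j, i, k)}" and k: "(i, j, k) \<in> P" "b < k" by auto
    define i' j' where "i' = min i j" and "j' = max i j"
    have X': "X = {(i', j', k), (j', i', k)}" by (auto simp: X i'_def j'_def min_def max_def)
    have r: "1 \<le> i'" "i' \<le> j'" using in_range[OF k(1)] by (auto simp: i'_def j'_def)
    have h: "k \<le> height P i' j'" using k height_sym[of i j] by (auto simp: mem_iff i'_def j'_def min_def max_def)
    have s: "i' + j' \<le> 2 * n + 1" using bound[of i' j'] r h k(2) by (meson leD leI le_trans)
    define d where "d = j' - i'"
    have "i' - 1 + d div 2 < n" "d < 2 * n" using r s by (auto simp: d_def)
    moreover have "Suc (i' - 1) = i'" "i' + d = j'" using r by (auto simp: d_def)
    ultimately have "((d, i' - 1), k) \<in> ?T" using h k(2) by (auto simp: pattern_of_def)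
    moreover have "X = ?f ((d, i' - 1), k)" using \<open>Suc (i' - 1) = i'\<close> \<open>i' + d = j'\<close> by (simp add: X')
    ultimately show "X \<in> ?f ` ?T" by (rule rev_image_eqI)
  next
    fix X assume "X \<in> ?f ` ?T"
    then obtain d i k where X: "X = {(Suc i, Suc i + d, k), (Suc i + d, Suc i, k)}"
      and k: "b < k" "k \<le> b + pattern_of n b P d i" by auto
    have "i + d div 2 < n" using k by (auto simp: pattern_of_def split: if_splits)
    then have "k \<le> height P (Suc i) (Suc i + d)" using k by (auto simp: pattern_of_def)
    then have "(Suc i, Suc i + d, k) \<in> {(i, j, k). (i, j, k) \<in> P \<and> b < k}" using k by (simp add: mem_iff)
    then show "X \<in> (\<lambda>(i, j, k). {(i, j, k), (j, i, k)}) ` {(i, j, k). (i, j, k) \<in> P \<and> b < k}"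
      by (rule rev_image_eqI) (simp add: X)
  qed
  moreover have "inj_on ?f ?T"
    by (rule inj_onI) (auto simp: doubleton_eq_iff)
  ultimately have "orbit_count b P = card ?T" by (simp add: orbit_count_def card_image)
  also have "\<dots> = (\<Sum>p\<in>{..<2 * n} \<times> {..<n}. pattern_of n b P (fst p) (snd p))"
    by (subst card_SigmaI) auto
  also have "\<dots> = pattern_sum n (pattern_of n b P)"
    by (simp add: pattern_sum_def sum.cartesian_product case_prod_beta)
  finally show ?thesis .
qed

end

section \<open>From patterns to plane partitions\<close>

locale pattern =
  fixes n b :: nat and h :: "nat \<Rightarrow> nat \<Rightarrow> nat"
  assumes h: "h \<in> patterns n b"
begin

lemma pattern_height_step:
  assumes "1 \<le> i" "i \<le> j" "j \<le> 2 * n"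
  shows "pattern_height n b h i (Suc j) \<le> pattern_height n b h i j"
proof -
  have e: "Suc j - i = Suc (j - i)" "2 * n + 1 - j = Suc (2 * n + 1 - Suc j)" using assms by auto
  have "h (Suc (j - i)) (i - 1) \<le> h (j - i) (i - 1)"
    "h (j - i) (Suc (2 * n + 1 - Suc j)) \<le> h (Suc (j - i)) (2 * n + 1 - Suc j)"
    by (rule patternsD[OF h])+
  then show ?thesis unfolding pattern_height_def e by linarith
qed

lemma pattern_height_step':
  assumes "1 \<le> i" "i < j" "j \<le> 2 * n + 1"
  shows "pattern_height n b h (Suc i) j \<le> pattern_height n b h i j"
proof -
  have e: "j - i = Suc (j - Suc i)" "Suc i - 1 = Suc (i - 1)" using assms by auto
  have "h (Suc (j - Suc i)) (2 * n + 1 - j) \<le> h (j - Suc i) (2 * n + 1 - j)"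
    "h (j - Suc i) (Suc (i - 1)) \<le> h (Suc (j - Suc i)) (i - 1)"
    by (rule patternsD[OF h])+
  then show ?thesis unfolding pattern_height_def e by linarith
qed

definition H :: "nat \<Rightarrow> nat \<Rightarrow> nat" where
  "H i j = pattern_height n b h (min i j) (max i j)"

lemma H_step: "1 \<le> i \<Longrightarrow> i \<le> 2 * n + 1 \<Longrightarrow> 1 \<le> j \<Longrightarrow> j \<le> 2 * n \<Longrightarrow> H i (Suc j) \<le> H i j"
  using pattern_height_step[of i j] pattern_height_step'[of j i] by (auto simp: H_def min_def max_def not_le le_Suc_eq)

lemma H_antimono_right:
  assumes "1 \<le> i" "i \<le> 2 * n + 1" "1 \<le> j'" "j' \<le> j" "j \<le> 2 * n + 1"
  shows "H i j \<le> H i j'"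
  using assms(4,5)
proof (induction j rule: dec_induct)
  case (step j)
  then show ?case using H_step[of i j] assms by simp
qed simp

lemma H_sym: "H i j = H j i"
  by (simp add: H_def min.commute max.commute)

lemma H_antimono:
  assumes "1 \<le> i'" "i' \<le> i" "i \<le> 2 * n + 1" "1 \<le> j'" "j' \<le> j" "j \<le> 2 * n + 1"
  shows "H i j \<le> H i' j'"
  using H_antimono_right[of i j' j] H_antimono_right[of j' i' i] assms H_sym[of i j'] H_sym[of i' j'] by simp

text \<open>The two row indices and \<open>j - i\<close> add up to \<open>2 * n\<close>. Two nonzero
  entries would make the row indices and \<open>2 * ((j - i) div 2)\<close> add up to at most
  \<open>2 * n - 2\<close>.\<close>

lemma one_zero: "1 \<le> i \<Longrightarrow> i \<le> j \<Longrightarrow> j \<le> 2 * n + 1 \<Longrightarrow> h (j - i) (i - 1) = 0 \<or> h (j - i) (2 * n + 1 - j) = 0"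
  using patternsD(3)[OF h, of "i - 1" "j - i"] patternsD(3)[OF h, of "2 * n + 1 - j" "j - i"] by linarith

lemma H_complement:
  assumes "i \<in> {1..2 * n + 1}" "j \<in> {1..2 * n + 1}"
  shows "H i j + H (2 * n + 2 - j) (2 * n + 2 - i) = 2 * b"
proof -
  have *: "pattern_height n b h i j + pattern_height n b h (2 * n + 2 - j) (2 * n + 2 - i) = 2 * b"
    if "1 \<le> i" "i \<le> j" "j \<le> 2 * n + 1" for i j
  proof -
    have e: "2 * n + 2 - i - (2 * n + 2 - j) = j - i" "2 * n + 2 - j - 1 = 2 * n + 1 - j"
      "2 * n + 1 - (2 * n + 2 - i) = i - 1" using that by auto
    have "h (j - i) (i - 1) \<le> b" "h (j - i) (2 * n + 1 - j) \<le> b" by (rule patternsD[OF h])+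
    then show ?thesis unfolding pattern_height_def e using one_zero[OF that] by auto
  qed
  show ?thesis using *[of i j] *[of j i] assms by (auto simp: H_def min_def max_def)
qed

lemma pp_of_mem: "(i, j, k) \<in> pp_of n b h \<longleftrightarrow> i \<in> {1..2 * n + 1} \<and> j \<in> {1..2 * n + 1} \<and> 1 \<le> k \<and> k \<le> H i j"
  by (simp add: pp_of_def H_def)

lemma pp_of_in_stc: "pp_of n b h \<in> stc_pps (2 * n + 1) (2 * b)"
proof -
  let ?P = "pp_of n b h"
  have H_le: "H i j \<le> 2 * b" if "i \<in> {1..2 * n + 1}" "j \<in> {1..2 * n + 1}" for i j
    using H_complement[OF that] by simp
  have box: "?P \<subseteq> {1..2 * n + 1} \<times> {1..2 * n + 1} \<times> {1..2 * b}"
    using H_le by (fastforce simp: pp_of_mem)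
  then have "finite ?P" by (rule finite_subset) simp
  moreover have "(i', j', k') \<in> ?P" if "(i, j, k) \<in> ?P" "1 \<le> i'" "i' \<le> i" "1 \<le> j'" "j' \<le> j" "1 \<le> k'" "k' \<le> k" for i j k i' j' k'
    using that H_antimono[of i' i j' j] by (auto simp: pp_of_mem)
  ultimately have "plane_partition ?P" unfolding plane_partition_def by (auto simp: pp_of_mem)
  moreover have "symmetric_pp ?P" by (auto simp: symmetric_pp_def pp_of_mem H_sym)
  moreover have "transpose_complementary (2 * n + 1) (2 * b) ?P"
    unfolding transpose_complementary_def
  proof (intro ballI)
    fix i j k assume r: "i \<in> {1..2 * n + 1}" "j \<in> {1..2 * n + 1}" "k \<in> {1..2 * b}"
    have "H i j + H (2 * n + 1 + 1 - j) (2 * n + 1 + 1 - i) = 2 * b" using H_complement[OF r(1,2)] by simp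
    then show "(i, j, k) \<in> ?P \<longleftrightarrow> (2 * n + 1 + 1 - j, 2 * n + 1 + 1 - i, 2 * b + 1 - k) \<notin> ?P"
      using r by (auto simp: pp_of_mem)
  qed
  ultimately show ?thesis using box by (simp add: stc_pps_def in_box_def)
qed

lemma pattern_of_pp_of: "pattern_of n b (pp_of n b h) = h"
proof (intro ext)
  fix d i
  show "pattern_of n b (pp_of n b h) d i = h d i"
  proof (cases "i + d div 2 < n")
    case True
    then have r: "Suc i + (Suc i + d) \<le> 2 * n + 1" by linarith
    have "{k. (Suc i, Suc i + d, k) \<in> pp_of n b h} = {1..H (Suc i) (Suc i + d)}"
      using r by (auto simp: pp_of_mem)
    then have "height (pp_of n b h) (Suc i) (Suc i + d) = H (Suc i) (Suc i + d)" by (simp add: height_def)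
    moreover have "h d (2 * n + 1 - (Suc i + d)) = 0" using r by (intro patternsD(3)[OF h]) linarith
    ultimately show ?thesis using True by (simp add: pattern_of_def H_def pattern_height_def)
  next
    case False
    then show ?thesis using patternsD(3)[OF h, of i d] by (simp add: pattern_of_def)
  qed
qed

end

section \<open>The weighted count as a top coefficient\<close>

lemma weighted_count_eq: "of_int (weighted_count n b) = top_coeff n (b + n)"
proof -
  have "weighted_count n b = (\<Sum>h\<in>patterns n b. (-1) ^ pattern_sum n h)"
    unfolding weighted_count_def
  proof (rule sum.reindex_bij_witness[where i = "pp_of n b" and j = "pattern_of n b"])
    fix P assume "P \<in> stc_pps (2 * n + 1) (2 * b)"
    then interpret stc n b P by unfold_locales
    show "pp_of n b (pattern_of n b P) = P" by (rule pp_of_pattern_of)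
    show "pattern_of n b P \<in> patterns n b" by (rule pattern_of_in_patterns)
    show "(-1) ^ pattern_sum n (pattern_of n b P) = (-1 :: int) ^ orbit_count b P" by (simp add: orbit_count_eq)
  next
    fix h assume "h \<in> patterns n b"
    then interpret pattern n b h by unfold_locales
    show "pattern_of n b (pp_of n b h) = h" by (rule pattern_of_pp_of)
    show "pp_of n b h \<in> stc_pps (2 * n + 1) (2 * b)" by (rule pp_of_in_stc)
  qed
  then show ?thesis by (simp add: sum_patterns_by_row sum_all_patterns[symmetric])
qed

theorem theorem3:
  fixes \<alpha> :: nat
  shows
    "(even \<alpha> \<and> 0 < \<alpha> \<longrightarrow>
       (\<exists>p\<^sub>1 :: rat poly. p\<^sub>1 \<noteq> 0 \<and> degree p\<^sub>1 = (\<alpha> div 2)\<^sup>2 - 1 \<and>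
         (\<forall>b :: nat. even b \<longrightarrow>
            of_int (weighted_count \<alpha> b) =
              (\<Prod>k = 1..\<alpha> div 2. pochhammer (of_nat b / 2 + of_nat k) (\<alpha> div 2 + 1))
                * (of_nat b + 2 * of_nat \<alpha> + 2) * poly p\<^sub>1 (of_nat b))) \<and>
       (\<exists>p\<^sub>2 :: rat poly. p\<^sub>2 \<noteq> 0 \<and> degree p\<^sub>2 = (\<alpha> div 2)\<^sup>2 - 1 \<and>
         (\<forall>b :: nat. odd b \<longrightarrow>
            of_int (weighted_count \<alpha> b) =
              (\<Prod>k = 1..\<alpha> div 2. pochhammer ((of_nat b - 1) / 2 + of_nat k) (\<alpha> div 2 + 1))
                * (of_nat b - 1) * poly p\<^sub>2 (of_nat b)))) \<and>
     (odd \<alpha> \<longrightarrow>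
       (\<exists>p\<^sub>3 :: rat poly. p\<^sub>3 \<noteq> 0 \<and> degree p\<^sub>3 = (\<alpha>\<^sup>2 - 1) div 4 \<and>
         (\<forall>b :: nat. even b \<longrightarrow>
            of_int (weighted_count \<alpha> b) =
              (\<Prod>i = 1..(\<alpha> + 1) div 2.
                 pochhammer ((of_nat \<alpha> + of_nat b - 1) / 2 - of_nat i + 2) (2 * i - 1))
                * poly p\<^sub>3 (of_nat b))) \<and>
       (\<exists>p\<^sub>4 :: rat poly. p\<^sub>4 \<noteq> 0 \<and> degree p\<^sub>4 = (\<alpha>\<^sup>2 - 1) div 4 \<and>
         (\<forall>b :: nat. odd b \<longrightarrow>
            of_int (weighted_count \<alpha> b) =
              (\<Prod>i = 1..(\<alpha> + 1) div 2.
                 pochhammer ((of_nat b + of_nat \<alpha>) / 2 - of_nat i + 1) (2 * i - 1))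
                * poly p\<^sub>4 (of_nat b))))"
  unfolding weighted_count_eq
  by (intro conjI impI top_coeff_factorization_even top_coeff_factorization_odd; (elim conjE)?; assumption)

end
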